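(* Consider the two-firm development game described in the context. (a) If $\lambda^{\mathrm{eff}}<(1-g)(\alpha-\beta)$ and $r+\lambda^{\mathrm{eff}}>\frac{\alpha^2+\beta^2}{\alpha-\beta}$, then every subgame-perfect equilibrium (SPE) outcome starting from a safety tie ($A_{10}=A_{20}=X_0$) is perpetual joint racing, i.e. $A_{it}=A_{i0}+t$ for $i=1,2$ and all $t\ge0$. (b) If $r>\alpha$ and $g>1/2$ and the firms start from a tie on the safety threshold ($A_{10}=A_{20}=X_0$), then every SPE outcome satisfies $$\Pr(\tau_D\le t)\le1-e^{-\overline\Lambda(t)}\qquad\text{for every finite }t\ge0.$$ Also, every SPE gives each firm normalized payoff at least $\underline V_\infty$, i.e. $V_i(\sigma,h_0)\ge e^{(\alpha-\beta)X_0}\,\underline V_\infty$.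
   Context: **Primitives.** Real numbers $\alpha>\beta>0$, $r>\alpha-\beta$, $g\in(0,1)$, and a hazard function $\lambda:\mathbb R\to[0,\infty)$ with $\lambda(D)=0$ for $D\le0$ and $\lambda(D)=\lambda_0+\phi(D)$ for $D>0$, where $\lambda_0\ge0$ and $\phi:[0,\infty)\to\mathbb R$ is continuous, nondecreasing, concave, twice continuously differentiable on $(0,\infty)$, with $\phi(0)=0$. **Game.** Two firms $i\in\{1,2\}$ ($j$ denotes the other firm). A state is $S=(A_1,A_2,X)\in\mathbb R^3$; $D=\max\{A_1,A_2\}-X$. A feasible (pre-disaster) history $h_t=(S_s)_{0\le s\le t}$ is an absolutely continuous state path, from an arbitrary initial state, with $\dot A_{1s},\dot A_{2s}\in[0,1]$ and $\dot X_s=g$ for a.e. $s$. A pure strategy $\sigma_i$ prescribes a speed $\sigma_i(h_t)\in[0,1]$ after every feasible history; formally it is a map $[0,\infty)\times\Omega\to[0,1]$, $\Omega$ being the set of pairs (infinite feasible state path, disaster time $\tau_D\in[0,\infty]$), progressively measurable with respect to $\mathcal F_t=\sigma(S_{s},\mathbf 1\{\tau_D\le s\}:s\le t)$. For histories put $d(h_t,\tilde h_{t'})=|t-t'|+\sup_{s\ge0}\|h_t(s\wedge t)-\tilde h_{t'}(s\wedge t')\|$ (Euclidean norm), where $h_t(s)$ is the state of $h_t$ at date $s$. For a profile $\sigma=(\sigma_1,\sigma_2)$, $$K[\sigma](h_t)=\bigcap_{\varepsilon>0}\overline{\mathrm{co}}\{\sigma(\tilde h_{t'}):\tilde h_{t'}\text{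 feasible},\ d(h_t,\tilde h_{t'})<\varepsilon\}\subseteq[0,1]^2.$$ $\mathcal P(\sigma;h_t)$ is the set of absolutely continuous extensions of $h_t$ to $[0,\infty)$ with $(\dot A_{1s},\dot A_{2s})\in K[\sigma](h_s)$ and $\dot X_s=g$ for a.e. $s>t$ ($h_s$ = full history along the path); these are the admissible continuations. The payoff of firm $i$ is $$V_i(\sigma,h_t)=\sup_{\mathcal P(\sigma;h_t)}\int_t^\infty e^{-r(s-t)-\int_t^s\lambda(D_u)du}\,e^{\alpha A_{is}-\beta A_{js}}\,ds\in(0,\infty].$$ A pure profile $\sigma$ is an SPE if for every feasible history $h_t$, each $i$ and every strategy $\sigma_i'$, $V_i((\sigma_i',\sigma_j),h_t)\le V_i(\sigma,h_t)$. An SPE outcome is an admissible continuation under an SPE that attains both firms' assigned payoffs on that same path. Along a path, $\Pr(\tau_D>t)=\exp(-\int_0^t\lambda(D_s)ds)$. **Benchmark values.** $R(0)=\int_0^\infty e^{-(r-\alpha+\beta)t-\int_0^t\lambda((1-g)s)ds}dt$ and $\lambda^{\mathrm{eff}}=\frac1{R(0)}-(r-\alpha+\beta)$. Put $\Lambda_t^R=\int_0^t\lambda((1-g)s)\,ds$. **Payoff guarantee** ($r>\alpha$, $g>1/2$). For $\varepsilon>0$ let $T=\frac{1-g}g\varepsilon$, $\Delta=\frac{2g-1}{g(1-g)}\varepsilon$, and for $s\ge0$ let $\Gamma_\varepsilon(s)=\frac1g\int_{((1-g)\varepsilon-gs)_+}^{(1-g)\varepsilon}\lambda(D)\,dD$.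 Define $$\widetilde L_2(\varepsilon)=e^{\alpha\varepsilon}\int_0^Te^{-(r+\beta)s-\Gamma_\varepsilon(s)}ds+e^{\alpha g\varepsilon-\Gamma_\varepsilon(T)}\int_T^{T+\Delta}e^{-(r+\beta-\alpha g)s}ds+e^{-\Gamma_\varepsilon(T)-(r-\alpha+\beta)(T+\Delta)}R(0),$$ $$\widetilde L_1(\varepsilon)=\int_0^\varepsilon e^{-(r+\beta)s-\Lambda_s^R}ds+\frac{r-\alpha}{r+\beta}e^{-(r+\alpha+\beta)\varepsilon-\Lambda_\varepsilon^R}\widetilde L_2(\varepsilon),$$ $$q(\varepsilon)=\frac{r-\alpha}{r+\beta}e^{-(r+\alpha+\beta)\varepsilon-\Lambda_\varepsilon^R-\Gamma_\varepsilon(T)-(r-\alpha+\beta)(T+\Delta)}.$$ Let $\underline V_0=R(0)$ and $\underline V_{n+1}=\max\{R(0),\sup_{\varepsilon>0}[\widetilde L_1(\varepsilon)+q(\varepsilon)(\underline V_n-R(0))]\}$; this sequence is nondecreasing and $\underline V_\infty=\lim_n\underline V_n$. **Exposure ceiling.** Let $F(t)=\max\{e^{(\alpha-\beta)t},\frac{e^{\alpha t}+e^{-\beta t}}2\}$ and, for $z\in[0,\Lambda_t^R]$, $$\overline V(t,z)=\int_0^te^{-rs}F(s)\exp[-\max\{0,z-\Lambda_t^R+\Lambda_s^R\}]\,ds+e^{-z}\int_t^\infty e^{-rs}F(s)\,ds,$$ and $\overline\Lambda(t)=\max\{z\in[0,\Lambda_t^R]:\overline V(t,z)\ge\underline V_\infty\}$.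 *)

theory Defs
  imports "HOL-Analysis.Analysis"
begin

section \<open>States, feasible histories, strategies\<close>

datatype firm = Firm1 | Firm2

fun other :: "firm \<Rightarrow> firm" where
  "other Firm1 = Firm2"
| "other Firm2 = Firm1"

text \<open>A state is \<open>(A\<^sub>1, A\<^sub>2, X)\<close>; the product norm on \<open>real \<times> real \<times> real\<close> is the Euclidean one.\<close>

type_synonym state = "real \<times> real \<times> real"
type_synonym path = "real \<Rightarrow> state"

fun capability :: "firm \<Rightarrow> state \<Rightarrow> real" where
  "capability Firm1 (a1, a2, x) = a1"
| "capability Firm2 (a1, a2, x) = a2"

fun exposure :: "state \<Rightarrow> real" where
  "exposure (a1, a2, x) = max a1 a2 - x"

definition abs_continuous_on :: "real set \<Rightarrow> (real \<Rightarrow> 'a::metric_space) \<Rightarrow> bool" where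
  "abs_continuous_on I f \<longleftrightarrow>
     (\<forall>\<epsilon>>0. \<exists>\<delta>>0. \<forall>(n::nat) a b.
        (\<forall>k<n. a k \<le> b k \<and> {a k..b k} \<subseteq> I) \<longrightarrow>
        disjoint_family_on (\<lambda>k. {a k<..<b k}) {..<n} \<longrightarrow>
        (\<Sum>k<n. b k - a k) < \<delta> \<longrightarrow>
        (\<Sum>k<n. dist (f (a k)) (f (b k))) < \<epsilon>)"

text \<open>A history \<open>h\<^sub>t\<close> is encoded as a pair \<open>(t, S)\<close>. Only the values of \<open>S\<close> on \<open>{0..t}\<close> are
  relevant: every definition below depends on \<open>S\<close> only through them.\<close>

type_synonym history = "real \<times> path"

definition feasible_history :: "real \<Rightarrow> history \<Rightarrow> bool" where
  "feasible_history g = (\<lambda>(t, S). 0 \<le> t \<and> abs_continuous_on {0..t} S \<and>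
     (AE s in lborel. 0 < s \<and> s < t \<longrightarrow>
        (\<exists>v1\<in>{0..1}. \<exists>v2\<in>{0..1}. (S has_vector_derivative (v1, v2, g)) (at s))))"

definition feasible_path :: "real \<Rightarrow> path \<Rightarrow> bool" where
  "feasible_path g S \<longleftrightarrow> (\<forall>t\<ge>0. feasible_history g (t, S))"

text \<open>The sample space of pairs (infinite feasible path, disaster time) and its filtration.\<close>

type_synonym outcome = "path \<times> ennreal"

definition outcomes :: "real \<Rightarrow> outcome set" where
  "outcomes g = {S. feasible_path g S} \<times> UNIV"

definition info :: "real \<Rightarrow> real \<Rightarrow> outcome measure" where
  "info g t = sigma (outcomes g)
     ({{(S, \<tau>) \<in> outcomes g. S s \<in> B} | s B. 0 \<le> s \<and> s \<le> t \<and> B \<in> sets borel} \<union>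
      {{(S, \<tau>) \<in> outcomes g. \<tau> \<le> ennreal s} | s. 0 \<le> s \<and> s \<le> t})"

type_synonym strategy = "real \<Rightarrow> outcome \<Rightarrow> real"

definition is_strategy :: "real \<Rightarrow> strategy \<Rightarrow> bool" where
  "is_strategy g \<sigma> \<longleftrightarrow>
     (\<forall>t\<ge>0. \<forall>\<omega>\<in>outcomes g. \<sigma> t \<omega> \<in> {0..1}) \<and>
     (\<forall>t\<ge>0. (\<lambda>(s, \<omega>). \<sigma> s \<omega>) \<in>
        borel_measurable (restrict_space borel {0..t} \<Otimes>\<^sub>M info g t))"

text \<open>The speed after a pre-disaster history is read off at one infinite feasible extension with no
  disaster (here: both firms stop at \<open>t\<close>). The lemma below shows that any other feasible extension
  and any disaster time after \<open>t\<close> give the same speed.\<close>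

definition extend :: "real \<Rightarrow> history \<Rightarrow> path" where
  "extend g = (\<lambda>(t, S) s. if s \<le> t then S s else S t + (0, 0, g * (s - t)))"

definition speed :: "real \<Rightarrow> strategy \<Rightarrow> history \<Rightarrow> real" where
  "speed g \<sigma> h = \<sigma> (fst h) (extend g h, \<infinity>)"

lemma strategy_eqI:
  assumes \<sigma>: "is_strategy g \<sigma>" and t: "0 \<le> t"
    and S: "feasible_path g S" "feasible_path g S'"
    and eq: "\<And>s. 0 \<le> s \<Longrightarrow> s \<le> t \<Longrightarrow> S s = S' s"
    and \<tau>: "ennreal t < \<tau>" "ennreal t < \<tau>'"
  shows "\<sigma> t (S, \<tau>) = \<sigma> t (S', \<tau>')"
proof -
  define G where "G = {{(S, \<tau>) \<in> outcomes g. S s \<in> B} | s B. 0 \<le> s \<and> s \<le> t \<and> B \<in> sets borel} \<union>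
      {{(S, \<tau>) \<in> outcomes g. \<tau> \<le> ennreal s} | s. 0 \<le> s \<and> s \<le> t}"
  have G: "G \<subseteq> Pow (outcomes g)"
    unfolding G_def by auto
  have info: "info g t = sigma (outcomes g) G"
    unfolding info_def G_def ..
  have sets_info: "sets (info g t) = sigma_sets (outcomes g) G"
    and space_info: "space (info g t) = outcomes g"
    using G by (simp_all add: info)
  have mem: "(S, \<tau>) \<in> outcomes g" "(S', \<tau>') \<in> outcomes g"
    using S by (auto simp: outcomes_def)
  have late: "\<not> \<tau> \<le> ennreal s" "\<not> \<tau>' \<le> ennreal s" if "s \<le> t" for s
    using \<tau> ennreal_leI[OF that] by (auto simp: not_le intro: le_less_trans)
  have inv: "(S, \<tau>) \<in> A \<longleftrightarrow> (S', \<tau>') \<in> A" if "A \<in> sigma_sets (outcomes g) G" for A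
    using that
  proof induction
    case (Basic A)
    then show ?case
      unfolding G_def using mem eq late by auto
  qed (use mem in auto)
  have "(\<lambda>\<omega>. (t, \<omega>)) \<in> info g t \<rightarrow>\<^sub>M restrict_space borel {0..t} \<Otimes>\<^sub>M info g t"
    using t by (intro measurable_Pair1') (simp add: space_restrict_space)
  then have "(\<lambda>\<omega>. case (t, \<omega>) of (s, \<omega>) \<Rightarrow> \<sigma> s \<omega>) \<in> borel_measurable (info g t)"
    using \<sigma> t by (rule_tac measurable_compose) (auto simp: is_strategy_def)
  then have "\<sigma> t \<in> borel_measurable (info g t)"
    by simp
  then have "\<sigma> t -` {\<sigma> t (S, \<tau>)} \<inter> space (info g t) \<in> sets (info g t)"
    by (rule measurable_sets) simp
  then show ?thesis
    using inv[of "\<sigma> t -` {\<sigma> t (S, \<tau>)} \<inter> outcomes g"] mem by (simp add: sets_info space_info)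
qed


section \<open>Admissible continuations, payoffs, equilibrium\<close>

type_synonym profile = "firm \<Rightarrow> strategy"

fun hist_dist :: "history \<Rightarrow> history \<Rightarrow> real" where
  "hist_dist (t, S) (t', S') =
     \<bar>t - t'\<bar> + (SUP s\<in>{0..}. norm (S (min s t) - S' (min s t')))"

definition limit_speeds :: "real \<Rightarrow> profile \<Rightarrow> history \<Rightarrow> (real \<times> real) set" where
  "limit_speeds g \<sigma> h =
     (\<Inter>\<epsilon>\<in>{0<..}. closure (convex hull
        {(speed g (\<sigma> Firm1) h', speed g (\<sigma> Firm2) h') | h'. feasible_history g h' \<and> hist_dist h h' < \<epsilon>}))"

definition continuations :: "real \<Rightarrow> profile \<Rightarrow> history \<Rightarrow> path set" where
  "continuations g \<sigma> = (\<lambda>(t, S). {Y.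
     (\<forall>s\<in>{0..t}. Y s = S s) \<and>
     (\<forall>T\<ge>0. abs_continuous_on {0..T} Y) \<and>
     (AE s in lborel. t < s \<longrightarrow>
        (\<exists>v1 v2. (v1, v2) \<in> limit_speeds g \<sigma> (s, Y) \<and>
           (Y has_vector_derivative (v1, v2, g)) (at s)))})"

definition cum_hazard :: "(real \<Rightarrow> real) \<Rightarrow> path \<Rightarrow> real \<Rightarrow> real \<Rightarrow> real" where
  "cum_hazard lam Y t s = integral {t..s} (\<lambda>u. lam (exposure (Y u)))"

definition path_payoff ::
    "real \<Rightarrow> real \<Rightarrow> real \<Rightarrow> (real \<Rightarrow> real) \<Rightarrow> firm \<Rightarrow> real \<Rightarrow> path \<Rightarrow> ennreal" where
  "path_payoff \<alpha> \<beta> r lam i t Y =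
     (\<integral>\<^sup>+s\<in>{t..}. ennreal (exp (- r * (s - t) - cum_hazard lam Y t s) *
        exp (\<alpha> * capability i (Y s) - \<beta> * capability (other i) (Y s))) \<partial>lborel)"

definition payoff ::
    "real \<Rightarrow> real \<Rightarrow> real \<Rightarrow> real \<Rightarrow> (real \<Rightarrow> real) \<Rightarrow> firm \<Rightarrow> profile \<Rightarrow> history \<Rightarrow> ennreal" where
  "payoff \<alpha> \<beta> r g lam i \<sigma> h =
     (SUP Y\<in>continuations g \<sigma> h. path_payoff \<alpha> \<beta> r lam i (fst h) Y)"

definition spe :: "real \<Rightarrow> real \<Rightarrow> real \<Rightarrow> real \<Rightarrow> (real \<Rightarrow> real) \<Rightarrow> profile \<Rightarrow> bool" where
  "spe \<alpha> \<beta> r g lam \<sigma> \<longleftrightarrow>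
     (\<forall>i. is_strategy g (\<sigma> i)) \<and>
     (\<forall>h i \<sigma>'. feasible_history g h \<longrightarrow> is_strategy g \<sigma>' \<longrightarrow>
        payoff \<alpha> \<beta> r g lam i (\<sigma>(i := \<sigma>')) h \<le> payoff \<alpha> \<beta> r g lam i \<sigma> h)"

definition spe_outcome ::
    "real \<Rightarrow> real \<Rightarrow> real \<Rightarrow> real \<Rightarrow> (real \<Rightarrow> real) \<Rightarrow> history \<Rightarrow> path \<Rightarrow> bool" where
  "spe_outcome \<alpha> \<beta> r g lam h Y \<longleftrightarrow>
     (\<exists>\<sigma>. spe \<alpha> \<beta> r g lam \<sigma> \<and> Y \<in> continuations g \<sigma> h \<and>
        (\<forall>i. path_payoff \<alpha> \<beta> r lam i (fst h) Y = payoff \<alpha> \<beta> r g lam i \<sigma> h))"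

definition tie_history :: "real \<Rightarrow> history" where
  "tie_history x = (0, \<lambda>_. (x, x, x))"

text \<open>\<open>Pr(\<tau>\<^sub>D \<le> t)\<close> along a path, where \<open>Pr(\<tau>\<^sub>D > t)\<close> is given by the cumulative hazard.\<close>

definition disaster_prob :: "(real \<Rightarrow> real) \<Rightarrow> path \<Rightarrow> real \<Rightarrow> real" where
  "disaster_prob lam Y t = 1 - exp (- cum_hazard lam Y 0 t)"


section \<open>Benchmark values, payoff guarantee, exposure ceiling\<close>

definition race_hazard :: "real \<Rightarrow> (real \<Rightarrow> real) \<Rightarrow> real \<Rightarrow> real" where
  "race_hazard g lam t = integral {0..t} (\<lambda>s. lam ((1 - g) * s))"

definition race_value :: "real \<Rightarrow> real \<Rightarrow> real \<Rightarrow> real \<Rightarrow> (real \<Rightarrow> real) \<Rightarrow> real" where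
  "race_value \<alpha> \<beta> r g lam =
     integral {0..} (\<lambda>t. exp (- (r - \<alpha> + \<beta>) * t - race_hazard g lam t))"

definition effective_hazard :: "real \<Rightarrow> real \<Rightarrow> real \<Rightarrow> real \<Rightarrow> (real \<Rightarrow> real) \<Rightarrow> real" where
  "effective_hazard \<alpha> \<beta> r g lam = 1 / race_value \<alpha> \<beta> r g lam - (r - \<alpha> + \<beta>)"

definition catch_time :: "real \<Rightarrow> real \<Rightarrow> real" where
  "catch_time g \<epsilon> = (1 - g) / g * \<epsilon>"

definition follow_time :: "real \<Rightarrow> real \<Rightarrow> real" where
  "follow_time g \<epsilon> = (2 * g - 1) / (g * (1 - g)) * \<epsilon>"

definition pause_hazard :: "real \<Rightarrow> (real \<Rightarrow> real) \<Rightarrow> real \<Rightarrow> real \<Rightarrow> real" where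
  "pause_hazard g lam \<epsilon> s =
     1 / g * integral {max 0 ((1 - g) * \<epsilon> - g * s)..(1 - g) * \<epsilon>} lam"

definition L2 :: "real \<Rightarrow> real \<Rightarrow> real \<Rightarrow> real \<Rightarrow> (real \<Rightarrow> real) \<Rightarrow> real \<Rightarrow> real" where
  "L2 \<alpha> \<beta> r g lam \<epsilon> =
     (let T = catch_time g \<epsilon>; \<Delta> = follow_time g \<epsilon>; \<Gamma> = pause_hazard g lam \<epsilon> in
        exp (\<alpha> * \<epsilon>) * integral {0..T} (\<lambda>s. exp (- (r + \<beta>) * s - \<Gamma> s)) +
        exp (\<alpha> * g * \<epsilon> - \<Gamma> T) * integral {T..T + \<Delta>} (\<lambda>s. exp (- (r + \<beta> - \<alpha> * g) * s)) +
        exp (- \<Gamma> T - (r - \<alpha> + \<beta>) * (T + \<Delta>)) * race_value \<alpha> \<beta> r g lam)"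

definition L1 :: "real \<Rightarrow> real \<Rightarrow> real \<Rightarrow> real \<Rightarrow> (real \<Rightarrow> real) \<Rightarrow> real \<Rightarrow> real" where
  "L1 \<alpha> \<beta> r g lam \<epsilon> =
     integral {0..\<epsilon>} (\<lambda>s. exp (- (r + \<beta>) * s - race_hazard g lam s)) +
     (r - \<alpha>) / (r + \<beta>) * exp (- (r + \<alpha> + \<beta>) * \<epsilon> - race_hazard g lam \<epsilon>) * L2 \<alpha> \<beta> r g lam \<epsilon>"

definition q :: "real \<Rightarrow> real \<Rightarrow> real \<Rightarrow> real \<Rightarrow> (real \<Rightarrow> real) \<Rightarrow> real \<Rightarrow> real" where
  "q \<alpha> \<beta> r g lam \<epsilon> =
     (let T = catch_time g \<epsilon>; \<Delta> = follow_time g \<epsilon>; \<Gamma> = pause_hazard g lam \<epsilon> in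
        (r - \<alpha>) / (r + \<beta>) *
        exp (- (r + \<alpha> + \<beta>) * \<epsilon> - race_hazard g lam \<epsilon> - \<Gamma> T - (r - \<alpha> + \<beta>) * (T + \<Delta>)))"

fun guarantee_seq :: "real \<Rightarrow> real \<Rightarrow> real \<Rightarrow> real \<Rightarrow> (real \<Rightarrow> real) \<Rightarrow> nat \<Rightarrow> real" where
  "guarantee_seq \<alpha> \<beta> r g lam 0 = race_value \<alpha> \<beta> r g lam"
| "guarantee_seq \<alpha> \<beta> r g lam (Suc n) =
     max (race_value \<alpha> \<beta> r g lam)
       (SUP \<epsilon>\<in>{0<..}. L1 \<alpha> \<beta> r g lam \<epsilon> +
          q \<alpha> \<beta> r g lam \<epsilon> * (guarantee_seq \<alpha> \<beta> r g lam n - race_value \<alpha> \<beta> r g lam))"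

definition guarantee :: "real \<Rightarrow> real \<Rightarrow> real \<Rightarrow> real \<Rightarrow> (real \<Rightarrow> real) \<Rightarrow> real" where
  "guarantee \<alpha> \<beta> r g lam = lim (guarantee_seq \<alpha> \<beta> r g lam)"

definition average_bound :: "real \<Rightarrow> real \<Rightarrow> real \<Rightarrow> real" where
  "average_bound \<alpha> \<beta> t = max (exp ((\<alpha> - \<beta>) * t)) ((exp (\<alpha> * t) + exp (- \<beta> * t)) / 2)"

definition value_ceiling ::
    "real \<Rightarrow> real \<Rightarrow> real \<Rightarrow> real \<Rightarrow> (real \<Rightarrow> real) \<Rightarrow> real \<Rightarrow> real \<Rightarrow> real" where
  "value_ceiling \<alpha> \<beta> r g lam t z =
     integral {0..t} (\<lambda>s. exp (- r * s) * average_bound \<alpha> \<beta> s *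
        exp (- max 0 (z - race_hazard g lam t + race_hazard g lam s))) +
     exp (- z) * integral {t..} (\<lambda>s. exp (- r * s) * average_bound \<alpha> \<beta> s)"

definition exposure_ceiling ::
    "real \<Rightarrow> real \<Rightarrow> real \<Rightarrow> real \<Rightarrow> (real \<Rightarrow> real) \<Rightarrow> real \<Rightarrow> real" where
  "exposure_ceiling \<alpha> \<beta> r g lam t =
     (GREATEST z. z \<in> {0..race_hazard g lam t} \<and>
        value_ceiling \<alpha> \<beta> r g lam t z \<ge> guarantee \<alpha> \<beta> r g lam)"

end

theory Submission
  imports Defs "HOL-Complex_Analysis.Great_Picard"
begin

text \<open>Part (a): by racing forever, either firm secures the racing value at a tie. Conversely, with
  \<open>M\<close> the largest of the capabilities and the safety threshold \<open>X\<close>, and \<open>z\<close> the capability gap, the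
  average payoff is bounded by the Lyapunov function \<open>exp (- r s - \<integral>\<lambda> + (\<alpha> - \<beta>) M) v(M - X) K(z)\<close>, where
  \<open>v\<close> is the value of racing on and \<open>K\<close> solves \<open>K - K'/\<kappa> = (exp (\<beta> z) + exp (- \<alpha> z))/2\<close> with \<open>K(0) = 1\<close>.
  The first hypothesis makes slowing the frontier costly, the second leaves room for a \<open>\<kappa>\<close> below
  \<open>1 / R(0)\<close> with \<open>K' \<ge> 0\<close>; equality forces the frontier to race and the gap to vanish.

  Part (b): a firm that pauses for \<open>\<epsilon>\<close> is either still ahead or has been overtaken. In the first case it
  can wait for the threshold and follow it until the rival can tie; in the second case the rival can do
  so, and the payoffs of the two firms along a common path have a bounded ratio. Both give the next
  iterate of the guarantee. The exposure ceiling compares the guarantee with the average payoff along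
  a path of given cumulative hazard.

  All deviations hold a speed constant for some time; that they have admissible continuations
  is Filippov's existence theorem, which needs Lipschitz paths to be differentiable almost everywhere.\<close>

section \<open>Absolutely continuous and Lipschitz functions\<close>

text \<open>A deviation does not determine the path: payoffs are suprema over all solutions of a
  differential inclusion, and only the deviator's speed is known, only inside an open time window.
  Every lower bound must therefore hold against arbitrary rival speeds. Such bounds can be chained
  because the limit speeds after the window are again those of the equilibrium profile, so the value
  at its end is an equilibrium value of the history reached. Upper bounds exist only for the average
  of the two payoffs, which is why an outcome has to attain both on one path. Derivatives along a
  path exist only almost everywhere and the hazard may jump at the threshold, so the Lyapunov
  inequality is proved for almost every date and then integrated; constancy of the function yields
  the rigidity in (a). The positive loss from a slower frontier rests on concavity of
  \<open>\<phi>\<close>: an extra constant hazard c raises the reciprocal of the racing value by at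
  most c. In (b), g > 1/2 makes a lead of \<open>(1 - g) * \<epsilon>\<close> over the threshold
  vanish before the rival can tie.\<close>

lemma abs_continuous_on_deriv_nonpos:
  fixes f :: "real \<Rightarrow> real"
  assumes ac: "abs_continuous_on {a..b} f" and "a \<le> b"
    and der: "AE s in lborel. a < s \<and> s < b \<longrightarrow> (\<exists>v\<le>0. (f has_real_derivative v) (at s))"
  shows "f b \<le> f a"
proof (rule field_le_epsilon)
  fix e :: real assume "e > 0"
  \<comment> \<open>The budget for two errors: intervals tagged at good points contribute at most
    \<open>e' * (b - a)\<close>, those tagged at exceptional points at most
    \<open>e'\<close>.\<close>
  define e' where "e' = e / (2 + (b - a))"
  have "e' > 0" using \<open>e > 0\<close> \<open>a \<le> b\<close> by (simp add: e'_def)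
  have e'_le: "e' * (b - a) + e' \<le> e"
  proof -
    have "e' * (2 + (b - a)) = e" using \<open>a \<le> b\<close> by (simp add: e'_def)
    then have "e' * (b - a) + 2 * e' = e" by (simp add: algebra_simps)
    then show ?thesis using \<open>e' > 0\<close> by simp
  qed
  obtain \<delta> where "\<delta> > 0" and \<delta>: "\<And>(n::nat) u v.
        (\<forall>k<n. u k \<le> v k \<and> {u k..v k} \<subseteq> {a..b}) \<Longrightarrow>
        disjoint_family_on (\<lambda>k. {u k<..<v k}) {..<n} \<Longrightarrow>
        (\<Sum>k<n. v k - u k) < \<delta> \<Longrightarrow> (\<Sum>k<n. dist (f (u k)) (f (v k))) < e'"
    using ac \<open>e' > 0\<close> unfolding abs_continuous_on_def by meson
  obtain N0 where N0: "N0 \<in> null_sets lborel"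
    "\<And>s. s \<notin> N0 \<Longrightarrow> a < s \<and> s < b \<Longrightarrow> \<exists>v\<le>0. (f has_real_derivative v) (at s)"
    by (rule AE_E3[OF der]) auto
  \<comment> \<open>The derivative is given only inside the interval, so the endpoints join the
    exceptional set.\<close>
  define N where "N = N0 \<union> {a, b}"
  have N: "N \<in> null_sets lborel"
    unfolding N_def by (intro null_sets.Un N0(1) finite_imp_null_set_lborel) auto
  obtain U where U: "open U" "N \<subseteq> U" "emeasure lborel (U - N) < ennreal \<delta>"
    using outer_regular_lborel[of N \<delta>] N \<open>\<delta> > 0\<close> by (metis null_setsD2 sets_lborel)
  have emU: "emeasure lborel U < ennreal \<delta>"
    using U N emeasure_Diff_null_set[OF N, of U] by auto
  have ex: "\<exists>d>0. \<forall>y. \<bar>y - x\<bar> < d \<longrightarrow> (x \<le> y \<longrightarrow> f y - f x \<le> e' * (y - x)) \<and> (y \<le> x \<longrightarrow> f x - f y \<le> e' * (x - y))"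
    if "x \<in> {a..b}" "x \<notin> N" for x
  proof -
    have "x \<notin> N0" "a < x \<and> x < b" using that by (auto simp: N_def)
    then obtain v where "v \<le> 0" and v: "(f has_real_derivative v) (at x)"
      using N0(2)[of x] by blast
    from v have "(f has_derivative (\<lambda>h. v * h)) (at x)"
      by (simp add: has_field_derivative_def)
    then obtain d where "d > 0" and d: "\<And>y. norm (y - x) < d \<Longrightarrow> norm (f y - f x - v * (y - x)) \<le> e' * norm (y - x)"
      using \<open>e' > 0\<close> unfolding has_derivative_at_alt by blast
    have "(x \<le> y \<longrightarrow> f y - f x \<le> e' * (y - x)) \<and> (y \<le> x \<longrightarrow> f x - f y \<le> e' * (x - y))" if "\<bar>y - x\<bar> < d" for y
    proof -
      have *: "\<bar>f y - f x - v * (y - x)\<bar> \<le> e' * \<bar>y - x\<bar>" using d[of y] that by simp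
      show ?thesis
      proof (intro conjI impI)
        assume "x \<le> y"
        then have "v * (y - x) \<le> 0" using \<open>v \<le> 0\<close> by (simp add: mult_nonpos_nonneg)
        then show "f y - f x \<le> e' * (y - x)" using * \<open>x \<le> y\<close> by simp
      next
        assume "y \<le> x"
        then have "v * (y - x) \<ge> 0" using \<open>v \<le> 0\<close> by (simp add: mult_nonpos_nonpos)
        then show "f x - f y \<le> e' * (x - y)" using * \<open>y \<le> x\<close> by simp
      qed
    qed
    then show ?thesis using \<open>d > 0\<close> by blast
  qed
  then obtain d where d: "\<And>x. x \<in> {a..b} \<Longrightarrow> x \<notin> N \<Longrightarrow> d x > 0 \<and> (\<forall>y. \<bar>y - x\<bar> < d x \<longrightarrow>
      (x \<le> y \<longrightarrow> f y - f x \<le> e' * (y - x)) \<and> (y \<le> x \<longrightarrow> f x - f y \<le> e' * (x - y)))"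
    by metis
  \<comment> \<open>At an exceptional point the gauge is the thin open set U, whose intervals
    absolute continuity controls; at other points of the interval it is a ball on which the
    difference quotients on both sides of the tag are at most \<open>e'\<close>.\<close>
  define \<gamma> where "\<gamma> x = (if x \<in> N then U else if x \<in> {a..b} then ball x (d x) else UNIV)" for x
  have "gauge \<gamma>"
    unfolding gauge_def \<gamma>_def using U d by auto
  then obtain p where p: "p tagged_division_of {a..b}" "\<gamma> fine p"
    using fine_division_exists_real by blast
  note pD = tagged_division_ofD[OF p(1)]
  have K: "\<exists>u w. K = {u..w} \<and> u \<le> w \<and> Inf K = u \<and> Sup K = w \<and> u \<le> x \<and> x \<le> w \<and> a \<le> u \<and> w \<le> b \<and> K \<subseteq> \<gamma> x"
    if xK: "(x, K) \<in> p" for x K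
  proof -
    obtain u w where uw: "K = {u..w}" using pD(4)[OF xK] by auto
    moreover have "x \<in> K" "K \<subseteq> {a..b}" "K \<subseteq> \<gamma> x"
      using pD(2,3)[OF that] p(2) that by (auto simp: fine_def)
    ultimately show ?thesis by auto
  qed
  define p1 where "p1 = {(x, K) \<in> p. x \<in> N}"
  have fin: "finite p" using pD(1) .
  have "f b - f a = (\<Sum>(x, K)\<in>p. f (Sup K) - f (Inf K))"
    using additive_tagged_division_1[OF \<open>a \<le> b\<close> p(1), of f] by simp
  also have "\<dots> = (\<Sum>(x, K)\<in>p - p1. f (Sup K) - f (Inf K)) + (\<Sum>(x, K)\<in>p1. f (Sup K) - f (Inf K))"
    by (rule sum.subset_diff) (auto simp: p1_def fin)
  also have "(\<Sum>(x, K)\<in>p - p1. f (Sup K) - f (Inf K)) \<le> (\<Sum>(x, K)\<in>p - p1. e' * (Sup K - Inf K))"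
  proof (rule sum_mono, clarify)
    fix x K assume xK: "(x, K) \<in> p" "(x, K) \<notin> p1"
    then have xN: "x \<notin> N" by (auto simp: p1_def)
    obtain u w where uw: "K = {u..w}" "u \<le> w" "Inf K = u" "Sup K = w" "u \<le> x" "x \<le> w" "a \<le> u" "w \<le> b" "K \<subseteq> \<gamma> x"
      using K[OF xK(1)] by blast
    then have "K \<subseteq> ball x (d x)" using xN by (auto simp: \<gamma>_def)
    then have "\<bar>u - x\<bar> < d x" "\<bar>w - x\<bar> < d x"
      using uw(1,2) by (auto simp: subset_iff dist_real_def)
    then have "f w - f x \<le> e' * (w - x)" "f x - f u \<le> e' * (x - u)"
      using d[of x] xN uw by auto
    then show "f (Sup K) - f (Inf K) \<le> e' * (Sup K - Inf K)"
      unfolding uw(3,4) by (simp add: algebra_simps)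
  qed
  also have "(\<Sum>(x, K)\<in>p - p1. e' * (Sup K - Inf K)) \<le> (\<Sum>(x, K)\<in>p. e' * (Sup K - Inf K))"
  proof (rule sum_mono2)
    show "0 \<le> (case y of (x, K) \<Rightarrow> e' * (Sup K - Inf K))" if "y \<in> p - (p - p1)" for y
      using that K \<open>e' > 0\<close> by (cases y) fastforce
  qed (use fin in auto)
  also have "(\<Sum>(x, K)\<in>p. e' * (Sup K - Inf K)) = e' * (b - a)"
    using additive_tagged_division_1[OF \<open>a \<le> b\<close> p(1), of "\<lambda>x. x"]
    by (simp add: sum_distrib_left[symmetric] case_prod_unfold)
  also have "(\<Sum>(x, K)\<in>p1. f (Sup K) - f (Inf K)) \<le> e'"
  proof -
    have fin1: "finite p1" using fin by (auto simp: p1_def intro: finite_subset)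
    \<comment> \<open>Absolute continuity speaks of finite sequences of intervals, so the badly
      tagged part of the division is enumerated.\<close>
    then obtain h where h: "bij_betw h {..<card p1} p1"
      using ex_bij_betw_nat_finite[of p1] atLeast0LessThan by auto
    let ?n = "card p1"
    define u where "u k = Inf (snd (h k))" for k
    define w where "w k = Sup (snd (h k))" for k
    have hk: "snd (h k) = {u k..w k} \<and> u k \<le> w k \<and> a \<le> u k \<and> w k \<le> b \<and> {u k..w k} \<subseteq> U \<and> h k \<in> p" if "k < ?n" for k
    proof -
      have hp: "h k \<in> p1" using h that by (auto simp: bij_betw_def)
      then obtain x L where xL: "h k = (x, L)" "(x, L) \<in> p" "x \<in> N" by (auto simp: p1_def)
      then show ?thesis using K[OF xL(2)] by (auto simp: u_def w_def \<gamma>_def)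
    qed
    have disj: "disjoint_family_on (\<lambda>k. {u k<..<w k}) {..<?n}"
      unfolding disjoint_family_on_def
    proof (intro ballI impI)
      fix k l assume kl: "k \<in> {..<?n}" "l \<in> {..<?n}" "k \<noteq> l"
      then have "h k \<noteq> h l" using h by (auto simp: bij_betw_def inj_on_def)
      moreover have "h k \<in> p" "h l \<in> p" using hk kl by auto
      ultimately have "interior (snd (h k)) \<inter> interior (snd (h l)) = {}"
        using pD(5) by (metis prod.collapse)
      then show "{u k<..<w k} \<inter> {u l<..<w l} = {}"
        using hk kl by simp
    qed
    have "ennreal (\<Sum>k<?n. w k - u k) = (\<Sum>k<?n. emeasure lborel {u k<..<w k})"
      using hk by (subst sum_ennreal[symmetric]) auto
    also have "\<dots> = emeasure lborel (\<Union>k<?n. {u k<..<w k})"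
      by (intro sum_emeasure disj) auto
    also have "\<dots> \<le> emeasure lborel U"
    proof (intro emeasure_mono)
      show "(\<Union>k<?n. {u k<..<w k}) \<subseteq> U"
      proof
        fix x assume "x \<in> (\<Union>k<?n. {u k<..<w k})"
        then obtain k where "k < ?n" "x \<in> {u k..w k}" by auto
        then show "x \<in> U" using hk by blast
      qed
    qed (use U in auto)
    finally have "ennreal (\<Sum>k<?n. w k - u k) < ennreal \<delta>" using emU by (rule le_less_trans)
    then have len: "(\<Sum>k<?n. w k - u k) < \<delta>" using \<open>\<delta> > 0\<close> by (metis ennreal_leI not_le)
    have "(\<Sum>(x, K)\<in>p1. f (Sup K) - f (Inf K)) = (\<Sum>k<?n. f (w k) - f (u k))"
      by (subst sum.reindex_bij_betw[OF h, symmetric]) (simp add: u_def w_def case_prod_unfold)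
    also have "\<dots> \<le> (\<Sum>k<?n. dist (f (u k)) (f (w k)))"
      by (intro sum_mono) (auto simp: dist_real_def)
    also have "\<dots> \<le> e'"
      using \<delta>[of ?n u w] hk disj len by fastforce
    finally show ?thesis .
  qed
  finally show "f b \<le> f a + e" using e'_le by simp
qed

lemma lipschitz_imp_abs_continuous_on:
  assumes "L-lipschitz_on I f"
  shows "abs_continuous_on I f"
  unfolding abs_continuous_on_def
proof (intro allI impI)
  fix e :: real assume "e > 0"
  have L: "L \<ge> 0" using assms by (rule lipschitz_on_nonneg)
  show "\<exists>\<delta>>0. \<forall>(n::nat) a b.
        (\<forall>k<n. a k \<le> b k \<and> {a k..b k} \<subseteq> I) \<longrightarrow>
        disjoint_family_on (\<lambda>k. {a k<..<b k}) {..<n} \<longrightarrow>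
        (\<Sum>k<n. b k - a k) < \<delta> \<longrightarrow> (\<Sum>k<n. dist (f (a k)) (f (b k))) < e"
  proof (intro exI conjI allI impI)
    show "e / (L + 1) > 0" using \<open>e > 0\<close> L by simp
    fix n :: nat and a b :: "nat \<Rightarrow> real"
    assume ab: "\<forall>k<n. a k \<le> b k \<and> {a k..b k} \<subseteq> I" and s: "(\<Sum>k<n. b k - a k) < e / (L + 1)"
    have "(\<Sum>k<n. dist (f (a k)) (f (b k))) \<le> (\<Sum>k<n. L * (b k - a k))"
    proof (rule sum_mono)
      fix k assume "k \<in> {..<n}"
      then have "a k \<le> b k" "{a k..b k} \<subseteq> I" using ab by auto
      then have "a k \<in> I" "b k \<in> I" by auto
      then show "dist (f (a k)) (f (b k)) \<le> L * (b k - a k)"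
        using lipschitz_onD[OF assms, of "a k" "b k"] \<open>a k \<le> b k\<close> by (simp add: dist_real_def)
    qed
    also have "\<dots> = L * (\<Sum>k<n. b k - a k)" by (simp add: sum_distrib_left)
    also have "\<dots> \<le> L * (e / (L + 1))" using s L by (intro mult_left_mono) auto
    also have "\<dots> < e" using \<open>e > 0\<close> L by (simp add: field_simps)
    finally show "(\<Sum>k<n. dist (f (a k)) (f (b k))) < e" .
  qed
qed

section \<open>Almost everywhere differentiability of Lipschitz functions\<close>

text \<open>Since f is nondecreasing and 1-Lipschitz, x - f x is nondecreasing too, and the
  Stieltjes measures of the two add up to Lebesgue measure. So the measure of f is absolutely
  continuous, and \<open>\<phi>\<close> is its Radon-Nikodym density.\<close>

lemma monotone_lipschitz_density:
  fixes f :: "real \<Rightarrow> real"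
  assumes mono: "mono f" and lip: "1-lipschitz_on UNIV f"
  obtains \<phi> where "\<phi> \<in> borel_measurable borel" "\<And>a b. a \<le> b \<Longrightarrow> (\<integral>\<^sup>+x\<in>{a..b}. \<phi> x \<partial>lborel) = ennreal (f b - f a)"
proof -
  define h where "h x = x - f x" for x
  have monoh: "h x \<le> h y" if "x \<le> y" for x y
    using lipschitz_onD[OF lip, of x y] that by (auto simp: h_def dist_real_def)
  have contf: "continuous_on UNIV f" using lip by (rule lipschitz_on_continuous_on)
  then have conth: "continuous_on UNIV h" unfolding h_def by (intro continuous_intros)
  have cf: "continuous (at_right a) f" and cfl: "isCont f a" and ch: "continuous (at_right a) h" for a
    using contf conth by (auto simp: continuous_on_eq_continuous_at continuous_at_imp_continuous_at_within)
  let ?\<mu> = "interval_measure f" and ?\<nu> = "interval_measure h"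
  define K where "K = measure_of UNIV (sets borel) (\<lambda>A. emeasure ?\<mu> A + emeasure ?\<nu> A)"
  have sK: "sets K = sets borel" 
    unfolding K_def using sets.sigma_sets_eq[of "borel :: real measure"] by simp
  have emK: "emeasure K A = emeasure ?\<mu> A + emeasure ?\<nu> A" if "A \<in> sets borel" for A
    unfolding K_def
  proof (rule emeasure_measure_of[where \<Omega>=UNIV and A="sets borel"])
    show "countably_additive (sets (measure_of UNIV (sets borel) (\<lambda>A. emeasure ?\<mu> A + emeasure ?\<nu> A)))
       (\<lambda>A. emeasure ?\<mu> A + emeasure ?\<nu> A)"
    proof (rule countably_additiveI)
      fix F :: "nat \<Rightarrow> real set" assume F: "range F \<subseteq> sets (measure_of UNIV (sets borel) (\<lambda>A. emeasure ?\<mu> A + emeasure ?\<nu> A))" "disjoint_family F"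
      then have F': "range F \<subseteq> sets borel" using sK by (simp add: K_def)
      show "(\<Sum>i. emeasure ?\<mu> (F i) + emeasure ?\<nu> (F i)) = emeasure ?\<mu> (\<Union> (range F)) + emeasure ?\<nu> (\<Union> (range F))"
        using F' F(2) by (subst suminf_add[symmetric]) (auto intro!: suminf_emeasure arg_cong2[where f="(+)"])
    qed
  qed (use that sK in \<open>auto simp: positive_def K_def\<close>)
  have "lborel = K"
  proof (rule lborel_eqI)
    show "emeasure K (box l u) = ennreal (\<Prod>b\<in>Basis. (u - l) \<bullet> b)" if "\<And>b. b \<in> Basis \<Longrightarrow> l \<bullet> b \<le> u \<bullet> b" for l u :: real
    proof -
      have lu: "l \<le> u" using that by auto
      have box: "box l u = {l<..u} - {u}" by auto
      have 1: "emeasure (interval_measure q) {u} = 0" if "\<And>x y. x \<le> y \<Longrightarrow> q x \<le> q y" "continuous_on UNIV q" for q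
        using emeasure_interval_measure_Icc[of u u q] that by auto
      have 2: "emeasure (interval_measure q) (box l u) = ennreal (q u - q l)"
        if "\<And>x y. x \<le> y \<Longrightarrow> q x \<le> q y" "continuous_on UNIV q" for q
      proof -
        have "{u} \<in> null_sets (interval_measure q)" using 1[OF that] by auto
        then have "emeasure (interval_measure q) (box l u) = emeasure (interval_measure q) {l<..u}"
          unfolding box by (rule emeasure_Diff_null_set) auto
        then show ?thesis
          using that lu by (simp add: emeasure_interval_measure_Ioc continuous_on_eq_continuous_at continuous_at_imp_continuous_at_within)
      qed
      have "emeasure K (box l u) = ennreal (f u - f l) + ennreal (h u - h l)"
        using 2[of f] 2[of h] monoh conth contf mono by (simp add: emK monoD)
      also have "\<dots> = ennreal (u - l)"
        using monoh[OF lu] monoD[OF mono lu] by (subst ennreal_plus[symmetric]) (auto simp: h_def)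
      finally show ?thesis by simp
    qed
  qed (simp add: sK)
  then have "absolutely_continuous lborel ?\<mu>"
    unfolding absolutely_continuous_def using emK sK by (auto simp: null_sets_def)
  then obtain \<phi> where \<phi>: "\<phi> \<in> borel_measurable lborel" "density lborel \<phi> = ?\<mu>"
    using sigma_finite_measure.Radon_Nikodym[OF sigma_finite_lborel, of ?\<mu>] by auto
  show ?thesis
  proof
    fix a b :: real assume "a \<le> b"
    have "(\<integral>\<^sup>+x\<in>{a..b}. \<phi> x \<partial>lborel) = emeasure (density lborel \<phi>) {a..b}"
      using \<phi>(1) by (simp add: emeasure_density)
    also have "\<dots> = ennreal (f b - f a)"
      unfolding \<phi>(2) using \<open>a \<le> b\<close> mono contf by (intro emeasure_interval_measure_Icc) (auto simp: monoD)
    finally show "(\<integral>\<^sup>+x\<in>{a..b}. \<phi> x \<partial>lborel) = ennreal (f b - f a)" .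
  qed (use \<phi> in simp)
qed

text \<open>With f the integral of its density, right difference quotients converge at almost every
  point by the Lebesgue differentiation theorem for cubes based at x; left quotients are right
  quotients of the reflected density.\<close>

lemma monotone_lipschitz_AE_differentiable:
  fixes f :: "real \<Rightarrow> real"
  assumes mono: "mono f" and lip: "1-lipschitz_on UNIV f"
  shows "AE x in lborel. \<exists>v. (f has_real_derivative v) (at x)"
proof -
  obtain \<phi> where [measurable]: "\<phi> \<in> borel_measurable borel"
    and \<phi>: "\<And>a b. a \<le> b \<Longrightarrow> (\<integral>\<^sup>+x\<in>{a..b}. \<phi> x \<partial>lborel) = ennreal (f b - f a)"
    using monotone_lipschitz_density[OF assms] by metis
  \<comment> \<open>The density is extended-valued, but its finite integrals make it finite almost
    everywhere on each interval, so the default value of \<open>enn2real\<close> at infinity changes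
    no integral.\<close>
  define \<psi> where "\<psi> x = enn2real (\<phi> x)" for x
  have [measurable]: "\<psi> \<in> borel_measurable borel" unfolding \<psi>_def by measurable
  have has_int: "(\<psi> has_integral (f b - f a)) {a..b}" if "a \<le> b" for a b
  proof -
    have ne: "(\<integral>\<^sup>+x. \<phi> x * indicator {a..b} x \<partial>lborel) \<noteq> \<infinity>" using \<phi>[OF that] by simp
    have "AE x in lborel. \<phi> x * indicator {a..b} x \<noteq> \<infinity>"
      by (rule nn_integral_PInf_AE[OF _ ne]) measurable
    then have "(\<integral>\<^sup>+x. ennreal (\<psi> x * indicator {a..b} x) \<partial>lborel) = (\<integral>\<^sup>+x. \<phi> x * indicator {a..b} x \<partial>lborel)"
    proof (intro nn_integral_cong_AE, rule eventually_mono)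
      fix x assume "\<phi> x * indicator {a..b} x \<noteq> \<infinity>"
      then show "ennreal (\<psi> x * indicator {a..b} x) = \<phi> x * indicator {a..b} x"
        by (cases "x \<in> {a..b}") (simp_all add: \<psi>_def less_top)
    qed
    also have "\<dots> = ennreal (f b - f a)" by (rule \<phi>[OF that])
    finally have nn: "(\<integral>\<^sup>+x. ennreal (\<psi> x * indicator {a..b} x) \<partial>lborel) = ennreal (f b - f a)" .
    have "((\<lambda>x. \<psi> x * indicator {a..b} x) has_integral (f b - f a)) UNIV"
      by (rule nn_integral_has_integral[OF _ _ nn])
        (use monoD[OF mono that] in \<open>auto simp: \<psi>_def split: split_indicator\<close>)
    moreover have "(\<lambda>x. \<psi> x * indicator {a..b} x) = (\<lambda>x. if x \<in> {a..b} then \<psi> x else 0)"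
      by (auto split: split_indicator)
    ultimately show ?thesis by (simp only: has_integral_restrict_UNIV)
  qed
  have refl: "((\<lambda>x. \<psi> (- x)) has_integral (f (-a) - f (-b))) {a..b}" if "a \<le> b" for a b
    using has_integral_reflect_lemma[of \<psi> "f (-a) - f (-b)" "-b" "-a"] has_int[of "-b" "-a"] that by simp
  have intg: "\<psi> integrable_on cbox a b" "(\<lambda>x. \<psi> (- x)) integrable_on cbox a b" for a b
    using has_int[of a b] refl[of a b] by (cases "a \<le> b"; auto simp: integrable_on_def)+
  obtain N1 where N1: "negligible N1" "\<And>x e. \<lbrakk>x \<notin> N1; 0 < e\<rbrakk> \<Longrightarrow> \<exists>d>0. \<forall>h. 0 < h \<and> h < d \<longrightarrow>
       norm(integral (cbox x (x + h *\<^sub>R One)) \<psi> /\<^sub>R h ^ DIM(real) - \<psi> x) < e"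
    using integrable_ccontinuous_explicit[of \<psi>] intg(1) by auto
  obtain N2 where N2: "negligible N2" "\<And>x e. \<lbrakk>x \<notin> N2; 0 < e\<rbrakk> \<Longrightarrow> \<exists>d>0. \<forall>h. 0 < h \<and> h < d \<longrightarrow>
       norm(integral (cbox x (x + h *\<^sub>R One)) (\<lambda>x. \<psi> (- x)) /\<^sub>R h ^ DIM(real) - \<psi> (- x)) < e"
    using integrable_ccontinuous_explicit[of "\<lambda>x. \<psi> (- x)"] intg(2) by auto
  have deriv: "(f has_real_derivative \<psi> x) (at x)" if x: "x \<notin> N1" "- x \<notin> N2" for x
    unfolding DERIV_def
  proof (rule LIM_I)
    fix e :: real assume "e > 0"
    obtain d1 where "d1 > 0" and d1: "\<And>h. 0 < h \<Longrightarrow> h < d1 \<Longrightarrow> norm (integral {x..x + h} \<psi> / h - \<psi> x) < e"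
      using N1(2)[OF x(1) \<open>e > 0\<close>] by (auto simp: divide_inverse mult.commute)
    obtain d2 where "d2 > 0" and d2: "\<And>h. 0 < h \<Longrightarrow> h < d2 \<Longrightarrow> norm (integral {-x..-x + h} (\<lambda>x. \<psi> (- x)) / h - \<psi> x) < e"
      using N2(2)[OF x(2) \<open>e > 0\<close>] by (auto simp: divide_inverse mult.commute)
    show "\<exists>s>0. \<forall>h. h \<noteq> 0 \<and> norm (h - 0) < s \<longrightarrow> norm ((f (x + h) - f x) / h - \<psi> x) < e"
    proof (intro exI conjI allI impI)
      show "min d1 d2 > 0" using \<open>d1 > 0\<close> \<open>d2 > 0\<close> by simp
      fix h :: real assume h: "h \<noteq> 0 \<and> norm (h - 0) < min d1 d2"
      show "norm ((f (x + h) - f x) / h - \<psi> x) < e"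
      proof (cases "h > 0")
        case True
        then have "integral {x..x + h} \<psi> = f (x + h) - f x"
          using has_int[of x "x + h"] by (simp add: integral_unique)
        then show ?thesis using d1[of h] h True by simp
      next
        case False
        then have "integral {-x..-x + (- h)} (\<lambda>x. \<psi> (- x)) = f x - f (x + h)"
          using refl[of "-x" "-x + (- h)"] by (simp add: integral_unique algebra_simps)
        moreover have "(f x - f (x + h)) / (- h) = (f (x + h) - f x) / h"
          using h by (simp add: field_simps)
        ultimately show ?thesis using d2[of "- h"] h False by auto
      qed
    qed
  qed
  have "negligible (uminus ` N2)"
    using N2(1) by (intro negligible_differentiable_image_negligible) (auto intro!: derivative_intros)
  then have "negligible (N1 \<union> uminus ` N2)" using N1(1) by (rule negligible_Un[rotated])
  then have "AE x in lebesgue. x \<notin> N1 \<union> uminus ` N2"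
    by (intro AE_not_in) (simp add: negligible_iff_null_sets)
  then have "AE x in lborel. x \<notin> N1 \<union> uminus ` N2"
    by (simp add: AE_completion_iff)
  then show ?thesis
  proof (rule eventually_mono)
    fix x assume "x \<notin> N1 \<union> uminus ` N2"
    then have "x \<notin> N1" "- x \<notin> N2" by (auto simp: image_iff)
    then show "\<exists>v. (f has_real_derivative v) (at x)" using deriv by blast
  qed
qed

text \<open>Clamping the argument extends f to the line; adding \<open>L' * x\<close> makes it
  monotone and dividing by \<open>2 * L'\<close> makes it 1-Lipschitz. The choice
  \<open>L' = L + 1\<close> keeps the divisor positive.\<close>

lemma lipschitz_AE_differentiable:
  fixes f :: "real \<Rightarrow> real"
  assumes lip: "L-lipschitz_on {a..b} f"
  shows "AE x in lborel. a < x \<and> x < b \<longrightarrow> (\<exists>v. (f has_real_derivative v) (at x))"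
proof (cases "a < b")
  case True
  define L' where "L' = L + 1"
  have L': "L' > 0" using lipschitz_on_nonneg[OF lip] by (simp add: L'_def)
  define c where "c x = max a (min b x)" for x
  define q where "q x = (f (c x) + L' * x) / (2 * L')" for x
  have cl: "\<bar>f (c x) - f (c y)\<bar> \<le> L' * \<bar>x - y\<bar>" for x y
  proof -
    have cc: "c x \<in> {a..b}" "c y \<in> {a..b}" using True by (auto simp: c_def)
    have "\<bar>f (c x) - f (c y)\<bar> \<le> L * \<bar>c x - c y\<bar>"
      using lipschitz_onD[OF lip cc] by (simp add: dist_real_def)
    also have "\<dots> \<le> L' * \<bar>x - y\<bar>"
      using lipschitz_on_nonneg[OF lip] by (intro mult_mono) (auto simp: L'_def c_def)
    finally show ?thesis .
  qed
  have "AE x in lborel. \<exists>v. (q has_real_derivative v) (at x)"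
  proof (rule monotone_lipschitz_AE_differentiable)
    show "mono q"
    proof (rule monoI)
      fix x y :: real assume "x \<le> y"
      then show "q x \<le> q y" using cl[of x y] L' unfolding q_def
          by (intro divide_right_mono) (simp_all add: abs_le_iff algebra_simps)
    qed
    show "1-lipschitz_on UNIV q"
    proof (rule lipschitz_onI)
      fix x y :: real
      have "\<bar>(f (c x) - f (c y)) + L' * (x - y)\<bar> \<le> \<bar>f (c x) - f (c y)\<bar> + \<bar>L' * (x - y)\<bar>" by (rule abs_triangle_ineq)
      also have "\<dots> \<le> 2 * L' * \<bar>x - y\<bar>" using cl[of x y] L' by (simp add: abs_mult)
      finally have "\<bar>(f (c x) - f (c y)) + L' * (x - y)\<bar> \<le> 2 * L' * \<bar>x - y\<bar>" .
      moreover have "q x - q y = ((f (c x) - f (c y)) + L' * (x - y)) / (2 * L')"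
        by (simp add: q_def diff_divide_distrib add_divide_distrib algebra_simps)
      ultimately have "\<bar>q x - q y\<bar> * (2 * L') \<le> \<bar>x - y\<bar> * (2 * L')"
        using L' by (simp add: abs_divide algebra_simps)
      then show "dist (q x) (q y) \<le> 1 * dist x y"
        using L' by (simp add: dist_real_def)
    qed simp
  qed
  then show ?thesis
  proof (rule eventually_mono, intro impI)
    fix x assume "\<exists>v. (q has_real_derivative v) (at x)" and x: "a < x \<and> x < b"
    then obtain v where v: "(q has_real_derivative v) (at x)" by blast
    have "((\<lambda>y. 2 * L' * q y - L' * y) has_real_derivative 2 * L' * v - L') (at x)"
      by (auto intro!: derivative_eq_intros v)
    then have "(f has_real_derivative 2 * L' * v - L') (at x)"
    proof (rule has_field_derivative_transform_within_open[of _ _ _ "{a<..<b}"])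
      show "2 * L' * q y - L' * y = f y" if "y \<in> {a<..<b}" for y
        using that L' by (simp add: q_def c_def)
    qed (use x in auto)
    then show "\<exists>v. (f has_real_derivative v) (at x)" by blast
  qed
qed auto

section \<open>Feasible paths\<close>

lemma abs_continuous_on_subset:
  assumes "abs_continuous_on I f" "J \<subseteq> I"
  shows "abs_continuous_on J f"
  using assms unfolding abs_continuous_on_def by (meson order_trans)

text \<open>Subtracting \<open>c * s\<close> from \<open>F (S s)\<close> leaves an absolutely
  continuous scalar function with nonpositive derivative. Applied to plus and minus a coordinate,
  this turns constraints on velocities into constraints on increments.\<close>

lemma abs_continuous_on_linear_increment_le:
  fixes S :: "real \<Rightarrow> 'a::real_normed_vector" and F :: "'a \<Rightarrow> real"
  assumes ac: "abs_continuous_on {a..b} S" and F: "bounded_linear F" and "a \<le> b"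
    and der: "AE s in lborel. a < s \<and> s < b \<longrightarrow> (\<exists>v. (S has_vector_derivative v) (at s) \<and> F v \<le> c)"
  shows "F (S b) - F (S a) \<le> c * (b - a)"
proof -
  obtain K where K: "K > 0" "\<And>x. norm (F x) \<le> norm x * K"
    using bounded_linear.pos_bounded[OF F] by blast
  define f where "f s = F (S s) - c * s" for s
  have "f b \<le> f a"
  proof (rule abs_continuous_on_deriv_nonpos[OF _ \<open>a \<le> b\<close>])
    show "abs_continuous_on {a..b} f"
      unfolding abs_continuous_on_def
    proof (intro allI impI)
      fix e :: real assume "e > 0"
      then have "e / (2 * K) > 0" using K by simp
      then obtain d where "d > 0" and d: "\<And>(n::nat) u v. (\<forall>k<n. u k \<le> v k \<and> {u k..v k} \<subseteq> {a..b}) \<Longrightarrow>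
        disjoint_family_on (\<lambda>k. {u k<..<v k}) {..<n} \<Longrightarrow>
        (\<Sum>k<n. v k - u k) < d \<Longrightarrow> (\<Sum>k<n. dist (S (u k)) (S (v k))) < e / (2 * K)"
        using ac unfolding abs_continuous_on_def by meson
      define d' where "d' = min d (e / (2 * (\<bar>c\<bar> + 1)))"
      show "\<exists>\<delta>>0. \<forall>(n::nat) u v. (\<forall>k<n. u k \<le> v k \<and> {u k..v k} \<subseteq> {a..b}) \<longrightarrow>
        disjoint_family_on (\<lambda>k. {u k<..<v k}) {..<n} \<longrightarrow>
        (\<Sum>k<n. v k - u k) < \<delta> \<longrightarrow> (\<Sum>k<n. dist (f (u k)) (f (v k))) < e"
      proof (intro exI conjI allI impI)
        show "d' > 0" using \<open>d > 0\<close> \<open>e > 0\<close> by (simp add: d'_def)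
        fix n :: nat and u v :: "nat \<Rightarrow> real"
        assume uv: "\<forall>k<n. u k \<le> v k \<and> {u k..v k} \<subseteq> {a..b}"
          and *: "disjoint_family_on (\<lambda>k. {u k<..<v k}) {..<n}" and len: "(\<Sum>k<n. v k - u k) < d'"
        have "(\<Sum>k<n. dist (f (u k)) (f (v k))) \<le> (\<Sum>k<n. K * dist (S (u k)) (S (v k)) + \<bar>c\<bar> * (v k - u k))"
        proof (rule sum_mono)
          fix k assume "k \<in> {..<n}"
          then have le: "u k \<le> v k" using uv by auto
          have "\<bar>f (u k) - f (v k)\<bar> = \<bar>F (S (u k) - S (v k)) + c * (v k - u k)\<bar>"
            using F by (simp add: f_def linear_diff bounded_linear.linear algebra_simps)
          also have "\<dots> \<le> \<bar>F (S (u k) - S (v k))\<bar> + \<bar>c * (v k - u k)\<bar>" by (rule abs_triangle_ineq)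
          also have "\<dots> \<le> K * norm (S (u k) - S (v k)) + \<bar>c\<bar> * (v k - u k)"
            using K(2)[of "S (u k) - S (v k)"] le by (simp add: abs_mult mult.commute)
          finally show "dist (f (u k)) (f (v k)) \<le> K * dist (S (u k)) (S (v k)) + \<bar>c\<bar> * (v k - u k)"
            by (simp add: dist_norm)
        qed
        also have "\<dots> = K * (\<Sum>k<n. dist (S (u k)) (S (v k))) + \<bar>c\<bar> * (\<Sum>k<n. v k - u k)"
          by (simp add: sum.distrib sum_distrib_left)
        also have "\<dots> < K * (e / (2 * K)) + e / 2"
        proof (rule add_less_le_mono)
          show "K * (\<Sum>k<n. dist (S (u k)) (S (v k))) < K * (e / (2 * K))"
            using d[OF uv *] len K by (intro mult_strict_left_mono) (auto simp: d'_def)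
          have "\<bar>c\<bar> * (\<Sum>k<n. v k - u k) \<le> \<bar>c\<bar> * (e / (2 * (\<bar>c\<bar> + 1)))"
            using len by (intro mult_left_mono) (auto simp: d'_def)
          also have "\<dots> \<le> e / 2" using \<open>e > 0\<close> by (simp add: field_simps)
          finally show "\<bar>c\<bar> * (\<Sum>k<n. v k - u k) \<le> e / 2" .
        qed
        also have "\<dots> = e" using K by simp
        finally show "(\<Sum>k<n. dist (f (u k)) (f (v k))) < e" .
      qed
    qed
    show "AE s in lborel. a < s \<and> s < b \<longrightarrow> (\<exists>v\<le>0. (f has_real_derivative v) (at s))"
      using der
    proof (rule eventually_mono, intro impI)
      fix s assume "a < s \<and> s < b \<longrightarrow> (\<exists>v. (S has_vector_derivative v) (at s) \<and> F v \<le> c)" "a < s \<and> s < b"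
      then obtain v where v: "(S has_vector_derivative v) (at s)" "F v \<le> c" by blast
      have "((\<lambda>s. F (S s)) has_vector_derivative F v) (at s)"
        by (rule bounded_linear.has_vector_derivative[OF F v(1)])
      then have "((\<lambda>s. F (S s)) has_real_derivative F v) (at s)"
        by (simp add: has_real_derivative_iff_has_vector_derivative)
      then have "(f has_real_derivative (F v - c)) (at s)"
        unfolding f_def by (auto intro!: derivative_eq_intros)
      moreover have "F v - c \<le> 0" using v(2) by simp
      ultimately show "\<exists>v\<le>0. (f has_real_derivative v) (at s)" by blast
    qed
  qed
  then show ?thesis by (simp add: f_def algebra_simps)
qed

lemma has_vector_derivative_quotient_tendsto:
  assumes "(Y has_vector_derivative w) (at s)"
  shows "((\<lambda>h. (Y (s + h) - Y s) /\<^sub>R h) \<longlongrightarrow> w) (at_right 0)"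
proof -
  have "((\<lambda>h. norm (Y (s + h) - Y s - h *\<^sub>R w) / norm h) \<longlongrightarrow> 0) (at 0)"
    using assms unfolding has_vector_derivative_def has_derivative_at by auto
  then have "((\<lambda>h. norm (Y (s + h) - Y s - h *\<^sub>R w) / norm h) \<longlongrightarrow> 0) (at_right 0)"
    by (rule tendsto_mono[rotated]) (simp add: at_le)
  moreover have "\<forall>\<^sub>F h in at_right 0. norm (Y (s + h) - Y s - h *\<^sub>R w) / norm h = norm ((Y (s + h) - Y s) /\<^sub>R h - w)"
    unfolding eventually_at_filter
  proof (intro always_eventually allI impI)
    fix h :: real assume "h \<noteq> 0" "h \<in> {0<..}"
    then have "(Y (s + h) - Y s) /\<^sub>R h - w = (Y (s + h) - Y s - h *\<^sub>R w) /\<^sub>R h"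
      by (simp add: scaleR_diff_right)
    then show "norm (Y (s + h) - Y s - h *\<^sub>R w) / norm h = norm ((Y (s + h) - Y s) /\<^sub>R h - w)"
      by (simp add: divide_inverse mult.commute)
  qed
  ultimately have "((\<lambda>h. norm ((Y (s + h) - Y s) /\<^sub>R h - w)) \<longlongrightarrow> 0) (at_right 0)"
    by (rule Lim_transform_eventually)
  then show ?thesis by (simp add: tendsto_norm_zero_iff LIM_zero_iff)
qed

lemma has_vector_derivative_in_closed:
  assumes "(Y has_vector_derivative w) (at s)" "closed C" "d > 0"
    and "\<And>h. 0 < h \<Longrightarrow> h < d \<Longrightarrow> (Y (s + h) - Y s) /\<^sub>R h \<in> C"
  shows "w \<in> C"
proof (rule Lim_in_closed_set[OF assms(2) _ _ has_vector_derivative_quotient_tendsto[OF assms(1)]])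
  show "\<forall>\<^sub>F h in at_right 0. (Y (s + h) - Y s) /\<^sub>R h \<in> C"
    using assms(3,4) by (auto simp: eventually_at_right_field)
qed simp

text \<open>Feasibility without derivatives: the integrated velocity constraint. In this form it
  passes to pasted paths and to pointwise limits, and it yields the Lipschitz bounds.\<close>

definition bounded_speed :: "real \<Rightarrow> real set \<Rightarrow> path \<Rightarrow> bool" where
  "bounded_speed g I S \<longleftrightarrow> (\<forall>s\<in>I. \<forall>s'\<in>I. s \<le> s' \<longrightarrow>
     fst (S s') - fst (S s) \<in> {0..s' - s} \<and>
     fst (snd (S s')) - fst (snd (S s)) \<in> {0..s' - s} \<and>
     snd (snd (S s')) - snd (snd (S s)) = g * (s' - s))"

lemma capability_proj: "capability Firm1 p = fst p" "capability Firm2 p = fst (snd p)"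
  by (cases p; simp)+

lemma exposure_proj: "exposure p = max (fst p) (fst (snd p)) - snd (snd p)"
  by (cases p) simp

lemma bounded_speed_subset: "bounded_speed g I S \<Longrightarrow> J \<subseteq> I \<Longrightarrow> bounded_speed g J S"
  unfolding bounded_speed_def by blast

lemma bounded_speed_cong: "(\<And>s. s \<in> I \<Longrightarrow> S s = S' s) \<Longrightarrow> bounded_speed g I S \<longleftrightarrow> bounded_speed g I S'"
  unfolding bounded_speed_def by auto

lemma bounded_speed_union:
  assumes "bounded_speed g {a..b} S" "bounded_speed g {b..c} S"
  shows "bounded_speed g {a..c} S"
  unfolding bounded_speed_def
proof (intro ballI impI)
  fix s s' assume s: "s \<in> {a..c}" "s' \<in> {a..c}" "s \<le> s'"
  consider "s' \<le> b" | "b \<le> s" | "s \<le> b" "b \<le> s'" by linarith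
  then show "fst (S s') - fst (S s) \<in> {0..s' - s} \<and> fst (snd (S s')) - fst (snd (S s)) \<in> {0..s' - s} \<and>
      snd (snd (S s')) - snd (snd (S s)) = g * (s' - s)"
  proof cases
    case 3
    have 1: "fst (S b) - fst (S s) \<in> {0..b - s} \<and> fst (snd (S b)) - fst (snd (S s)) \<in> {0..b - s} \<and>
      snd (snd (S b)) - snd (snd (S s)) = g * (b - s)"
      using assms(1) s 3 unfolding bounded_speed_def by auto
    have 2: "fst (S s') - fst (S b) \<in> {0..s' - b} \<and> fst (snd (S s')) - fst (snd (S b)) \<in> {0..s' - b} \<and>
      snd (snd (S s')) - snd (snd (S b)) = g * (s' - b)"
      using assms(2) s 3 unfolding bounded_speed_def by auto
    from 1 2 show ?thesis by (auto simp: algebra_simps)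
  qed (use assms s in \<open>auto simp: bounded_speed_def\<close>)
qed

context
  fixes g :: real
  assumes g: "0 < g" "g < 1"
begin

lemma bounded_speed_lipschitz:
  assumes "bounded_speed g I S"
  shows "3-lipschitz_on I S"
proof (rule lipschitz_onI)
  have *: "dist (S s) (S s') \<le> 3 * dist s s'" if "s \<in> I" "s' \<in> I" "s \<le> s'" for s s'
  proof -
    have b: "fst (S s') - fst (S s) \<in> {0..s' - s} \<and> fst (snd (S s')) - fst (snd (S s)) \<in> {0..s' - s} \<and>
      snd (snd (S s')) - snd (snd (S s)) = g * (s' - s)"
      using assms that unfolding bounded_speed_def by auto
    have "norm (S s' - S s) \<le> norm (fst (S s') - fst (S s)) + (norm (fst (snd (S s')) - fst (snd (S s))) + norm (snd (snd (S s')) - snd (snd (S s))))"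
      using norm_Pair_le[of "fst (S s') - fst (S s)" "snd (S s') - snd (S s)"]
        norm_Pair_le[of "fst (snd (S s')) - fst (snd (S s))" "snd (snd (S s')) - snd (snd (S s))"]
      by (simp add: minus_prod_def)
    also have "\<dots> \<le> (s' - s) + ((s' - s) + g * (s' - s))"
      using b g that by auto
    also have "\<dots> \<le> 3 * (s' - s)"
      using g that mult_right_mono[of g 1 "s' - s"] by auto
    finally show ?thesis using that by (simp add: dist_norm norm_minus_commute)
  qed
  show "dist (S s) (S s') \<le> 3 * dist s s'" if "s \<in> I" "s' \<in> I" for s s'
    using *[of s s'] *[of s' s] that by (cases "s \<le> s'") (auto simp: dist_commute)
qed simp

lemma bounded_speed_component_lipschitz:
  assumes "bounded_speed g I S"
  shows "1-lipschitz_on I (\<lambda>s. fst (S s))" "1-lipschitz_on I (\<lambda>s. fst (snd (S s)))" "1-lipschitz_on I (\<lambda>s. snd (snd (S s)))"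
proof -
  have *: "1-lipschitz_on I f" if inc: "\<And>s s'. s \<in> I \<Longrightarrow> s' \<in> I \<Longrightarrow> s \<le> s' \<Longrightarrow> \<bar>f s' - f s\<bar> \<le> s' - s" for f :: "real \<Rightarrow> real"
  proof (rule lipschitz_onI)
    show "dist (f s) (f s') \<le> 1 * dist s s'" if "s \<in> I" "s' \<in> I" for s s'
      using inc[of s s'] inc[of s' s] that by (cases "s \<le> s'") (auto simp: dist_real_def)
  qed simp
  show "1-lipschitz_on I (\<lambda>s. fst (S s))" "1-lipschitz_on I (\<lambda>s. fst (snd (S s)))" 
    using assms unfolding bounded_speed_def by (intro *; force)+
  show "1-lipschitz_on I (\<lambda>s. snd (snd (S s)))"
  proof (rule *)
    fix s s' assume ss: "s \<in> I" "s' \<in> I" "s \<le> s'"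
    then have "snd (snd (S s')) - snd (snd (S s)) = g * (s' - s)" using assms unfolding bounded_speed_def by blast
    then show "\<bar>snd (snd (S s')) - snd (snd (S s))\<bar> \<le> s' - s"
      using g ss mult_right_mono[of g 1 "s' - s"] by simp
  qed
qed

lemma bounded_speed_AE_derivative:
  assumes S: "bounded_speed g {a..b} S"
  shows "AE s in lborel. a < s \<and> s < b \<longrightarrow>
    (\<exists>v1\<in>{0..1}. \<exists>v2\<in>{0..1}. (S has_vector_derivative (v1, v2, g)) (at s))"
proof -
  note lip = bounded_speed_component_lipschitz[OF S]
  from lipschitz_AE_differentiable[OF lip(1)] lipschitz_AE_differentiable[OF lip(2)]
  show ?thesis
  proof eventually_elim
    case (elim s)
    show ?case
    proof
      assume s: "a < s \<and> s < b"
      from elim s obtain v1 v2 where v: "((\<lambda>s. fst (S s)) has_real_derivative v1) (at s)"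
        "((\<lambda>s. fst (snd (S s))) has_real_derivative v2) (at s)" by blast
      have Sb: "fst (S s') - fst (S s) \<in> {0..s' - s} \<and> fst (snd (S s')) - fst (snd (S s)) \<in> {0..s' - s} \<and>
         snd (snd (S s')) - snd (snd (S s)) = g * (s' - s)" if "s < s'" "s' < b" for s'
        using S that s unfolding bounded_speed_def by auto
      have v': "((\<lambda>s. fst (S s)) has_vector_derivative v1) (at s)"
        "((\<lambda>s. fst (snd (S s))) has_vector_derivative v2) (at s)"
        using v by (auto simp: has_real_derivative_iff_has_vector_derivative)
      have "v1 \<in> {0..1}"
      proof (rule has_vector_derivative_in_closed[OF v'(1), of _ "b - s"])
        show "(fst (S (s + h)) - fst (S s)) /\<^sub>R h \<in> {0..1}" if "0 < h" "h < b - s" for h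
          using Sb[of "s + h"] that by (auto simp: field_simps)
      qed (use s in auto)
      moreover have "v2 \<in> {0..1}"
      proof (rule has_vector_derivative_in_closed[OF v'(2), of _ "b - s"])
        show "(fst (snd (S (s + h))) - fst (snd (S s))) /\<^sub>R h \<in> {0..1}" if "0 < h" "h < b - s" for h
          using Sb[of "s + h"] that by (auto simp: field_simps)
      qed (use s in auto)
      moreover have "((\<lambda>s. snd (snd (S s))) has_vector_derivative g) (at s)"
      proof -
        have "((\<lambda>u. snd (snd (S a)) + g * (u - a)) has_real_derivative g) (at s)"
          by (auto intro!: derivative_eq_intros)
        then have "((\<lambda>s. snd (snd (S s))) has_real_derivative g) (at s)"
        proof (rule has_field_derivative_transform_within_open[of _ _ _ "{a<..<b}"])
          fix u assume "u \<in> {a<..<b}"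
          then have "snd (snd (S u)) - snd (snd (S a)) = g * (u - a)"
            using S unfolding bounded_speed_def by auto
          then show "snd (snd (S a)) + g * (u - a) = snd (snd (S u))" by simp
        qed (use s in auto)
        then show ?thesis by (simp add: has_real_derivative_iff_has_vector_derivative)
      qed
      ultimately show "\<exists>v1\<in>{0..1}. \<exists>v2\<in>{0..1}. (S has_vector_derivative (v1, v2, g)) (at s)"
        using has_vector_derivative_Pair[OF v'(1) has_vector_derivative_Pair[OF v'(2)], of "\<lambda>s. snd (snd (S s))" g]
        by (intro bexI[of _ v1] bexI[of _ v2]) auto
    qed
  qed
qed

text \<open>Integrating the velocity of an absolutely continuous path bounds its increments;
  conversely bounded increments make the path Lipschitz, hence differentiable almost everywhere,
  with quotients in the closed interval of speeds.\<close>

lemma feasible_history_iff: "feasible_history g (t, S) \<longleftrightarrow> 0 \<le> t \<and> bounded_speed g {0..t} S"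
proof
  assume *: "0 \<le> t \<and> bounded_speed g {0..t} S"
  then show "feasible_history g (t, S)"
    unfolding feasible_history_def
    using bounded_speed_AE_derivative[of 0 t S] lipschitz_imp_abs_continuous_on[OF bounded_speed_lipschitz, of "{0..t}" S]
    by auto
next
  assume *: "feasible_history g (t, S)"
  then have t: "0 \<le> t" and ac: "abs_continuous_on {0..t} S"
    and der: "AE s in lborel. 0 < s \<and> s < t \<longrightarrow>
        (\<exists>v1\<in>{0..1}. \<exists>v2\<in>{0..1}. (S has_vector_derivative (v1, v2, g)) (at s))"
    by (auto simp: feasible_history_def)
  have inc: "F (S s') - F (S s) \<le> c * (s' - s)"
    if "bounded_linear F" "\<And>v1 v2. v1 \<in> {0..1} \<Longrightarrow> v2 \<in> {0..1} \<Longrightarrow> F (v1, v2, g) \<le> c" "0 \<le> s" "s \<le> s'" "s' \<le> t" for F c s s'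
  proof (rule abs_continuous_on_linear_increment_le[OF _ that(1)])
    show "AE u in lborel. s < u \<and> u < s' \<longrightarrow> (\<exists>v. (S has_vector_derivative v) (at u) \<and> F v \<le> c)"
      using der by (rule eventually_mono) (use that in force)
  qed (use that ac in \<open>auto intro: abs_continuous_on_subset\<close>)
  have "bounded_speed g {0..t} S"
    unfolding bounded_speed_def
  proof (intro ballI impI)
    fix s s' assume s: "s \<in> {0..t}" "s' \<in> {0..t}" "s \<le> s'"
    note i = inc[OF _ _ _ s(3)]
    show "fst (S s') - fst (S s) \<in> {0..s' - s} \<and> fst (snd (S s')) - fst (snd (S s)) \<in> {0..s' - s} \<and>
      snd (snd (S s')) - snd (snd (S s)) = g * (s' - s)"
      using i[of fst 1] i[of "\<lambda>p. - fst p" 0] i[of "\<lambda>p. fst (snd p)" 1] i[of "\<lambda>p. - fst (snd p)" 0]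
        i[of "\<lambda>p. snd (snd p)" g] i[of "\<lambda>p. - snd (snd p)" "- g"] s
      by (auto simp: bounded_linear_fst bounded_linear_minus bounded_linear_fst_comp bounded_linear_snd_comp bounded_linear_snd)
  qed
  with t show "0 \<le> t \<and> bounded_speed g {0..t} S" by simp
qed

lemma feasible_path_iff: "feasible_path g S \<longleftrightarrow> bounded_speed g {0..} S"
proof
  assume "feasible_path g S"
  then have "bounded_speed g {0..max s s'} S" if "0 \<le> s" "0 \<le> s'" for s s'
    using that by (auto simp: feasible_path_def feasible_history_iff)
  then show "bounded_speed g {0..} S"
    unfolding bounded_speed_def by (meson atLeastAtMost_iff atLeast_iff max.cobounded1 max.cobounded2)
next
  assume "bounded_speed g {0..} S"
  then show "feasible_path g S"
    using bounded_speed_subset[of g "{0..}" S] by (auto simp: feasible_path_def feasible_history_iff)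
qed

lemma extend_feasible:
  assumes "feasible_history g h"
  shows "feasible_path g (extend g h)"
proof -
  obtain t S where h: "h = (t, S)" by (cases h)
  have t: "0 \<le> t" and S: "bounded_speed g {0..t} S" using assms by (auto simp: h feasible_history_iff)
  have "bounded_speed g {0..T} (extend g h)" for T
  proof (rule bounded_speed_union)
    show "bounded_speed g {0..t} (extend g h)"
      using S by (subst bounded_speed_cong[of _ _ S]) (auto simp: h extend_def)
    show "bounded_speed g {t..T} (extend g h)"
      using g unfolding bounded_speed_def h extend_def by (auto simp: algebra_simps)
  qed
  then show ?thesis
    unfolding feasible_path_def using feasible_history_iff by blast
qed

end

section \<open>Existence of admissible continuations\<close>

lemma bounded_speed_halfline_iff: "bounded_speed g {0..} S \<longleftrightarrow> (\<forall>T\<ge>0. bounded_speed g {0..T} S)"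
proof
  assume *: "\<forall>T\<ge>0. bounded_speed g {0..T} S"
  show "bounded_speed g {0..} S"
    unfolding bounded_speed_def
  proof (intro ballI impI)
    fix s s' :: real assume "s \<in> {0..}" "s' \<in> {0..}" "s \<le> s'"
    then show "fst (S s') - fst (S s) \<in> {0..s' - s} \<and> fst (snd (S s')) - fst (snd (S s)) \<in> {0..s' - s} \<and>
       snd (snd (S s')) - snd (snd (S s)) = g * (s' - s)"
      using *[rule_format, of s'] unfolding bounded_speed_def by auto
  qed
qed (auto intro: bounded_speed_subset)

text \<open>Euler polygons of mesh \<open>\<delta>\<close>: on each grid interval both firms keep
  the speed prescribed at its left end. A prescription depends on the whole history, so the
  recursion produces paths rather than states. Later stages overwrite what \<open>extend\<close>
  puts after the initial date.\<close>

primrec euler :: "real \<Rightarrow> (history \<Rightarrow> real \<times> real) \<Rightarrow> real \<Rightarrow> history \<Rightarrow> nat \<Rightarrow> path" where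
  "euler g v \<delta> h 0 = extend g h"
| "euler g v \<delta> h (Suc k) = (\<lambda>s. let t = fst h + k * \<delta>; P = euler g v \<delta> h k in
     if s \<le> t then P s else P t + (s - t) *\<^sub>R (fst (v (t, P)), snd (v (t, P)), g))"

text \<open>Forgets the threshold coordinate, whose speed is always g, because limit speeds are
  pairs.\<close>

definition velocity :: "state \<Rightarrow> real \<times> real" where
  "velocity p = (fst p, fst (snd p))"

lemma bounded_linear_velocity: "bounded_linear velocity"
  unfolding velocity_def
  by (intro bounded_linear_Pair bounded_linear_fst bounded_linear_fst_comp bounded_linear_snd)

lemmas linear_velocity = bounded_linear.linear[OF bounded_linear_velocity]

text \<open>Each piece has a constant velocity \<open>V k\<close>, so a quotient over several pieces
  is their average weighted by time, and only pieces that meet the interval enter. The induction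
  moves the right end from grid point to grid point.\<close>

lemma polygon_quotient_in_convex:
  assumes \<delta>: "\<delta> > 0" and C: "convex C"
    and Y: "\<And>k s s'. t + real k * \<delta> \<le> s \<Longrightarrow> s \<le> s' \<Longrightarrow> s' \<le> t + real (Suc k) * \<delta> \<Longrightarrow>
       velocity (Y s' - Y s) = (s' - s) *\<^sub>R V k"
    and V: "\<And>k. t + real k * \<delta> < s' \<Longrightarrow> s < t + real (Suc k) * \<delta> \<Longrightarrow> V k \<in> C"
    and s: "t \<le> s" "s < s'"
  shows "velocity (Y s' - Y s) /\<^sub>R (s' - s) \<in> C"
proof -
  define T where "T k = t + real k * \<delta>" for k :: nat
  have T: "T k \<le> T (Suc k)" for k using \<delta> by (auto simp: T_def algebra_simps)
  have "velocity (Y u - Y s) /\<^sub>R (u - s) \<in> C" if "s < u" "u \<le> s'" "u \<le> T k" for k u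
    using that
  proof (induction k arbitrary: u)
    case 0
    then show ?case using s by (simp add: T_def)
  next
    case (Suc k)
    consider "u \<le> T k" | "T k \<le> s" "T k < u" | "s < T k" "T k < u" by linarith
    then show ?case
    proof cases
      case 1
      then show ?thesis using Suc by blast
    next
      case 2
      then have "velocity (Y u - Y s) = (u - s) *\<^sub>R V k"
        using Suc Y[of k s u] by (auto simp: T_def)
      moreover have "V k \<in> C" using V[of k] 2 Suc by (auto simp: T_def)
      ultimately show ?thesis using Suc by simp
    next
      case 3
      have a: "velocity (Y (T k) - Y s) /\<^sub>R (T k - s) \<in> C" using Suc 3 by auto
      have eq: "velocity (Y u - Y (T k)) = (u - T k) *\<^sub>R V k"
        using Suc 3 Y[of k "T k" u] by (auto simp: T_def)
      have b: "V k \<in> C" using V[of k] 3 Suc by (auto simp: T_def)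
      have "velocity (Y u - Y s) = velocity (Y (T k) - Y s) + velocity (Y u - Y (T k))"
        using linear_add[OF linear_velocity, of "Y (T k) - Y s" "Y u - Y (T k)"] by simp
      also have "\<dots> = (T k - s) *\<^sub>R (velocity (Y (T k) - Y s) /\<^sub>R (T k - s)) + (u - T k) *\<^sub>R V k"
        using 3 eq by simp
      finally have *: "velocity (Y u - Y s) = (T k - s) *\<^sub>R (velocity (Y (T k) - Y s) /\<^sub>R (T k - s)) + (u - T k) *\<^sub>R V k" .
      have "velocity (Y u - Y s) /\<^sub>R (u - s) =
          ((T k - s) / (u - s)) *\<^sub>R (velocity (Y (T k) - Y s) /\<^sub>R (T k - s)) + ((u - T k) / (u - s)) *\<^sub>R V k"
        unfolding * by (simp only: scaleR_add_right scaleR_scaleR) (simp add: divide_inverse mult.commute)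
      also have "\<dots> \<in> C"
      proof (rule convexD[OF C a b])
        show "(T k - s) / (u - s) + (u - T k) / (u - s) = 1"
          using 3 by (simp add: add_divide_distrib[symmetric])
      qed (use 3 in auto)
      finally show ?thesis .
    qed
  qed
  moreover obtain k :: nat where "(s' - t) / \<delta> \<le> k" using real_arch_simple by blast
  then have "s' \<le> T k" using \<delta> by (simp add: T_def field_simps)
  ultimately show ?thesis using s by blast
qed

lemma limit_speeds_subset:
  assumes "\<epsilon> > 0" "closed C" "convex C"
    and "\<And>h'. feasible_history g h' \<Longrightarrow> hist_dist h h' < \<epsilon> \<Longrightarrow> (speed g (\<sigma> Firm1) h', speed g (\<sigma> Firm2) h') \<in> C"
  shows "limit_speeds g \<sigma> h \<subseteq> C"
proof -
  have "closure (convex hull {(speed g (\<sigma> Firm1) h', speed g (\<sigma> Firm2) h') | h'. feasible_history g h' \<and> hist_dist h h' < \<epsilon>}) \<subseteq> C"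
    using assms by (intro closure_minimal hull_minimal) auto
  then show ?thesis unfolding limit_speeds_def using \<open>\<epsilon> > 0\<close> by blast
qed

lemma hist_dist_cong:
  assumes "\<And>u. u \<in> {0..s} \<Longrightarrow> Y u = Z u" "0 \<le> s"
  shows "hist_dist (s, Y) h' = hist_dist (s, Z) h'"
proof (cases h')
  case (Pair t' S')
  have "(SUP u\<in>{0..}. norm (Y (min u s) - S' (min u t'))) = (SUP u\<in>{0..}. norm (Z (min u s) - S' (min u t')))"
    using assms by (intro SUP_cong) auto
  then show ?thesis by (simp add: Pair)
qed

lemma limit_speeds_cong:
  assumes "\<And>u. u \<in> {0..s} \<Longrightarrow> Y u = Z u" "0 \<le> s"
  shows "limit_speeds g \<sigma> (s, Y) = limit_speeds g \<sigma> (s, Z)"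
  unfolding limit_speeds_def using hist_dist_cong[OF assms] by simp

text \<open>Arzela-Ascoli on the half-line: a diagonal subsequence converges at the rationals, and
  the common Lipschitz constant makes the convergence uniform on compact intervals.\<close>

lemma lipschitz_sequence_locally_uniform_limit:
  fixes Y :: "nat \<Rightarrow> path"
  assumes lip: "\<And>n. L-lipschitz_on {0..} (Y n)" and start: "\<And>n. Y n 0 = y0"
  obtains k Z where "strict_mono (k :: nat \<Rightarrow> nat)"
    "\<And>T e. e > 0 \<Longrightarrow> \<exists>N. \<forall>n\<ge>N. \<forall>x\<in>{0..T}. norm (Y (k n) x - Z x) < e"
proof -
  have L: "L \<ge> 0" using lipschitz_on_nonneg[OF lip] .
  \<comment> \<open>Division by \<open>1 + x\<close> turns the linear growth of the paths into one
    bound for all points, as the diagonal argument requires.\<close>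
  have bnd: "norm (Y n x /\<^sub>R (1 + x)) \<le> norm y0 + L" if "x \<ge> 0" for n x
  proof -
    have "norm (Y n x) \<le> norm (Y n 0) + norm (Y n x - Y n 0)" by (metis add.commute norm_triangle_sub)
    also have "\<dots> \<le> norm y0 + L * x"
      using lipschitz_onD[OF lip[of n], of x 0] that by (simp add: start dist_norm)
    also have "\<dots> \<le> (norm y0 + L) * (1 + x)"
      using that L by (simp add: algebra_simps)
    finally show ?thesis using that by (simp add: field_simps)
  qed
  obtain k where k: "strict_mono (k :: nat \<Rightarrow> nat)"
    and lim: "\<And>x. x \<in> \<rat> \<inter> {0..} \<Longrightarrow> \<exists>l. (\<lambda>n. Y (k n) x /\<^sub>R (1 + x)) \<longlonglongrightarrow> l"
    by (rule function_convergent_subsequence[of "\<rat> \<inter> {0..}" "\<lambda>n x. Y n x /\<^sub>R (1 + x)" "norm y0 + L"])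
      (use bnd in \<open>auto intro: countable_Int1 countable_rat\<close>)
  have cauchy: "\<exists>N. \<forall>m\<ge>N. \<forall>n\<ge>N. norm (Y (k m) x - Y (k n) x) < e" if x: "x \<in> \<rat>" "x \<ge> 0" "e > 0" for x e
  proof -
    obtain l where "(\<lambda>n. Y (k n) x /\<^sub>R (1 + x)) \<longlonglongrightarrow> l" using lim[of x] x by auto
    then have "(\<lambda>n. (1 + x) *\<^sub>R (Y (k n) x /\<^sub>R (1 + x))) \<longlonglongrightarrow> (1 + x) *\<^sub>R l" by (intro tendsto_intros)
    then have "(\<lambda>n. Y (k n) x) \<longlonglongrightarrow> (1 + x) *\<^sub>R l" using x by simp
    then have "Cauchy (\<lambda>n. Y (k n) x)" by (rule LIMSEQ_imp_Cauchy)
    then show ?thesis using x(3) unfolding Cauchy_iff by blast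
  qed
  have unif: "\<exists>N. \<forall>m\<ge>N. \<forall>n\<ge>N. \<forall>x\<in>{0..T}. norm (Y (k m) x - Y (k n) x) < e" if "e > 0" for T e
  proof -
    \<comment> \<open>The grid of mesh 1/p is so fine that moving down to the next grid point costs
      less than e/3.\<close>
    obtain p :: nat where p: "real p > 3 * (L + 1) / e" using reals_Archimedean2 by blast
    have p0: "real p > 0" using p L \<open>e > 0\<close> by (smt (verit) divide_pos_pos)
    obtain J :: nat where J: "T * p < J" using reals_Archimedean2 by blast
    have "\<exists>N. \<forall>m\<ge>N. \<forall>n\<ge>N. norm (Y (k m) (real j / real p) - Y (k n) (real j / real p)) < e / 3" for j
      using cauchy[of "real j / real p" "e / 3"] \<open>e > 0\<close> by auto
    then obtain N where N: "\<And>j m n. m \<ge> N j \<Longrightarrow> n \<ge> N j \<Longrightarrow> norm (Y (k m) (real j / real p) - Y (k n) (real j / real p)) < e / 3"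
      by metis
    define M where "M = Max (N ` {..J})"
    have M: "N j \<le> M" if "j \<le> J" for j using that by (auto simp: M_def)
    show ?thesis
    proof (intro exI allI impI ballI)
      fix m n x assume mn: "M \<le> m" "M \<le> n" and x: "x \<in> {0..T}"
      define j where "j = nat \<lfloor>x * p\<rfloor>"
      have xp: "x * p \<ge> 0" using x by simp
      have j: "real j \<le> x * p" "x * p < real j + 1" using xp by (auto simp: j_def)
      have "real j < real J"
      proof -
        have "x * p \<le> T * p" using x by (intro mult_right_mono) auto
        then show ?thesis using j J by linarith
      qed
      then have jJ: "j \<le> J" by simp
      define y where "y = real j / real p"
      have "y \<le> x" "x \<le> (real j + 1) / p"
        using j p0 by (simp_all add: y_def pos_divide_le_eq pos_le_divide_eq)
      then have y: "y \<ge> 0" "\<bar>x - y\<bar> \<le> 1 / p"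
        by (auto simp: y_def add_divide_distrib)
      have close: "norm (Y i x - Y i y) < e / 3" for i
      proof -
        have "norm (Y i x - Y i y) \<le> L * \<bar>x - y\<bar>"
          using lipschitz_onD[OF lip[of i], of x y] x y by (simp add: dist_norm)
        also have "\<dots> \<le> (L + 1) * (1 / p)" using y L by (intro mult_mono) auto
        also have "\<dots> < e / 3" using p p0 \<open>e > 0\<close> by (simp add: field_simps)
        finally show ?thesis .
      qed
      have "norm (Y (k m) y - Y (k n) y) < e / 3"
        using N[of j m n] M[OF jJ] mn by (simp add: y_def)
      moreover have "Y (k m) x - Y (k n) x = (Y (k m) x - Y (k m) y) + (Y (k m) y - Y (k n) y) - (Y (k n) x - Y (k n) y)"
        by simp
      then have "norm (Y (k m) x - Y (k n) x) \<le>
          norm ((Y (k m) x - Y (k m) y) + (Y (k m) y - Y (k n) y)) + norm (Y (k n) x - Y (k n) y)"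
        by (metis norm_triangle_ineq4)
      moreover note norm_triangle_ineq[of "Y (k m) x - Y (k m) y" "Y (k m) y - Y (k n) y"]
      ultimately show "norm (Y (k m) x - Y (k n) x) < e"
        using close[of "k m"] close[of "k n"] by linarith
    qed
  qed
  have conv: "\<exists>z. (\<lambda>n. Y (k n) x) \<longlonglongrightarrow> z" if "x \<ge> 0" for x
  proof -
    have "Cauchy (\<lambda>n. Y (k n) x)"
      unfolding Cauchy_iff
    proof (intro allI impI)
      fix e :: real assume "e > 0"
      then show "\<exists>M. \<forall>m\<ge>M. \<forall>n\<ge>M. norm (Y (k m) x - Y (k n) x) < e"
        using unif[of e x] that by fastforce
    qed
    then show ?thesis using Cauchy_convergent convergent_def by blast
  qed
  then obtain Z where Z: "\<And>x. x \<ge> 0 \<Longrightarrow> (\<lambda>n. Y (k n) x) \<longlonglongrightarrow> Z x" by metis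
  show ?thesis
  proof (rule that[OF k, of Z])
    fix T e :: real assume "e > 0"
    then obtain N where N: "\<forall>m\<ge>N. \<forall>n\<ge>N. \<forall>x\<in>{0..T}. norm (Y (k m) x - Y (k n) x) < e / 2"
      using unif[of "e / 2" T] by auto
    have "norm (Y (k m) x - Z x) < e" if "m \<ge> N" "x \<in> {0..T}" for m x
    proof -
      have "(\<lambda>n. norm (Y (k m) x - Y (k n) x)) \<longlonglongrightarrow> norm (Y (k m) x - Z x)"
        using that by (intro tendsto_intros Z) auto
      then have "norm (Y (k m) x - Z x) \<le> e / 2"
        by (rule LIMSEQ_le_const2) (use N that in \<open>force intro: less_imp_le\<close>)
      then show ?thesis using \<open>e > 0\<close> by simp
    qed
    then show "\<exists>N. \<forall>n\<ge>N. \<forall>x\<in>{0..T}. norm (Y (k n) x - Z x) < e" by blast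
  qed
qed

lemma bounded_speed_limit:
  fixes Y :: "nat \<Rightarrow> path"
  assumes Y: "\<And>n. bounded_speed g I (Y n)" and lim: "\<And>x. x \<in> I \<Longrightarrow> (\<lambda>n. Y n x) \<longlonglongrightarrow> Z x"
  shows "bounded_speed g I Z"
  unfolding bounded_speed_def
proof (intro ballI impI)
  fix s s' assume s: "s \<in> I" "s' \<in> I" "s \<le> s'"
  have b: "fst (Y n s') - fst (Y n s) \<in> {0..s' - s} \<and> fst (snd (Y n s')) - fst (snd (Y n s)) \<in> {0..s' - s} \<and>
       snd (snd (Y n s')) - snd (snd (Y n s)) = g * (s' - s)" for n
    using Y s unfolding bounded_speed_def by blast
  note l = lim[OF s(1)] lim[OF s(2)]
  have "(\<lambda>n. fst (Y n s') - fst (Y n s)) \<longlonglongrightarrow> fst (Z s') - fst (Z s)" by (intro tendsto_intros l)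
  then have "fst (Z s') - fst (Z s) \<in> {0..s' - s}"
    by (rule closed_sequentially[OF closed_real_atLeastAtMost, rotated]) (use b in auto)
  moreover have "(\<lambda>n. fst (snd (Y n s')) - fst (snd (Y n s))) \<longlonglongrightarrow> fst (snd (Z s')) - fst (snd (Z s))" by (intro tendsto_intros l)
  then have "fst (snd (Z s')) - fst (snd (Z s)) \<in> {0..s' - s}"
    by (rule closed_sequentially[OF closed_real_atLeastAtMost, rotated]) (use b in auto)
  moreover have "(\<lambda>n. snd (snd (Y n s')) - snd (snd (Y n s))) \<longlonglongrightarrow> snd (snd (Z s')) - snd (snd (Z s))" by (intro tendsto_intros l)
  then have "snd (snd (Z s')) - snd (snd (Z s)) = g * (s' - s)"
    using b by (simp add: LIMSEQ_const_iff)
  ultimately show "fst (Z s') - fst (Z s) \<in> {0..s' - s} \<and> fst (snd (Z s')) - fst (snd (Z s)) \<in> {0..s' - s} \<and>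
       snd (snd (Z s')) - snd (snd (Z s)) = g * (s' - s)" by blast
qed

text \<open>The factor 4 is 1 for the difference of the dates plus the Lipschitz constant 3 for
  freezing Y at different dates.\<close>

lemma hist_dist_le:
  assumes Y: "3-lipschitz_on {0..} Y" and s: "0 \<le> s" "0 \<le> t'"
    and close: "\<And>u. u \<in> {0..t'} \<Longrightarrow> norm (Y u - P u) \<le> e"
  shows "hist_dist (s, Y) (t', P) \<le> 4 * \<bar>s - t'\<bar> + e"
proof -
  have "(SUP u\<in>{0..}. norm (Y (min u s) - P (min u t'))) \<le> 3 * \<bar>s - t'\<bar> + e"
  proof (rule cSUP_least)
    fix u :: real assume u: "u \<in> {0..}"
    have "norm (Y (min u s) - P (min u t')) \<le> norm (Y (min u s) - Y (min u t')) + norm (Y (min u t') - P (min u t'))"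
      using norm_triangle_ineq[of "Y (min u s) - Y (min u t')" "Y (min u t') - P (min u t')"] by simp
    also have "norm (Y (min u s) - Y (min u t')) \<le> 3 * \<bar>min u s - min u t'\<bar>"
      using lipschitz_onD[OF Y, of "min u s" "min u t'"] u s by (simp add: dist_norm)
    also have "3 * \<bar>min u s - min u t'\<bar> \<le> 3 * \<bar>s - t'\<bar>" by (simp add: min_def)
    also have "norm (Y (min u t') - P (min u t')) \<le> e" using u s by (intro close) auto
    finally show "norm (Y (min u s) - P (min u t')) \<le> 3 * \<bar>s - t'\<bar> + e" by simp
  qed simp
  then show ?thesis by simp
qed

context
  fixes g :: real
  assumes g: "0 < g" "g < 1"
begin

text \<open>Later stages do not change a polygon before its grid date, so all stages paste to one
  path Y. The stages \<open>P k\<close> are kept because the k-th speed is read at the history they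
  define, which agrees with Y up to that date.\<close>

lemma euler_polygon:
  assumes h: "feasible_history g (t, S)" and \<delta>: "\<delta> > 0"
    and v: "\<And>h. feasible_history g h \<Longrightarrow> v h \<in> {0..1} \<times> {0..1}"
  obtains Y P where "bounded_speed g {0..} Y" "\<And>s. s \<in> {0..t} \<Longrightarrow> Y s = S s"
    "\<And>k s. s \<in> {0..t + real k * \<delta>} \<Longrightarrow> P k s = Y s"
    "\<And>k s s'. t + real k * \<delta> \<le> s \<Longrightarrow> s \<le> s' \<Longrightarrow> s' \<le> t + real (Suc k) * \<delta> \<Longrightarrow>
       velocity (Y s' - Y s) = (s' - s) *\<^sub>R v (t + real k * \<delta>, P k)"
proof -
  define P where "P = euler g v \<delta> (t, S)"
  define T where "T k = t + real k * \<delta>" for k :: nat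
  have t: "t \<ge> 0" using h by (simp add: feasible_history_iff[OF g])
  have T: "T k \<ge> 0" "T k \<le> T (Suc k)" for k using t \<delta> by (auto simp: T_def algebra_simps)
  have T_mono: "k \<le> m \<Longrightarrow> T k \<le> T m" for k m using \<delta> by (auto simp: T_def mult_right_mono)
  have PSuc: "P (Suc k) s = (if s \<le> T k then P k s else P k (T k) + (s - T k) *\<^sub>R (fst (v (T k, P k)), snd (v (T k, P k)), g))" for k s
    by (simp add: P_def T_def Let_def)
  have P0: "P 0 s = S s" if "s \<le> t" for s using that by (simp add: P_def extend_def)
  have Pb: "bounded_speed g {0..} (P k)" for k
  proof (induction k)
    case 0
    show ?case using extend_feasible[OF g h] by (simp add: P_def feasible_path_iff[OF g])
  next
    case (Suc k)
    have f: "feasible_history g (T k, P k)"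
      using Suc T by (auto simp: feasible_history_iff[OF g] intro: bounded_speed_subset)
    from v[OF f] have vv: "fst (v (T k, P k)) \<in> {0..1}" "snd (v (T k, P k)) \<in> {0..1}" by (auto simp: mem_Times_iff)
    have "bounded_speed g {0..U} (P (Suc k))" for U
    proof (rule bounded_speed_union)
      show "bounded_speed g {0..T k} (P (Suc k))"
        using bounded_speed_subset[OF Suc, of "{0..T k}"]
        by (subst bounded_speed_cong[of _ _ "P k"]) (auto simp: PSuc)
      show "bounded_speed g {T k..U} (P (Suc k))"
        unfolding bounded_speed_def
      proof (intro ballI impI)
        fix s s' assume s: "s \<in> {T k..U}" "s' \<in> {T k..U}" "s \<le> s'"
        have 1: "P (Suc k) u = P k (T k) + (u - T k) *\<^sub>R (fst (v (T k, P k)), snd (v (T k, P k)), g)" if "T k \<le> u" for u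
          using that by (auto simp: PSuc zero_prod_def)
        have "P (Suc k) s' - P (Suc k) s = (s' - s) *\<^sub>R (fst (v (T k, P k)), snd (v (T k, P k)), g)"
          using s by (simp add: 1 algebra_simps)
        then have "fst (P (Suc k) s') - fst (P (Suc k) s) = (s' - s) * fst (v (T k, P k))"
          "fst (snd (P (Suc k) s')) - fst (snd (P (Suc k) s)) = (s' - s) * snd (v (T k, P k))"
          "snd (snd (P (Suc k) s')) - snd (snd (P (Suc k) s)) = (s' - s) * g"
          by (simp_all add: prod_eq_iff)
        then show "fst (P (Suc k) s') - fst (P (Suc k) s) \<in> {0..s' - s} \<and>
           fst (snd (P (Suc k) s')) - fst (snd (P (Suc k) s)) \<in> {0..s' - s} \<and>
           snd (snd (P (Suc k) s')) - snd (snd (P (Suc k) s)) = g * (s' - s)"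
          using vv s by (auto simp: mult_left_le)
      qed
    qed
    then show ?case unfolding bounded_speed_halfline_iff by blast
  qed
  have agree: "P m s = P k s" if "k \<le> m" "s \<le> T k" for k m s
    using that(1)
  proof (induction m rule: dec_induct)
    case (step n)
    then show ?case using that(2) T_mono[of k n] by (simp add: PSuc)
  qed simp
  have ex: "\<exists>k. s \<le> T k" for s
  proof -
    obtain k :: nat where "(s - t) / \<delta> \<le> k" using real_arch_simple by blast
    then show ?thesis using \<delta> by (intro exI[of _ k]) (simp add: T_def field_simps)
  qed
  define Y where "Y s = P (LEAST k. s \<le> T k) s" for s
  have Y: "Y s = P k s" if "s \<le> T k" for s k
    unfolding Y_def using agree[of "LEAST k. s \<le> T k" k s] that
    by (metis LeastI_ex Least_le ex)
  show ?thesis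
  proof (rule that[of Y P])
    have "bounded_speed g {0..U} Y" for U
    proof -
      obtain k where k: "U \<le> T k" using ex by blast
      show ?thesis
        using bounded_speed_subset[OF Pb[of k], of "{0..U}"] k
        by (subst bounded_speed_cong[of _ _ "P k"]) (auto intro!: Y)
    qed
    then show "bounded_speed g {0..} Y" unfolding bounded_speed_halfline_iff by blast
    show "Y s = S s" if "s \<in> {0..t}" for s
      using Y[of s 0] P0[of s] that by (simp add: T_def)
    show "P k s = Y s" if "s \<in> {0..t + real k * \<delta>}" for k s
      using Y[of s k] that by (simp add: T_def)
    show "velocity (Y s' - Y s) = (s' - s) *\<^sub>R v (t + real k * \<delta>, P k)"
      if "t + real k * \<delta> \<le> s" "s \<le> s'" "s' \<le> t + real (Suc k) * \<delta>" for k s s'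
    proof -
      have 1: "P (Suc k) u = P k (T k) + (u - T k) *\<^sub>R (fst (v (T k, P k)), snd (v (T k, P k)), g)" if "T k \<le> u" for u
        using that by (auto simp: PSuc zero_prod_def)
      have "Y s' - Y s = (s' - s) *\<^sub>R (fst (v (T k, P k)), snd (v (T k, P k)), g)"
        using that Y[of s "Suc k"] Y[of s' "Suc k"] 1[of s] 1[of s'] by (simp add: T_def algebra_simps)
      then show ?thesis by (simp add: velocity_def T_def prod_eq_iff)
    qed
  qed
qed

lemma speed_bounds:
  assumes "is_strategy g \<sigma>" "feasible_history g h"
  shows "speed g \<sigma> h \<in> {0..1}"
proof -
  have "fst h \<ge> 0" using assms(2) by (cases h) (simp add: feasible_history_iff[OF g])
  then show ?thesis
    using assms extend_feasible[OF g assms(2)] unfolding speed_def is_strategy_def outcomes_def by auto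
qed

lemma limit_speeds_unit:
  assumes "\<And>i. is_strategy g (\<sigma> i)"
  shows "limit_speeds g \<sigma> h \<subseteq> {0..1} \<times> {0..1}"
  by (rule limit_speeds_subset[of 1])
    (use assms speed_bounds in \<open>auto intro: closed_Times convex_Times\<close>)

text \<open>Speeds lie in the unit square before t by feasibility and after t because the limit
  speeds do; the date t itself is a null set.\<close>

lemma continuation_bounded_speed:
  assumes \<sigma>: "\<And>i. is_strategy g (\<sigma> i)" and h: "feasible_history g (t, S)"
    and Y: "Y \<in> continuations g \<sigma> (t, S)"
  shows "bounded_speed g {0..} Y"
  unfolding bounded_speed_halfline_iff
proof (intro allI impI)
  fix T :: real assume "T \<ge> 0"
  have eq: "\<forall>s\<in>{0..t}. Y s = S s" and ac: "abs_continuous_on {0..T} Y"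
    and der: "AE s in lborel. t < s \<longrightarrow> (\<exists>v1 v2. (v1, v2) \<in> limit_speeds g \<sigma> (s, Y) \<and>
           (Y has_vector_derivative (v1, v2, g)) (at s))"
    using Y \<open>T \<ge> 0\<close> by (auto simp: continuations_def)
  have der': "AE s in lborel. 0 < s \<and> s < t \<longrightarrow>
        (\<exists>v1\<in>{0..1}. \<exists>v2\<in>{0..1}. (S has_vector_derivative (v1, v2, g)) (at s))"
    using h by (auto simp: feasible_history_def)
  have net: "AE s in lborel. s \<noteq> t" using AE_lborel_singleton by blast
  have "AE s in lborel. 0 < s \<and> s < T \<longrightarrow>
        (\<exists>v1\<in>{0..1}. \<exists>v2\<in>{0..1}. (Y has_vector_derivative (v1, v2, g)) (at s))"
    using der der' net
  proof eventually_elim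
    case (elim s)
    show ?case
    proof
      assume s: "0 < s \<and> s < T"
      show "\<exists>v1\<in>{0..1}. \<exists>v2\<in>{0..1}. (Y has_vector_derivative (v1, v2, g)) (at s)"
      proof (cases "t < s")
        case True
        then obtain v1 v2 where v: "(v1, v2) \<in> limit_speeds g \<sigma> (s, Y)" "(Y has_vector_derivative (v1, v2, g)) (at s)"
          using elim by blast
        then have "(v1, v2) \<in> {0..1} \<times> {0..1}" using limit_speeds_unit[of \<sigma>, OF \<sigma>] by blast
        with v(2) show ?thesis by blast
      next
        case False
        then obtain v1 v2 where v: "v1 \<in> {0..1}" "v2 \<in> {0..1}" "(S has_vector_derivative (v1, v2, g)) (at s)"
          using elim s by auto
        have "(Y has_vector_derivative (v1, v2, g)) (at s)"
          using False s elim eq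
          by (intro has_vector_derivative_transform_within_open[OF v(3), of "{0<..<t}"]) auto
        then show ?thesis using v(1,2) by blast
      qed
    qed
  qed
  then have "feasible_history g (T, Y)" using ac \<open>T \<ge> 0\<close> by (simp add: feasible_history_def)
  then show "bounded_speed g {0..T} Y" by (simp add: feasible_history_iff[OF g])
qed

lemma bounded_speed_halfline_AE_derivative:
  assumes S: "bounded_speed g {0..} S"
  shows "AE s in lborel. 0 < s \<longrightarrow>
    (\<exists>v1\<in>{0..1}. \<exists>v2\<in>{0..1}. (S has_vector_derivative (v1, v2, g)) (at s))"
proof -
  have "AE s in lborel. \<forall>n::nat. 0 < s \<and> s < real n \<longrightarrow>
    (\<exists>v1\<in>{0..1}. \<exists>v2\<in>{0..1}. (S has_vector_derivative (v1, v2, g)) (at s))"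
    unfolding AE_all_countable
    using bounded_speed_AE_derivative[OF g bounded_speed_subset[OF S]] by auto
  then show ?thesis
  proof (rule eventually_mono, intro impI)
    fix s :: real assume *: "\<forall>n::nat. 0 < s \<and> s < real n \<longrightarrow>
      (\<exists>v1\<in>{0..1}. \<exists>v2\<in>{0..1}. (S has_vector_derivative (v1, v2, g)) (at s))" and "0 < s"
    obtain n :: nat where "s < real n" using reals_Archimedean2 by blast
    then show "\<exists>v1\<in>{0..1}. \<exists>v2\<in>{0..1}. (S has_vector_derivative (v1, v2, g)) (at s)"
      using * \<open>0 < s\<close> by blast
  qed
qed

text \<open>A uniform limit of Euler polygons solves the differential inclusion: wherever the limit is
  differentiable, its difference quotients are limits of averages of nearby prescribed speeds.\<close>

lemma continuations_nonempty:
  assumes \<sigma>: "\<And>i. is_strategy g (\<sigma> i)" and h: "feasible_history g (t, S)"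
  shows "continuations g \<sigma> (t, S) \<noteq> {}"
proof -
  define v where "v h = (speed g (\<sigma> Firm1) h, speed g (\<sigma> Firm2) h)" for h
  have t: "0 \<le> t" using h by (simp add: feasible_history_iff[OF g])
  have v: "v h \<in> {0..1} \<times> {0..1}" if "feasible_history g h" for h
    using speed_bounds[OF \<sigma> that] by (simp add: v_def)
  define \<delta> where "\<delta> n = 1 / real (Suc n)" for n
  have \<delta>: "\<delta> n > 0" for n by (simp add: \<delta>_def)
  have "\<exists>Y P. bounded_speed g {0..} Y \<and> (\<forall>s\<in>{0..t}. Y s = S s) \<and>
      (\<forall>k. \<forall>s\<in>{0..t + real k * \<delta> n}. P k s = Y s) \<and>
      (\<forall>k s s'. t + real k * \<delta> n \<le> s \<longrightarrow> s \<le> s' \<longrightarrow> s' \<le> t + real (Suc k) * \<delta> n \<longrightarrow>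
       velocity (Y s' - Y s) = (s' - s) *\<^sub>R v (t + real k * \<delta> n, P k))" for n
    by (rule euler_polygon[OF h \<delta>[of n] v]) blast+
  then obtain Y P where Yb: "\<And>n. bounded_speed g {0..} (Y n)" and YS: "\<And>n s. s \<in> {0..t} \<Longrightarrow> Y n s = S s"
    and PY: "\<And>n k s. s \<in> {0..t + real k * \<delta> n} \<Longrightarrow> P n k s = Y n s"
    and vel: "\<And>n k s s'. t + real k * \<delta> n \<le> s \<Longrightarrow> s \<le> s' \<Longrightarrow> s' \<le> t + real (Suc k) * \<delta> n \<Longrightarrow>
       velocity (Y n s' - Y n s) = (s' - s) *\<^sub>R v (t + real k * \<delta> n, P n k)"
    by metis
  obtain k Z where k: "strict_mono (k :: nat \<Rightarrow> nat)"
    and unif: "\<And>T e. e > 0 \<Longrightarrow> \<exists>N. \<forall>n\<ge>N. \<forall>x\<in>{0..T}. norm (Y (k n) x - Z x) < e"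
    by (rule lipschitz_sequence_locally_uniform_limit[of 3 Y "S 0"])
      (use bounded_speed_lipschitz[OF g Yb] YS t in auto)
  have lim: "(\<lambda>n. Y (k n) x) \<longlonglongrightarrow> Z x" if "x \<ge> 0" for x
    unfolding LIMSEQ_iff
  proof (intro allI impI)
    fix e :: real assume "e > 0"
    then show "\<exists>no. \<forall>n\<ge>no. norm (Y (k n) x - Z x) < e" using unif[of e x] that by fastforce
  qed
  have Zb: "bounded_speed g {0..} Z" using bounded_speed_limit[OF Yb lim] by simp
  note Zlip = bounded_speed_lipschitz[OF g Zb]
  have ZS: "Z s = S s" if "s \<in> {0..t}" for s
    using lim[of s] YS[OF that] that by (simp add: LIMSEQ_const_iff)
  have \<delta>lim: "(\<lambda>n. \<delta> (k n)) \<longlonglongrightarrow> 0"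
    using LIMSEQ_subseq_LIMSEQ[OF LIMSEQ_inverse_real_of_nat k] by (simp add: \<delta>_def o_def inverse_eq_divide)
  have K: "(v1, v2) \<in> limit_speeds g \<sigma> (s, Z)"
    if s: "t < s" and d: "(Z has_vector_derivative (v1, v2, g)) (at s)" for s v1 v2
    unfolding limit_speeds_def
  proof
    fix \<epsilon> :: real assume "\<epsilon> \<in> {0<..}"
    then have \<epsilon>: "\<epsilon> > 0" by simp
    define H where "H = convex hull {(speed g (\<sigma> Firm1) h', speed g (\<sigma> Firm2) h') | h'. feasible_history g h' \<and> hist_dist (s, Z) h' < \<epsilon>}"
    \<comment> \<open>Mesh and step h both stay below \<open>\<eta>\<close>, so a piece that meets
      the step starts within \<open>\<eta>\<close> of s: the histories differ by less than
      \<open>4 * \<epsilon> / 16\<close> through the dates and by \<open>\<epsilon> / 4\<close>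
      through the paths. The bound 1 keeps all dates below s + 1, where the convergence is
      uniform.\<close>
    define \<eta> where "\<eta> = min 1 (\<epsilon> / 16)"
    have \<eta>: "\<eta> > 0" using \<epsilon> by (simp add: \<eta>_def)
    have ev1: "\<forall>\<^sub>F n in sequentially. \<delta> (k n) < \<eta>" using \<delta>lim \<eta> by (rule order_tendstoD)
    have ev2: "\<forall>\<^sub>F n in sequentially. \<forall>x\<in>{0..s+1}. norm (Y (k n) x - Z x) < \<epsilon> / 4"
      using unif[of "\<epsilon> / 4" "s + 1"] \<epsilon> by (simp add: eventually_sequentially)
    have quot: "velocity (Z (s + h) - Z s) /\<^sub>R h \<in> closure H" if h: "0 < h" "h < \<eta>" for h
    proof (rule Lim_in_closed_set)
      show "(\<lambda>n. velocity (Y (k n) (s + h) - Y (k n) s) /\<^sub>R h) \<longlonglongrightarrow> velocity (Z (s + h) - Z s) /\<^sub>R h"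
        using s t h by (intro tendsto_intros bounded_linear.tendsto[OF bounded_linear_velocity] lim) auto
      show "\<forall>\<^sub>F n in sequentially. velocity (Y (k n) (s + h) - Y (k n) s) /\<^sub>R h \<in> closure H"
        using ev1 ev2
      proof eventually_elim
        case (elim n)
        have "velocity (Y (k n) (s + h) - Y (k n) s) /\<^sub>R ((s + h) - s) \<in> H"
        proof (rule polygon_quotient_in_convex[OF \<delta>[of "k n"] _ vel])
          show "convex H" by (simp add: H_def)
          fix j assume j: "t + real j * \<delta> (k n) < s + h" "s < t + real (Suc j) * \<delta> (k n)"
          define t' where "t' = t + real j * \<delta> (k n)"
          have t': "\<bar>s - t'\<bar> < \<eta>" "t' \<ge> 0"
            using j h elim(1) t \<delta>[of "k n"] by (auto simp: t'_def algebra_simps abs_less_iff)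
          have f: "feasible_history g (t', P (k n) j)"
          proof -
            have "bounded_speed g {0..t'} (Y (k n))" using Yb by (rule bounded_speed_subset) auto
            then have "bounded_speed g {0..t'} (P (k n) j)"
              by (subst bounded_speed_cong[of _ _ "Y (k n)"]) (auto intro: PY simp: t'_def)
            then show ?thesis using t' by (simp add: feasible_history_iff[OF g])
          qed
          have "hist_dist (s, Z) (t', P (k n) j) \<le> 4 * \<bar>s - t'\<bar> + \<epsilon> / 4"
          proof (rule hist_dist_le[OF Zlip])
            fix u assume u: "u \<in> {0..t'}"
            then have "u \<in> {0..s + 1}" using t' by (auto simp: \<eta>_def)
            then have "norm (Y (k n) u - Z u) < \<epsilon> / 4" using elim by blast
            then show "norm (Z u - P (k n) j u) \<le> \<epsilon> / 4"
              using PY[of u j "k n"] u by (simp add: t'_def norm_minus_commute)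
          qed (use s t t' in auto)
          also have "\<dots> < \<epsilon>" using t' \<epsilon> by (simp add: \<eta>_def)
          finally show "v (t + real j * \<delta> (k n), P (k n) j) \<in> H"
            unfolding H_def v_def t'_def[symmetric] by (intro hull_inc) (use f in blast)
        qed (use s h in auto)
        then show ?case using closure_subset by auto
      qed
    qed auto
    have "((\<lambda>s. velocity (Z s)) has_vector_derivative velocity (v1, v2, g)) (at s)"
      by (rule bounded_linear.has_vector_derivative[OF bounded_linear_velocity d])
    then have "velocity (v1, v2, g) \<in> closure H"
      by (rule has_vector_derivative_in_closed[OF _ closed_closure \<eta>])
        (use quot in \<open>simp add: linear_diff[OF linear_velocity]\<close>)
    then show "(v1, v2) \<in> closure (convex hull {(speed g (\<sigma> Firm1) h', speed g (\<sigma> Firm2) h') | h'. feasible_history g h' \<and> hist_dist (s, Z) h' < \<epsilon>})"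
      by (simp add: H_def velocity_def)
  qed
  have "Z \<in> continuations g \<sigma> (t, S)"
      unfolding continuations_def prod.case mem_Collect_eq
  proof (intro conjI allI impI ballI)
    show "Z s = S s" if "s \<in> {0..t}" for s using ZS that by simp
    show "abs_continuous_on {0..T} Z" if "T \<ge> 0" for T
      by (rule lipschitz_imp_abs_continuous_on[OF lipschitz_on_subset[OF Zlip]]) auto
    show "AE s in lborel. t < s \<longrightarrow> (\<exists>v1 v2. (v1, v2) \<in> limit_speeds g \<sigma> (s, Z) \<and> (Z has_vector_derivative (v1, v2, g)) (at s))"
      using bounded_speed_halfline_AE_derivative[OF Zb]
      by (rule eventually_mono) (use K t in \<open>force\<close>)
  qed
  then show ?thesis by blast
qed

end

section \<open>Constant-speed deviations\<close>

text \<open>The old strategy returns after the window, so at later dates the deviation prescribes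
  the same speed after the same history.\<close>

definition hold :: "real \<Rightarrow> real \<Rightarrow> real \<Rightarrow> strategy \<Rightarrow> strategy" where
  "hold c t \<tau> \<sigma> = (\<lambda>s \<omega>. if t \<le> s \<and> s < t + \<tau> then c else \<sigma> s \<omega>)"

lemma capability_eq: "capability Firm1 = fst" "capability Firm2 = (\<lambda>p. fst (snd p))"
  by (auto simp: capability_proj)

lemma bounded_linear_capability: "bounded_linear (capability i)"
  by (cases i) (simp_all add: capability_eq bounded_linear_fst bounded_linear_fst_comp bounded_linear_snd)

lemma is_strategy_hold:
  assumes "is_strategy g \<sigma>" "c \<in> {0..1}"
  shows "is_strategy g (hold c t \<tau> \<sigma>)"
  unfolding is_strategy_def
proof (intro conjI allI impI)
  show "\<forall>\<omega>\<in>outcomes g. hold c t \<tau> \<sigma> s \<omega> \<in> {0..1}" if "0 \<le> s" for s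
    using assms that by (auto simp: hold_def is_strategy_def)
  fix T :: real assume "0 \<le> T"
  let ?M = "restrict_space borel {0..T} \<Otimes>\<^sub>M info g T"
  have [measurable]: "(\<lambda>x. case x of (s, \<omega>) \<Rightarrow> \<sigma> s \<omega>) \<in> borel_measurable ?M"
    using assms \<open>0 \<le> T\<close> by (simp add: is_strategy_def)
  have [measurable]: "(fst :: real \<times> _ \<Rightarrow> real) \<in> borel_measurable ?M"
    by (rule measurable_compose[OF measurable_fst]) (simp add: measurable_restrict_space1)
  have "(\<lambda>x. if t \<le> fst x \<and> fst x < t + \<tau> then c else (case x of (s, \<omega>) \<Rightarrow> \<sigma> s \<omega>)) \<in> borel_measurable ?M"
    by measurable
  also have "(\<lambda>x. if t \<le> fst x \<and> fst x < t + \<tau> then c else (case x of (s, \<omega>) \<Rightarrow> \<sigma> s \<omega>)) = (\<lambda>(s, \<omega>). hold c t \<tau> \<sigma> s \<omega>)"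
    by (auto simp: hold_def fun_eq_iff)
  finally show "(\<lambda>(s, \<omega>). hold c t \<tau> \<sigma> s \<omega>) \<in> borel_measurable ?M" .
qed

lemma limit_speeds_mono_local:
  assumes "\<delta> > 0" and eq: "\<And>h' i. feasible_history g h' \<Longrightarrow> hist_dist h h' < \<delta> \<Longrightarrow> speed g (\<sigma> i) h' = speed g (\<sigma>' i) h'"
  shows "limit_speeds g \<sigma> h \<subseteq> limit_speeds g \<sigma>' h"
proof -
  have "closure (convex hull {(speed g (\<sigma> Firm1) h', speed g (\<sigma> Firm2) h') | h'. feasible_history g h' \<and> hist_dist h h' < min \<delta> \<epsilon>})
     \<subseteq> closure (convex hull {(speed g (\<sigma>' Firm1) h', speed g (\<sigma>' Firm2) h') | h'. feasible_history g h' \<and> hist_dist h h' < \<epsilon>})" for \<epsilon>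
    by (intro closure_mono hull_mono) (use eq in fastforce)
  moreover have "min \<delta> \<epsilon> > 0" if "\<epsilon> > 0" for \<epsilon> using that \<open>\<delta> > 0\<close> by simp
  ultimately show ?thesis unfolding limit_speeds_def by blast
qed

context
  fixes g :: real
  assumes g: "0 < g" "g < 1"
begin

text \<open>Dropping the supremum from the distance requires it to be nonnegative, and for a real
  supremum this needs boundedness first; the Lipschitz bounds provide it.\<close>

lemma hist_dist_ge_time:
  assumes "feasible_history g (s, Y)" "feasible_history g (t', S')"
  shows "\<bar>s - t'\<bar> \<le> hist_dist (s, Y) (t', S')"
proof -
  have s: "s \<ge> 0" "t' \<ge> 0" and b: "bounded_speed g {0..s} Y" "bounded_speed g {0..t'} S'"
    using assms by (auto simp: feasible_history_iff[OF g])
  have "bdd_above ((\<lambda>u. norm (Y (min u s) - S' (min u t'))) ` {0..})"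
  proof (rule bdd_aboveI2)
    fix u :: real assume u: "u \<in> {0..}"
    have 1: "norm (Y (min u s)) \<le> norm (Y 0) + 3 * s"
    proof -
      have "norm (Y (min u s) - Y 0) \<le> 3 * min u s"
        using lipschitz_onD[OF bounded_speed_lipschitz[OF g b(1)], of "min u s" 0] u s by (simp add: dist_norm)
      moreover have "norm (Y (min u s)) \<le> norm (Y 0) + norm (Y (min u s) - Y 0)" by (rule norm_triangle_sub)
      ultimately show ?thesis by linarith
    qed
    have 2: "norm (S' (min u t')) \<le> norm (S' 0) + 3 * t'"
    proof -
      have "norm (S' (min u t') - S' 0) \<le> 3 * min u t'"
        using lipschitz_onD[OF bounded_speed_lipschitz[OF g b(2)], of "min u t'" 0] u s by (simp add: dist_norm)
      moreover have "norm (S' (min u t')) \<le> norm (S' 0) + norm (S' (min u t') - S' 0)" by (rule norm_triangle_sub)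
      ultimately show ?thesis by linarith
    qed
    show "norm (Y (min u s) - S' (min u t')) \<le> (norm (Y 0) + 3 * s) + (norm (S' 0) + 3 * t')"
      using norm_triangle_ineq4[of "Y (min u s)" "S' (min u t')"] 1 2 by linarith
  qed
  then have "norm (Y (min 0 s) - S' (min 0 t')) \<le> (SUP u\<in>{0..}. norm (Y (min u s) - S' (min u t')))"
    by (rule cSUP_upper[rotated]) simp
  then have "0 \<le> (SUP u\<in>{0..}. norm (Y (min u s) - S' (min u t')))"
    by (rule order_trans[OF norm_ge_zero])
  then show ?thesis by simp
qed

lemma limit_speeds_hold_after:
  assumes "feasible_history g (s, Y)" "t + \<tau> < s"
  shows "limit_speeds g (\<sigma>(k := hold c t \<tau> (\<sigma> k))) (s, Y) = limit_speeds g \<sigma> (s, Y)"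
proof -
  have eq: "speed g ((\<sigma>(k := hold c t \<tau> (\<sigma> k))) i) h' = speed g (\<sigma> i) h'"
    if "feasible_history g h'" "hist_dist (s, Y) h' < s - (t + \<tau>)" for h' i
  proof -
    have "\<bar>s - fst h'\<bar> \<le> hist_dist (s, Y) h'"
      using hist_dist_ge_time[OF assms(1), of "fst h'" "snd h'"] that by simp
    then have "fst h' > t + \<tau>" using that by auto
    then show ?thesis by (auto simp: speed_def hold_def)
  qed
  show ?thesis
    using limit_speeds_mono_local[where \<delta> = "s - (t + \<tau>)" and h = "(s, Y)"] eq assms(2) by (intro equalityI) auto
qed

text \<open>Nearby histories still end inside the window, where the deviator's speed is c; this
  constraint is closed and convex, so the hull inherits it. At the ends of the window the hull may
  mix speeds, hence the strict inequalities. The rival's speed stays free.\<close>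

lemma limit_speeds_hold_during:
  assumes "feasible_history g (s, Y)" "t < s" "s < t + \<tau>"
  shows "limit_speeds g (\<sigma>(k := hold c t \<tau> (\<sigma> k))) (s, Y) \<subseteq> {(v1, v2). capability k (v1, v2, g) = c}"
proof -
  have "closed {(v1 :: real, v2 :: real). capability k (v1, v2, g) = c}"
    by (cases k) (auto simp: case_prod_unfold intro!: closed_Collect_eq continuous_intros)
  moreover have "convex {(v1 :: real, v2 :: real). capability k (v1, v2, g) = c}"
    by (cases k) (auto simp: convex_def algebra_simps distrib_right[symmetric])
  moreover have "(speed g ((\<sigma>(k := hold c t \<tau> (\<sigma> k))) Firm1) h', speed g ((\<sigma>(k := hold c t \<tau> (\<sigma> k))) Firm2) h')
      \<in> {(v1, v2). capability k (v1, v2, g) = c}"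
    if "feasible_history g h'" "hist_dist (s, Y) h' < min (s - t) (t + \<tau> - s)" for h'
  proof -
    have "\<bar>s - fst h'\<bar> \<le> hist_dist (s, Y) h'"
      using hist_dist_ge_time[OF assms(1), of "fst h'" "snd h'"] that by simp
    then have "t \<le> fst h'" "fst h' < t + \<tau>" using that by auto
    then show ?thesis by (cases k) (auto simp: speed_def hold_def)
  qed
  moreover have "min (s - t) (t + \<tau> - s) > 0" using assms by auto
  ultimately show ?thesis by (intro limit_speeds_subset)
qed

text \<open>A solution under the deviation up to the end of the window, followed by any solution
  under the old profile, solves the inclusion of the deviation, because the limit speeds coincide
  after the window. Equilibrium therefore bounds the payoff of every such Z, not only that of the
  path Y constructed first.\<close>

lemma spe_constant_speed_deviation:
  assumes \<sigma>: "spe \<alpha> \<beta> r g lam \<sigma>" and h: "feasible_history g (t, S)"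
    and c: "c \<in> {0..1}" and \<tau>: "\<tau> \<ge> 0"
  obtains Y where "bounded_speed g {0..} Y" "\<And>s. s \<in> {0..t} \<Longrightarrow> Y s = S s"
    "\<And>s. s \<in> {t..t + \<tau>} \<Longrightarrow> capability k (Y s) = capability k (S t) + c * (s - t)"
    "Y \<in> continuations g \<sigma> (t + \<tau>, Y)"
    "\<And>Z. Z \<in> continuations g \<sigma> (t + \<tau>, Y) \<Longrightarrow>
       bounded_speed g {0..} Z \<and> path_payoff \<alpha> \<beta> r lam k t Z \<le> payoff \<alpha> \<beta> r g lam k \<sigma> (t, S)"
proof -
  let ?\<sigma> = "\<sigma>(k := hold c t \<tau> (\<sigma> k))"
  have st: "is_strategy g (\<sigma> i)" for i using \<sigma> by (simp add: spe_def)
  have st': "is_strategy g (?\<sigma> i)" for i using st is_strategy_hold[OF st c] by simp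
  have t: "t \<ge> 0" using h by (simp add: feasible_history_iff[OF g])
  obtain Y where Y: "Y \<in> continuations g ?\<sigma> (t, S)"
    using continuations_nonempty[where \<sigma> = ?\<sigma>, OF g st' h] by blast
  have Yb: "bounded_speed g {0..} Y" by (rule continuation_bounded_speed[where \<sigma> = ?\<sigma>, OF g st' h Y])
  have f: "feasible_history g (s, Y)" if "s \<ge> 0" for s
    using that bounded_speed_subset[OF Yb, of "{0..s}"] by (auto simp: feasible_history_iff[OF g])
  have YS: "\<And>s. s \<in> {0..t} \<Longrightarrow> Y s = S s" and ac: "\<And>T. T \<ge> 0 \<Longrightarrow> abs_continuous_on {0..T} Y"
    and der: "AE s in lborel. t < s \<longrightarrow> (\<exists>v1 v2. (v1, v2) \<in> limit_speeds g ?\<sigma> (s, Y) \<and>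
           (Y has_vector_derivative (v1, v2, g)) (at s))"
    using Y by (auto simp: continuations_def)
  have cap: "capability k (Y s) = capability k (S t) + c * (s - t)" if s: "s \<in> {t..t + \<tau>}" for s
  proof -
    have *: "F (Y s) - F (Y t) \<le> c' * (s - t)"
      if "bounded_linear F" "\<And>v1 v2. capability k (v1, v2, g) = c \<Longrightarrow> F (v1, v2, g) \<le> c'" for F c'
    proof (rule abs_continuous_on_linear_increment_le[OF _ that(1)])
      show "abs_continuous_on {t..s} Y" using ac[of s] s t by (auto intro: abs_continuous_on_subset)
      show "AE u in lborel. t < u \<and> u < s \<longrightarrow> (\<exists>v. (Y has_vector_derivative v) (at u) \<and> F v \<le> c')"
        using der
      proof (rule eventually_mono, intro impI)
        fix u assume "t < u \<longrightarrow> (\<exists>v1 v2. (v1, v2) \<in> limit_speeds g ?\<sigma> (u, Y) \<and>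
           (Y has_vector_derivative (v1, v2, g)) (at u))" and u: "t < u \<and> u < s"
        then obtain v1 v2 where v: "(v1, v2) \<in> limit_speeds g ?\<sigma> (u, Y)" "(Y has_vector_derivative (v1, v2, g)) (at u)"
          by blast
        have "capability k (v1, v2, g) = c"
          using limit_speeds_hold_during[of u Y t \<tau> \<sigma> k c] f[of u] u s t v(1) by auto
        then show "\<exists>v. (Y has_vector_derivative v) (at u) \<and> F v \<le> c'" using that(2) v(2) by blast
      qed
    qed (use s in auto)
    \<comment> \<open>Applied to the capability and to its negative, the increment bound becomes an
      equality.\<close>
    show ?thesis
      using *[of "capability k" c] *[of "\<lambda>p. - capability k p" "- c"] YS[of t] t
      by (simp add: bounded_linear_capability bounded_linear_minus)
  qed
  show ?thesis
  proof (rule that[OF Yb YS cap])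
    show "Y \<in> continuations g \<sigma> (t + \<tau>, Y)"
      unfolding continuations_def prod.case mem_Collect_eq
    proof (intro conjI ballI allI impI ac)
      show "AE s in lborel. t + \<tau> < s \<longrightarrow> (\<exists>v1 v2. (v1, v2) \<in> limit_speeds g \<sigma> (s, Y) \<and>
           (Y has_vector_derivative (v1, v2, g)) (at s))"
        using der
      proof (rule eventually_mono, intro impI)
        fix s assume "t < s \<longrightarrow> (\<exists>v1 v2. (v1, v2) \<in> limit_speeds g ?\<sigma> (s, Y) \<and>
           (Y has_vector_derivative (v1, v2, g)) (at s))" "t + \<tau> < s"
        then show "\<exists>v1 v2. (v1, v2) \<in> limit_speeds g \<sigma> (s, Y) \<and> (Y has_vector_derivative (v1, v2, g)) (at s)"
          using limit_speeds_hold_after[OF f, of s t \<tau> \<sigma> k c] t \<tau> by auto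
      qed
    qed auto
  next
    fix Z assume Z: "Z \<in> continuations g \<sigma> (t + \<tau>, Y)"
    have Zb: "bounded_speed g {0..} Z"
      using continuation_bounded_speed[where \<sigma> = \<sigma>, OF g st f Z] t \<tau> by simp
    have fZ: "feasible_history g (s, Z)" if "s \<ge> 0" for s
      using that bounded_speed_subset[OF Zb, of "{0..s}"] by (auto simp: feasible_history_iff[OF g])
    have ZY: "\<And>s. s \<in> {0..t + \<tau>} \<Longrightarrow> Z s = Y s" and acZ: "\<And>T. T \<ge> 0 \<Longrightarrow> abs_continuous_on {0..T} Z"
      and derZ: "AE s in lborel. t + \<tau> < s \<longrightarrow> (\<exists>v1 v2. (v1, v2) \<in> limit_speeds g \<sigma> (s, Z) \<and>
           (Z has_vector_derivative (v1, v2, g)) (at s))"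
      using Z by (auto simp: continuations_def)
    have net: "AE s in lborel. s \<noteq> t + \<tau>" using AE_lborel_singleton by blast
    have "Z \<in> continuations g ?\<sigma> (t, S)"
      unfolding continuations_def prod.case mem_Collect_eq
    proof (intro conjI ballI allI impI acZ)
      show "Z s = S s" if "s \<in> {0..t}" for s using that YS[of s] ZY[of s] \<tau> by auto
      show "AE s in lborel. t < s \<longrightarrow> (\<exists>v1 v2. (v1, v2) \<in> limit_speeds g ?\<sigma> (s, Z) \<and>
           (Z has_vector_derivative (v1, v2, g)) (at s))"
        using der derZ net
      proof eventually_elim
        case (elim s)
        show ?case
        proof
          assume s: "t < s"
          show "\<exists>v1 v2. (v1, v2) \<in> limit_speeds g ?\<sigma> (s, Z) \<and> (Z has_vector_derivative (v1, v2, g)) (at s)"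
          proof (cases "s < t + \<tau>")
            case True
            then obtain v1 v2 where v: "(v1, v2) \<in> limit_speeds g ?\<sigma> (s, Y)" "(Y has_vector_derivative (v1, v2, g)) (at s)"
              using elim s by blast
            have "limit_speeds g ?\<sigma> (s, Z) = limit_speeds g ?\<sigma> (s, Y)"
              using True s t by (intro limit_speeds_cong) (auto intro: ZY)
            moreover have "(Z has_vector_derivative (v1, v2, g)) (at s)"
              using True s t by (intro has_vector_derivative_transform_within_open[OF v(2), of "{t<..<t + \<tau>}"]) (auto simp: ZY)
            ultimately show ?thesis using v(1) by auto
          next
            case False
            then have "t + \<tau> < s" using elim by simp
            then show ?thesis using elim limit_speeds_hold_after[OF fZ, of s t \<tau> \<sigma> k c] t \<tau> by auto
          qed
        qed
      qed
    qed
    then have "path_payoff \<alpha> \<beta> r lam k t Z \<le> payoff \<alpha> \<beta> r g lam k ?\<sigma> (t, S)"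
      unfolding payoff_def by (auto intro: SUP_upper2)
    also have "\<dots> \<le> payoff \<alpha> \<beta> r g lam k \<sigma> (t, S)"
      using \<sigma> h is_strategy_hold[OF st c] unfolding spe_def by blast
    finally show "bounded_speed g {0..} Z \<and> path_payoff \<alpha> \<beta> r lam k t Z \<le> payoff \<alpha> \<beta> r g lam k \<sigma> (t, S)"
      using Zb by blast
  qed
qed

end

section \<open>Payoffs along paths\<close>

lemma continuous_on_halfline:
  fixes f :: "real \<Rightarrow> 'a::topological_space"
  assumes "\<And>b. continuous_on {a..b} f"
  shows "continuous_on {a..} f"
  unfolding continuous_on_eq_continuous_within
proof
  fix x assume x: "x \<in> {a..}"
  have "continuous (at x within {a..x + 1}) f"
    using assms[of "x + 1"] x by (auto simp: continuous_on_eq_continuous_within)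
  moreover have "at x within {a..x + 1} = at x within {a..}"
    by (rule at_within_nhd[of x "{x - 1<..<x + 1}"]) auto
  ultimately show "continuous (at x within {a..}) f" by (simp add: continuous_within)
qed

lemma continuous_on_borel_measurable_indicator:
  fixes f :: "real \<Rightarrow> real"
  assumes "continuous_on A f" "A \<in> sets borel"
  shows "(\<lambda>s. ennreal (f s) * indicator A s) \<in> borel_measurable borel"
proof -
  have "(\<lambda>s. indicator A s *\<^sub>R f s) \<in> borel_measurable borel"
    using assms by (intro borel_measurable_continuous_on_indicator)
  then have "(\<lambda>s. ennreal (indicator A s *\<^sub>R f s)) \<in> borel_measurable borel" by measurable
  also have "(\<lambda>s. ennreal (indicator A s *\<^sub>R f s)) = (\<lambda>s. ennreal (f s) * indicator A s)"
    by (auto simp: fun_eq_iff split: split_indicator)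
  finally show ?thesis .
qed

lemma nn_integral_Icc_eq_integral:
  fixes f :: "real \<Rightarrow> real"
  assumes "continuous_on {a..b} f" "\<And>s. s \<in> {a..b} \<Longrightarrow> 0 \<le> f s"
  shows "(\<integral>\<^sup>+s\<in>{a..b}. ennreal (f s) \<partial>lborel) = ennreal (integral {a..b} f)"
proof -
  have "(f has_integral integral {a..b} f) {a..b}"
    using assms(1) by (intro integrable_integral integrable_continuous_real)
  from nn_integral_has_integral_lebesgue'[OF assms(2) this] show ?thesis by simp
qed

lemma nn_integral_halfline_SUP:
  assumes [measurable]: "f \<in> borel_measurable borel"
  shows "(\<integral>\<^sup>+s\<in>{a..}. f s \<partial>lborel) = (SUP n. \<integral>\<^sup>+s\<in>{a..a + real n}. f s \<partial>lborel)"
proof -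
  have "(SUP n. f s * indicator {a..a + real n} s) = f s * indicator {a..} s" for s
  proof (rule antisym)
    show "(SUP n. f s * indicator {a..a + real n} s) \<le> f s * indicator {a..} s"
      by (rule SUP_least) (auto split: split_indicator)
    obtain n :: nat where "s - a \<le> n" using real_arch_simple by blast
    then have "f s * indicator {a..} s \<le> f s * indicator {a..a + real n} s"
      by (auto split: split_indicator)
    then show "f s * indicator {a..} s \<le> (SUP n. f s * indicator {a..a + real n} s)"
      by (rule order_trans) (auto intro: SUP_upper)
  qed
  then have "(\<integral>\<^sup>+s\<in>{a..}. f s \<partial>lborel) = (\<integral>\<^sup>+s. (SUP n. f s * indicator {a..a + real n} s) \<partial>lborel)"
    by simp
  also have "\<dots> = (SUP n. \<integral>\<^sup>+s\<in>{a..a + real n}. f s \<partial>lborel)"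
  proof (rule nn_integral_monotone_convergence_SUP)
    show "incseq (\<lambda>n s. f s * indicator {a..a + real n} s)"
      by (auto simp: incseq_def le_fun_def split: split_indicator)
  qed measurable
  finally show ?thesis .
qed

locale development_game =
  fixes \<alpha> \<beta> r g lam0 :: real and \<phi> lam :: "real \<Rightarrow> real"
  assumes \<alpha>_gt_\<beta>: "\<alpha> > \<beta>" and \<beta>_pos: "\<beta> > 0" and r_gt: "r > \<alpha> - \<beta>" and g: "0 < g" "g < 1"
    and lam0: "lam0 \<ge> 0"
    and \<phi>_cont: "continuous_on {0..} \<phi>" and \<phi>_mono: "mono_on {0..} \<phi>" and \<phi>_concave: "concave_on {0..} \<phi>"
    and \<phi>_0: "\<phi> 0 = 0"
    and lam_nonpos: "\<And>D. D \<le> 0 \<Longrightarrow> lam D = 0"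
    and lam_pos: "\<And>D. D > 0 \<Longrightarrow> lam D = lam0 + \<phi> D"
begin

lemma \<phi>_nonneg: "D \<ge> 0 \<Longrightarrow> \<phi> D \<ge> 0"
  using mono_onD[OF \<phi>_mono, of 0 D] \<phi>_0 by simp

lemma lam_nonneg: "lam D \<ge> 0"
  using lam_nonpos[of D] lam_pos[of D] \<phi>_nonneg[of D] lam0 by (cases "D > 0") auto

lemma lam_mono: "D \<le> E \<Longrightarrow> lam D \<le> lam E"
proof (cases "D > 0")
  case True
  assume "D \<le> E"
  then show ?thesis using True \<phi>_mono by (auto simp: lam_pos mono_on_def)
qed (use lam_nonneg lam_nonpos in auto)

lemma lam_measurable [measurable]: "lam \<in> borel_measurable borel"
  by (rule borel_measurable_mono) (simp add: mono_def lam_mono)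

text \<open>The hazard jumps at 0 when \<open>lam0 > 0\<close>, so the composition may be
  discontinuous; monotonicity gives measurability and a bound by the hazard at the largest
  exposure.\<close>

lemma lam_compose_integrable:
  fixes a b :: real
  assumes "continuous_on {a..b} f"
  shows "(\<lambda>u. lam (f u)) integrable_on {a..b}"
proof -
  have "compact (f ` {a..b})" using assms by (rule compact_continuous_image) (rule compact_Icc)
  then have "bdd_above (f ` {a..b})" by (simp add: compact_imp_bounded bounded_imp_bdd_above)
  then obtain B where B: "\<And>u. u \<in> {a..b} \<Longrightarrow> f u \<le> B" unfolding bdd_above_def by blast
  show ?thesis
  proof (rule measurable_bounded_by_integrable_imp_integrable)
    have "f \<in> borel_measurable (lebesgue_on {a..b})"
      using assms by (intro continuous_imp_measurable_on_sets_lebesgue) auto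
    then show "(\<lambda>u. lam (f u)) \<in> borel_measurable (lebesgue_on {a..b})"
      by (rule measurable_compose) measurable
    show "norm (lam (f u)) \<le> lam B" if "u \<in> {a..b}" for u
      using lam_mono[OF B[OF that]] lam_nonneg by simp
  qed auto
qed

definition flow :: "firm \<Rightarrow> real \<Rightarrow> path \<Rightarrow> real \<Rightarrow> real" where
  "flow i t Y s = exp (- r * (s - t) - cum_hazard lam Y t s) *
     exp (\<alpha> * capability i (Y s) - \<beta> * capability (other i) (Y s))"

abbreviation "value_of \<equiv> path_payoff \<alpha> \<beta> r lam"
abbreviation "game_value \<equiv> payoff \<alpha> \<beta> r g lam"

lemma path_payoff_flow: "value_of i t Y = (\<integral>\<^sup>+s\<in>{t..}. ennreal (flow i t Y s) \<partial>lborel)"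
  by (simp add: path_payoff_def flow_def)

context
  fixes Y assumes Y: "bounded_speed g {0..} Y"
begin

lemma Y_lipschitz: "3-lipschitz_on {0..} Y"
  by (rule bounded_speed_lipschitz[OF g Y])

lemma Y_continuous: "continuous_on {0..} Y"
  using Y_lipschitz by (rule lipschitz_on_continuous_on)

lemma capability_continuous: "continuous_on {0..} (\<lambda>s. capability i (Y s))"
  by (rule bounded_linear.continuous_on[OF bounded_linear_capability Y_continuous])

lemma exposure_continuous: "continuous_on {0..} (\<lambda>s. exposure (Y s))"
  unfolding exposure_proj by (intro continuous_intros Y_continuous)

lemma hazard_integrable: "0 \<le> a \<Longrightarrow> (\<lambda>u. lam (exposure (Y u))) integrable_on {a..b}"
  by (intro lam_compose_integrable continuous_on_subset[OF exposure_continuous]) auto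

lemma cum_hazard_nonneg: "0 \<le> t \<Longrightarrow> 0 \<le> cum_hazard lam Y t s"
  unfolding cum_hazard_def by (intro integral_nonneg hazard_integrable) (auto simp: lam_nonneg)

lemma cum_hazard_add: "0 \<le> t \<Longrightarrow> t \<le> u \<Longrightarrow> u \<le> s \<Longrightarrow> cum_hazard lam Y t s = cum_hazard lam Y t u + cum_hazard lam Y u s"
  unfolding cum_hazard_def using hazard_integrable[of t s] by (simp add: Henstock_Kurzweil_Integration.integral_combine)

lemma cum_hazard_mono: "0 \<le> t \<Longrightarrow> t \<le> u \<Longrightarrow> u \<le> s \<Longrightarrow> cum_hazard lam Y t u \<le> cum_hazard lam Y t s"
  using cum_hazard_add[of t u s] cum_hazard_nonneg[of u s] by linarith

lemma cum_hazard_le: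
  assumes "0 \<le> t" "\<And>u. u \<in> {t..s} \<Longrightarrow> lam (exposure (Y u)) \<le> f u" "f integrable_on {t..s}"
  shows "cum_hazard lam Y t s \<le> integral {t..s} f"
  unfolding cum_hazard_def using assms hazard_integrable by (intro integral_le) auto

lemma cum_hazard_continuous: "0 \<le> t \<Longrightarrow> continuous_on {t..} (cum_hazard lam Y t)"
  unfolding cum_hazard_def
  by (intro continuous_on_halfline indefinite_integral_continuous_1 hazard_integrable)

lemma flow_continuous: "0 \<le> t \<Longrightarrow> continuous_on {t..} (flow i t Y)"
  unfolding flow_def
  by (intro continuous_intros cum_hazard_continuous continuous_on_subset[OF capability_continuous]) auto

lemma flow_pos: "flow i t Y s > 0"
  by (simp add: flow_def)

lemma flow_shift:
  assumes "0 \<le> t" "t \<le> u" "u \<le> s"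
  shows "flow i t Y s = exp (- r * (u - t) - cum_hazard lam Y t u) * flow i u Y s"
proof -
  have "exp (- r * (s - t) - cum_hazard lam Y t s) =
      exp (- r * (u - t) - cum_hazard lam Y t u) * exp (- r * (s - u) - cum_hazard lam Y u s)"
    by (simp add: exp_add[symmetric] cum_hazard_add[OF assms] algebra_simps)
  then show ?thesis by (simp add: flow_def)
qed

text \<open>Dynamic programming along one path: after the split the flow is a fresh flow times the
  discount and survival factor. It is stated in extended reals since the tail may be
  infinite.\<close>

lemma path_payoff_split:
  assumes "0 \<le> t" "0 \<le> \<tau>"
  shows "value_of i t Y = ennreal (integral {t..t + \<tau>} (flow i t Y)) +
    ennreal (exp (- r * \<tau> - cum_hazard lam Y t (t + \<tau>))) * value_of i (t + \<tau>) Y"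
proof -
  let ?u = "t + \<tau>"
  have c: "continuous_on {t..} (flow i t Y)" "continuous_on {?u..} (flow i ?u Y)"
    using assms by (auto intro: flow_continuous)
  have m1: "(\<lambda>s. ennreal (flow i t Y s) * indicator {t..?u} s) \<in> borel_measurable borel"
    by (rule continuous_on_borel_measurable_indicator) (auto intro: continuous_on_subset[OF c(1)])
  have m2: "(\<lambda>s. ennreal (flow i ?u Y s) * indicator {?u..} s) \<in> borel_measurable borel"
    by (rule continuous_on_borel_measurable_indicator[OF c(2)]) auto
  have "value_of i t Y = (\<integral>\<^sup>+s. ennreal (flow i t Y s) * indicator {t..?u} s +
      ennreal (exp (- r * \<tau> - cum_hazard lam Y t ?u)) * (ennreal (flow i ?u Y s) * indicator {?u..} s) \<partial>lborel)"
    unfolding path_payoff_flow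
  proof (rule nn_integral_cong_AE)
    have "AE s in lborel. s \<noteq> ?u" using AE_lborel_singleton by blast
    then show "AE s in lborel. ennreal (flow i t Y s) * indicator {t..} s = ennreal (flow i t Y s) * indicator {t..?u} s +
      ennreal (exp (- r * \<tau> - cum_hazard lam Y t ?u)) * (ennreal (flow i ?u Y s) * indicator {?u..} s)"
    proof (rule eventually_mono)
      fix s assume "s \<noteq> ?u"
      then consider "s < t" | "t \<le> s" "s < ?u" | "?u < s" by linarith
      then show "ennreal (flow i t Y s) * indicator {t..} s = ennreal (flow i t Y s) * indicator {t..?u} s +
        ennreal (exp (- r * \<tau> - cum_hazard lam Y t ?u)) * (ennreal (flow i ?u Y s) * indicator {?u..} s)"
      proof cases
        case 3
        then have "flow i t Y s = exp (- r * \<tau> - cum_hazard lam Y t ?u) * flow i ?u Y s"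
          using flow_shift[of t ?u s i] assms by simp
        then show ?thesis using 3 assms by (simp add: ennreal_mult flow_pos less_imp_le)
      qed (use assms in auto)
    qed
  qed
  also have "\<dots> = (\<integral>\<^sup>+s\<in>{t..?u}. ennreal (flow i t Y s) \<partial>lborel) +
      ennreal (exp (- r * \<tau> - cum_hazard lam Y t ?u)) * value_of i ?u Y"
    using m1 m2 unfolding path_payoff_flow
    by (subst nn_integral_add) (auto simp: nn_integral_cmult)
  also have "(\<integral>\<^sup>+s\<in>{t..?u}. ennreal (flow i t Y s) \<partial>lborel) = ennreal (integral {t..?u} (flow i t Y))"
    by (rule nn_integral_Icc_eq_integral) (auto intro: continuous_on_subset[OF c(1)] less_imp_le flow_pos)
  finally show ?thesis .
qed

end

lemma cum_hazard_cong: "(\<And>u. u \<in> {t..s} \<Longrightarrow> Y u = Z u) \<Longrightarrow> cum_hazard lam Y t s = cum_hazard lam Z t s"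
  unfolding cum_hazard_def by (rule integral_cong) simp

lemma flow_cong:
  assumes "\<And>u. u \<in> {t..s} \<Longrightarrow> Y u = Z u" "t \<le> s"
  shows "flow i t Y s = flow i t Z s"
  using cum_hazard_cong[OF assms(1)] assms unfolding flow_def by simp

text \<open>The deviation collects its window plus the discounted equilibrium value of the history
  reached. All continuations Z share the window with Y, so the window term and the factor move in
  and out of the supremum; for the sum this uses that continuations exist.\<close>

lemma spe_hold_value_step:
  assumes \<sigma>: "spe \<alpha> \<beta> r g lam \<sigma>" and h: "feasible_history g (t, S)" and c: "c \<in> {0..1}" and \<tau>: "\<tau> \<ge> 0"
  obtains Y where "bounded_speed g {0..} Y" "\<And>s. s \<in> {0..t} \<Longrightarrow> Y s = S s"
    "\<And>s. s \<in> {t..t + \<tau>} \<Longrightarrow> capability k (Y s) = capability k (S t) + c * (s - t)"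
    "\<And>Z. Z \<in> continuations g \<sigma> (t + \<tau>, Y) \<Longrightarrow> bounded_speed g {0..} Z"
    "ennreal (integral {t..t + \<tau>} (flow k t Y)) + ennreal (exp (- r * \<tau> - cum_hazard lam Y t (t + \<tau>))) *
       game_value k \<sigma> (t + \<tau>, Y) \<le> game_value k \<sigma> (t, S)"
    "\<And>Z. Z \<in> continuations g \<sigma> (t + \<tau>, Y) \<Longrightarrow>
       ennreal (integral {t..t + \<tau>} (flow k t Y)) + ennreal (exp (- r * \<tau> - cum_hazard lam Y t (t + \<tau>))) *
       value_of k (t + \<tau>) Z \<le> game_value k \<sigma> (t, S)"
    "continuations g \<sigma> (t + \<tau>, Y) \<noteq> {}"
proof -
  have t: "t \<ge> 0" using h by (simp add: feasible_history_iff[OF g])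
  obtain Y where Y: "bounded_speed g {0..} Y" "\<And>s. s \<in> {0..t} \<Longrightarrow> Y s = S s"
    "\<And>s. s \<in> {t..t + \<tau>} \<Longrightarrow> capability k (Y s) = capability k (S t) + c * (s - t)"
    "Y \<in> continuations g \<sigma> (t + \<tau>, Y)"
    and Z: "\<And>Z. Z \<in> continuations g \<sigma> (t + \<tau>, Y) \<Longrightarrow>
       bounded_speed g {0..} Z \<and> value_of k t Z \<le> game_value k \<sigma> (t, S)"
    using spe_constant_speed_deviation[OF g \<sigma> h c \<tau>, of k] by blast
  have each: "ennreal (integral {t..t + \<tau>} (flow k t Y)) + ennreal (exp (- r * \<tau> - cum_hazard lam Y t (t + \<tau>))) *
       value_of k (t + \<tau>) Z \<le> game_value k \<sigma> (t, S)" if "Z \<in> continuations g \<sigma> (t + \<tau>, Y)" for Z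
  proof -
    have eq: "Z u = Y u" if "u \<in> {t..t + \<tau>}" for u
      using \<open>Z \<in> _\<close> that t by (auto simp: continuations_def)
    have "value_of k t Z = ennreal (integral {t..t + \<tau>} (flow k t Z)) + ennreal (exp (- r * \<tau> - cum_hazard lam Z t (t + \<tau>))) *
       value_of k (t + \<tau>) Z"
      using Z[OF that] t \<tau> by (intro path_payoff_split) auto
    moreover have "cum_hazard lam Z t (t + \<tau>) = cum_hazard lam Y t (t + \<tau>)" by (rule cum_hazard_cong) (rule eq)
    moreover have "integral {t..t + \<tau>} (flow k t Z) = integral {t..t + \<tau>} (flow k t Y)"
      by (intro integral_cong flow_cong) (auto intro: eq)
    ultimately show ?thesis using Z[OF that] by simp
  qed
  have "ennreal (integral {t..t + \<tau>} (flow k t Y)) + ennreal (exp (- r * \<tau> - cum_hazard lam Y t (t + \<tau>))) *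
       game_value k \<sigma> (t + \<tau>, Y) = (SUP Z\<in>continuations g \<sigma> (t + \<tau>, Y). ennreal (integral {t..t + \<tau>} (flow k t Y)) +
         ennreal (exp (- r * \<tau> - cum_hazard lam Y t (t + \<tau>))) * value_of k (t + \<tau>) Z)"
    unfolding payoff_def fst_conv SUP_mult_left_ennreal
    by (rule ennreal_SUP_add_right) (use Y(4) in blast)
  also have "\<dots> \<le> game_value k \<sigma> (t, S)" by (rule SUP_least) (rule each)
  finally show ?thesis using that Y Z each by blast
qed

end

section \<open>The racing benchmark\<close>

lemma has_real_derivative_nonneg_imp_le:
  fixes f :: "real \<Rightarrow> real"
  assumes "a \<le> b" "\<And>x. x \<in> {a..b} \<Longrightarrow> (f has_real_derivative f' x) (at x within {a..b})"
    and "\<And>x. x \<in> {a..b} \<Longrightarrow> 0 \<le> f' x"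
  shows "f a \<le> f b"
proof -
  have "(f' has_integral f b - f a) {a..b}"
    using assms(1,2) by (intro fundamental_theorem_of_calculus)
      (auto simp: has_real_derivative_iff_has_vector_derivative)
  then have "0 \<le> f b - f a" using assms(3) by (rule has_integral_nonneg)
  then show ?thesis by simp
qed

text \<open>Monotone convergence, carried out for nonnegative extended-real integrals and
  transferred back to the gauge integral.\<close>

lemma integral_Icc_tendsto_halfline:
  fixes f :: "real \<Rightarrow> real"
  assumes cont: "continuous_on {a..} f" and nonneg: "\<And>x. a \<le> x \<Longrightarrow> 0 \<le> f x" and int: "f integrable_on {a..}"
  shows "(\<lambda>n. integral {a..a + real n} f) \<longlonglongrightarrow> integral {a..} f"
proof -
  have c: "continuous_on {a..b} f" for b using cont by (rule continuous_on_subset) auto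
  have m: "(\<lambda>s. ennreal (f s) * indicator {a..} s) \<in> borel_measurable borel"
    by (rule continuous_on_borel_measurable_indicator[OF cont]) auto
  have nn: "0 \<le> integral {a..a + real n} f" for n
    using nonneg c by (intro integral_nonneg integrable_continuous_real) auto
  have eq1: "(\<integral>\<^sup>+s\<in>{a..}. ennreal (f s) * indicator {a..} s \<partial>lborel) = ennreal (integral {a..} f)"
  proof -
    have "(\<integral>\<^sup>+s\<in>{a..}. ennreal (f s) * indicator {a..} s \<partial>lborel) = (\<integral>\<^sup>+s\<in>{a..}. ennreal (f s) \<partial>lborel)"
      by (intro nn_integral_cong) (auto split: split_indicator)
    then show ?thesis
      using nn_integral_has_integral_lebesgue'[OF _ integrable_integral[OF int]] nonneg by simp
  qed
  have eq2: "(\<integral>\<^sup>+s\<in>{a..a + real n}. ennreal (f s) * indicator {a..} s \<partial>lborel) = ennreal (integral {a..a + real n} f)" for n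
  proof -
    have "(\<integral>\<^sup>+s\<in>{a..a + real n}. ennreal (f s) * indicator {a..} s \<partial>lborel) = (\<integral>\<^sup>+s\<in>{a..a + real n}. ennreal (f s) \<partial>lborel)"
      by (intro nn_integral_cong) (auto split: split_indicator)
    then show ?thesis using nn_integral_Icc_eq_integral[OF c, of "a + real n"] nonneg by simp
  qed
  have inc: "incseq (\<lambda>n. ennreal (integral {a..a + real n} f))"
    using nonneg c unfolding incseq_def
    by (auto intro!: ennreal_leI integral_subset_le integrable_continuous_real)
  have "(\<lambda>n. ennreal (integral {a..a + real n} f)) \<longlonglongrightarrow> ennreal (integral {a..} f)"
    using LIMSEQ_SUP[OF inc] nn_integral_halfline_SUP[OF m, of a] unfolding eq1 eq2 by simp
  then show ?thesis
    using nonneg int nn by (subst (asm) tendsto_ennreal_iff) (auto intro!: integral_nonneg)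
qed

lemma continuous_bounded_integrable_halfline:
  fixes f h :: "real \<Rightarrow> real"
  assumes "continuous_on {a..} f" "h integrable_on {a..}" "\<And>x. a \<le> x \<Longrightarrow> \<bar>f x\<bar> \<le> h x"
  shows "f integrable_on {a..}"
  by (rule measurable_bounded_by_integrable_imp_integrable[OF _ assms(2)])
    (use assms(1,3) in \<open>auto intro: continuous_imp_measurable_on_sets_lebesgue\<close>)

context development_game
begin

lemma other_other [simp]: "other (other i) = i"
  by (cases i) auto

text \<open>The hazard with its right limit \<open>lam0\<close> continued to all nonpositive
  exposures. It is continuous, dominates \<open>lam\<close> and agrees with it at positive exposure;
  under joint racing the two differ at most at date 0, so the racing hazard has a derivative up to
  that date.\<close>

definition lamhat :: "real \<Rightarrow> real" where
  "lamhat D = lam0 + \<phi> (max D 0)"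

definition \<rho> :: real where "\<rho> = r - \<alpha> + \<beta>"

abbreviation "\<Lambda> \<equiv> race_hazard g lam"
abbreviation "R0 \<equiv> race_value \<alpha> \<beta> r g lam"

definition race_weight :: "real \<Rightarrow> real" where
  "race_weight s = exp (- \<rho> * s - \<Lambda> s)"

lemma \<rho>_pos: "\<rho> > 0"
  using r_gt by (simp add: \<rho>_def)

lemma lamhat_continuous: "continuous_on A lamhat"
proof -
  have "continuous_on UNIV (\<lambda>D. \<phi> (max D 0))"
    by (rule continuous_on_compose2[OF \<phi>_cont]) (auto intro!: continuous_intros)
  then show ?thesis
    unfolding lamhat_def by (intro continuous_intros) (auto intro: continuous_on_subset)
qed

lemma lamhat_eq: "D > 0 \<Longrightarrow> lamhat D = lam D"
  by (simp add: lamhat_def lam_pos)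

lemma lam_le_lamhat: "lam D \<le> lamhat D"
  using lam_nonpos[of D] lam_pos[of D] \<phi>_0 lam0 by (cases "D > 0") (auto simp: lamhat_def max_def)

lemma lamhat_mono: "D \<le> E \<Longrightarrow> lamhat D \<le> lamhat E"
  using mono_onD[OF \<phi>_mono, of "max D 0" "max E 0"] by (auto simp: lamhat_def)

lemma lamhat_nonneg: "lamhat D \<ge> 0"
  using lam_le_lamhat[of D] lam_nonneg[of D] by linarith

lemma race_hazard_lamhat: "\<Lambda> t = integral {0..t} (\<lambda>s. lamhat ((1 - g) * s))"
  unfolding race_hazard_def
  by (rule integral_spike[of "{0}"]) (use g in \<open>auto simp: lamhat_eq\<close>)

lemma lamhat_integrable: "(\<lambda>s. lamhat ((1 - g) * s)) integrable_on {a..b}"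
  by (intro integrable_continuous_real continuous_on_compose2[OF lamhat_continuous[of UNIV]] continuous_intros) auto

lemma race_hazard_has_derivative:
  assumes "0 \<le> s"
  shows "(\<Lambda> has_real_derivative lamhat ((1 - g) * s)) (at s within {0..})"
proof -
  have "((\<lambda>u. integral {0..u} (\<lambda>s. lamhat ((1 - g) * s))) has_real_derivative lamhat ((1 - g) * s)) (at s within {0..s + 1})"
    by (rule integral_has_real_derivative)
      (use assms in \<open>auto intro!: continuous_on_compose2[OF lamhat_continuous[of UNIV]] continuous_intros\<close>)
  moreover have "at s within {0..s + 1} = at s within {0..}"
    by (rule at_within_nhd[of s "{s - 1<..<s + 1}"]) auto
  ultimately show ?thesis by (simp add: race_hazard_lamhat[abs_def])
qed

lemma race_hazard_0 [simp]: "\<Lambda> 0 = 0"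
  by (simp add: race_hazard_def)

lemma race_hazard_mono: "0 \<le> s \<Longrightarrow> s \<le> t \<Longrightarrow> \<Lambda> s \<le> \<Lambda> t"
  unfolding race_hazard_lamhat by (intro integral_subset_le lamhat_integrable) (auto simp: lamhat_nonneg)

lemma race_hazard_nonneg: "0 \<le> s \<Longrightarrow> 0 \<le> \<Lambda> s"
  using race_hazard_mono[of 0 s] by simp

lemma race_hazard_continuous: "continuous_on {0..} \<Lambda>"
  using race_hazard_has_derivative
  by (intro DERIV_continuous_on) auto

lemma race_hazard_increment:
  assumes "0 \<le> \<tau>" "0 \<le> s"
  shows "\<Lambda> (\<tau> + s) - \<Lambda> \<tau> = integral {0..s} (\<lambda>u. lamhat ((1 - g) * (u + \<tau>)))"
proof -
  have "integral {0..\<tau>} (\<lambda>s. lamhat ((1 - g) * s)) + integral {\<tau>..\<tau> + s} (\<lambda>s. lamhat ((1 - g) * s)) = \<Lambda> (\<tau> + s)"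
    using assms lamhat_integrable unfolding race_hazard_lamhat by (intro Henstock_Kurzweil_Integration.integral_combine) auto
  moreover have "integral {0..s} ((\<lambda>s. lamhat ((1 - g) * s)) \<circ> (\<lambda>x. x + \<tau>)) = integral {0 + \<tau>..s + \<tau>} (\<lambda>s. lamhat ((1 - g) * s))"
    by (rule integral_shift) (auto intro!: continuous_on_compose2[OF lamhat_continuous[of UNIV]] continuous_intros)
  ultimately show ?thesis by (simp add: race_hazard_lamhat[of \<tau>] o_def add.commute)
qed

lemma race_hazard_superadditive:
  assumes "0 \<le> \<tau>" "0 \<le> s"
  shows "\<Lambda> \<tau> + \<Lambda> s \<le> \<Lambda> (\<tau> + s)"
proof -
  have "\<Lambda> s \<le> integral {0..s} (\<lambda>u. lamhat ((1 - g) * (u + \<tau>)))"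
    unfolding race_hazard_lamhat
  proof (intro integral_le lamhat_integrable)
    show "(\<lambda>u. lamhat ((1 - g) * (u + \<tau>))) integrable_on {0..s}"
      by (intro integrable_continuous_real continuous_on_compose2[OF lamhat_continuous[of UNIV]] continuous_intros) auto
    show "lamhat ((1 - g) * u) \<le> lamhat ((1 - g) * (u + \<tau>))" if "u \<in> {0..s}" for u
      using that assms g by (intro lamhat_mono mult_left_mono) auto
  qed
  then show ?thesis using race_hazard_increment[OF assms] by simp
qed

text \<open>Concavity with \<open>\<phi> 0 = 0\<close> puts \<open>\<phi>\<close> above its chords
  from the origin; the chord bounds at x and y add up to the value at x + y.\<close>

lemma \<phi>_subadditive:
  assumes "0 \<le> x" "0 \<le> y"
  shows "\<phi> (x + y) \<le> \<phi> x + \<phi> y"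
proof (cases "x + y = 0")
  case True
  then show ?thesis using assms \<phi>_0 by (simp add: add_nonneg_eq_0_iff)
next
  case False
  then have xy: "x + y > 0" using assms by simp
  have *: "z / (x + y) * \<phi> (x + y) \<le> \<phi> z" if "0 \<le> z" "z \<le> x + y" for z
  proof -
    define p where "p = z / (x + y)"
    have p: "0 \<le> p" "p \<le> 1" using that xy by (auto simp: p_def)
    have "- \<phi> ((1 - p) *\<^sub>R 0 + p *\<^sub>R (x + y)) \<le> (1 - p) * - \<phi> 0 + p * - \<phi> (x + y)"
      using \<phi>_concave xy p unfolding concave_on_def by (intro convex_onD[of "{0..}"]) auto
    moreover have "(1 - p) *\<^sub>R 0 + p *\<^sub>R (x + y) = z" using xy by (simp add: p_def)
    ultimately show ?thesis using \<phi>_0 by (simp add: p_def)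
  qed
  have "\<phi> (x + y) = x / (x + y) * \<phi> (x + y) + y / (x + y) * \<phi> (x + y)"
    using xy by (simp add: distrib_right[symmetric] add_divide_distrib[symmetric])
  also have "\<dots> \<le> \<phi> x + \<phi> y" using assms by (intro add_mono *) auto
  finally show ?thesis .
qed

text \<open>By subadditivity a head start of \<open>(1 - g) * \<tau>\<close> in exposure adds at
  most a constant to the hazard rate.\<close>

lemma race_hazard_concave_bound:
  assumes "0 \<le> \<tau>" "0 \<le> s"
  shows "\<Lambda> (\<tau> + s) \<le> \<Lambda> \<tau> + \<Lambda> s + \<phi> ((1 - g) * \<tau>) * s"
proof -
  have "integral {0..s} (\<lambda>u. lamhat ((1 - g) * (u + \<tau>))) \<le> integral {0..s} (\<lambda>u. lamhat ((1 - g) * u) + \<phi> ((1 - g) * \<tau>))"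
  proof (intro integral_le)
    show "(\<lambda>u. lamhat ((1 - g) * (u + \<tau>))) integrable_on {0..s}" "(\<lambda>u. lamhat ((1 - g) * u) + \<phi> ((1 - g) * \<tau>)) integrable_on {0..s}"
      by (intro integrable_continuous_real continuous_on_compose2[OF lamhat_continuous[of UNIV]] continuous_intros; auto)+
    show "lamhat ((1 - g) * (u + \<tau>)) \<le> lamhat ((1 - g) * u) + \<phi> ((1 - g) * \<tau>)" if "u \<in> {0..s}" for u
      using \<phi>_subadditive[of "(1 - g) * u" "(1 - g) * \<tau>"] that assms g
      by (simp add: lamhat_def distrib_left max_absorb1)
  qed
  also have "\<dots> = \<Lambda> s + \<phi> ((1 - g) * \<tau>) * s"
    using assms lamhat_integrable unfolding race_hazard_lamhat by (subst integral_add) auto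
  finally show ?thesis using race_hazard_increment[OF assms] by simp
qed

lemma race_weight_pos: "race_weight s > 0"
  by (simp add: race_weight_def)

lemma race_weight_continuous: "continuous_on {0..} race_weight"
  unfolding race_weight_def by (intro continuous_intros race_hazard_continuous)

lemma race_weight_integrable: "race_weight integrable_on {0..}"
proof (rule continuous_bounded_integrable_halfline[OF race_weight_continuous])
  show "(\<lambda>x. exp (- \<rho> * x)) integrable_on {0..}"
    using integrable_on_exp_minus_to_infinity[OF \<rho>_pos] by simp
  show "\<bar>race_weight x\<bar> \<le> exp (- \<rho> * x)" if "0 \<le> x" for x
    using race_hazard_nonneg[OF that] by (simp add: race_weight_def)
qed

lemma race_value_eq: "R0 = integral {0..} race_weight"
  unfolding race_value_def race_weight_def \<rho>_def by (simp add: algebra_simps)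

definition race_integral :: "real \<Rightarrow> real" where
  "race_integral T = integral {0..T} race_weight"

definition race_tail :: "real \<Rightarrow> real" where
  "race_tail T = R0 - race_integral T"

lemma race_weight_integrable_Icc: "0 \<le> a \<Longrightarrow> race_weight integrable_on {a..b}"
  by (intro integrable_continuous_real continuous_on_subset[OF race_weight_continuous]) auto

lemma race_integral_le: "0 \<le> T \<Longrightarrow> race_integral T \<le> R0"
  unfolding race_integral_def race_value_eq
  by (intro integral_subset_le race_weight_integrable race_weight_integrable_Icc) (auto simp: race_weight_pos less_imp_le)

lemma race_integral_tendsto: "(\<lambda>n. race_integral (real n)) \<longlonglongrightarrow> R0"
  using integral_Icc_tendsto_halfline[OF race_weight_continuous _ race_weight_integrable]
  by (simp add: race_integral_def race_value_eq race_weight_pos less_imp_le)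

lemma race_integral_has_derivative:
  assumes "0 \<le> s"
  shows "(race_integral has_real_derivative race_weight s) (at s within {0..})"
proof -
  have "((\<lambda>u. integral {0..u} race_weight) has_real_derivative race_weight s) (at s within {0..s + 1})"
    by (rule integral_has_real_derivative) (use assms in \<open>auto intro!: continuous_on_subset[OF race_weight_continuous]\<close>)
  moreover have "at s within {0..s + 1} = at s within {0..}"
    by (rule at_within_nhd[of s "{s - 1<..<s + 1}"]) auto
  ultimately show ?thesis by (simp add: race_integral_def[abs_def])
qed

lemma race_weight_has_derivative:
  assumes "0 \<le> s"
  shows "(race_weight has_real_derivative - (\<rho> + lamhat ((1 - g) * s)) * race_weight s) (at s within {0..})"
  unfolding race_weight_def
  by (auto intro!: derivative_eq_intros race_hazard_has_derivative[OF assms] simp: algebra_simps)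

lemma race_integral_increment:
  assumes "0 \<le> \<tau>" "0 \<le> s"
  shows "race_integral (\<tau> + s) - race_integral \<tau> = integral {0..s} (\<lambda>u. race_weight (u + \<tau>))"
proof -
  have "race_integral \<tau> + integral {\<tau>..\<tau> + s} race_weight = race_integral (\<tau> + s)"
    using assms race_weight_integrable_Icc unfolding race_integral_def by (intro Henstock_Kurzweil_Integration.integral_combine) auto
  moreover have "integral {0..s} (race_weight \<circ> (\<lambda>x. x + \<tau>)) = integral {0 + \<tau>..s + \<tau>} race_weight"
    by (rule integral_shift) (use assms in \<open>auto intro!: continuous_on_subset[OF race_weight_continuous]\<close>)
  ultimately show ?thesis by (simp add: o_def add.commute)
qed

lemma race_weight_shift_continuous: "0 \<le> \<tau> \<Longrightarrow> continuous_on {0..s} (\<lambda>u. race_weight (u + \<tau>))"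
  by (rule continuous_on_compose2[OF race_weight_continuous]) (auto intro!: continuous_intros)

lemma race_tail_pos:
  assumes "0 \<le> \<tau>"
  shows "race_tail \<tau> > 0"
proof -
  have "race_integral \<tau> < race_integral (\<tau> + 1)"
  proof -
    have "race_integral (\<tau> + 1) - race_integral \<tau> \<ge> integral {0..1::real} (\<lambda>u. race_weight (\<tau> + 1))"
      unfolding race_integral_increment[OF assms zero_le_one]
    proof (intro integral_le integrable_continuous_real race_weight_shift_continuous assms)
      show "race_weight (\<tau> + 1) \<le> race_weight (u + \<tau>)" if "u \<in> {0..1}" for u
      proof -
        have "\<Lambda> (u + \<tau>) \<le> \<Lambda> (\<tau> + 1)" using that assms by (intro race_hazard_mono) auto
        moreover have "\<rho> * (u + \<tau>) \<le> \<rho> * (\<tau> + 1)" using that \<rho>_pos by (intro mult_left_mono) auto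
        ultimately show ?thesis by (simp add: race_weight_def)
      qed
    qed auto
    then show ?thesis using race_weight_pos[of "\<tau> + 1"] by simp
  qed
  moreover have "race_integral (\<tau> + 1) \<le> R0" using assms by (intro race_integral_le) auto
  ultimately show ?thesis by (simp add: race_tail_def)
qed

lemma race_value_pos: "R0 > 0"
  using race_tail_pos[of 0] by (simp add: race_tail_def race_integral_def)

text \<open>Superadditivity of the racing hazard: a race resumed at higher exposure is worth no
  more, in current units, than one started on the threshold.\<close>

lemma race_tail_le:
  assumes "0 \<le> \<tau>"
  shows "race_tail \<tau> \<le> R0 * race_weight \<tau>"
proof -
  have "race_integral (\<tau> + real n) - race_integral \<tau> \<le> R0 * race_weight \<tau>" for n
  proof -
    have "race_integral (\<tau> + real n) - race_integral \<tau> \<le> integral {0..real n} (\<lambda>u. race_weight \<tau> * race_weight u)"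
      unfolding race_integral_increment[OF assms of_nat_0_le_iff]
    proof (intro integral_le integrable_continuous_real race_weight_shift_continuous assms)
      show "continuous_on {0..real n} (\<lambda>u. race_weight \<tau> * race_weight u)"
        by (intro continuous_intros continuous_on_subset[OF race_weight_continuous]) auto
      show "race_weight (u + \<tau>) \<le> race_weight \<tau> * race_weight u" if "u \<in> {0..real n}" for u
        using race_hazard_superadditive[of \<tau> u] that assms
        by (simp add: race_weight_def exp_add[symmetric] algebra_simps)
    qed
    also have "\<dots> = race_weight \<tau> * race_integral (real n)" by (simp add: race_integral_def)
    also have "\<dots> \<le> race_weight \<tau> * R0"
      by (intro mult_left_mono race_integral_le) (auto simp: race_weight_pos less_imp_le)
    finally show ?thesis by (simp add: mult.commute)
  qed
  moreover have "race_integral (real n) \<le> race_integral (\<tau> + real n)" for n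
    unfolding race_integral_def using assms
    by (intro integral_subset_le race_weight_integrable_Icc) (auto simp: race_weight_pos less_imp_le)
  ultimately have "race_integral (real n) - race_integral \<tau> \<le> R0 * race_weight \<tau>" for n
    by (smt (verit))
  then show ?thesis
    unfolding race_tail_def
    by (intro LIMSEQ_le_const2[OF tendsto_diff[OF race_integral_tendsto tendsto_const]]) auto
qed

text \<open>With v = tail / weight this says that 1 / v exceeds 1 / R(0) by at most
  \<open>\<phi> ((1 - g) * \<tau>)\<close>. The exposure built up so far adds at most a constant c
  to the hazard rate, and an extra constant rate c cannot bring the value of the race below
  \<open>R0 / (1 + c * R0)\<close>.\<close>

lemma race_tail_ge:
  assumes "0 \<le> \<tau>"
  shows "R0 * race_weight \<tau> \<le> (1 + \<phi> ((1 - g) * \<tau>) * R0) * race_tail \<tau>"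
proof -
  define c where "c = \<phi> ((1 - g) * \<tau>)"
  have c: "c \<ge> 0" unfolding c_def using assms g by (intro \<phi>_nonneg) auto
  \<comment> \<open>The value of racing from a threshold tie up to date s under the extra killing
    rate c.\<close>
  define J where "J s = integral {0..s} (\<lambda>u. exp (- c * u) * race_weight u)" for s
  have cont: "continuous_on {0..s} (\<lambda>u. exp (- c * u) * race_weight u)" for s
    by (intro continuous_intros continuous_on_subset[OF race_weight_continuous]) auto
  have J: "(J has_real_derivative exp (- c * s) * race_weight s) (at s within {0..n})" if "s \<in> {0..n}" for s n
    unfolding J_def[abs_def] by (rule integral_has_real_derivative[OF cont that])
  have 1: "race_weight \<tau> * J (real n) \<le> race_tail \<tau>" for n
  proof -
    have "race_weight \<tau> * J (real n) = integral {0..real n} (\<lambda>u. race_weight \<tau> * (exp (- c * u) * race_weight u))"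
      by (simp add: J_def)
    also have "\<dots> \<le> race_integral (\<tau> + real n) - race_integral \<tau>"
      unfolding race_integral_increment[OF assms of_nat_0_le_iff]
    proof (intro integral_le integrable_continuous_real race_weight_shift_continuous assms)
      show "continuous_on {0..real n} (\<lambda>u. race_weight \<tau> * (exp (- c * u) * race_weight u))"
        by (intro continuous_intros continuous_on_subset[OF race_weight_continuous]) auto
      show "race_weight \<tau> * (exp (- c * u) * race_weight u) \<le> race_weight (u + \<tau>)" if "u \<in> {0..real n}" for u
        using race_hazard_concave_bound[of \<tau> u] that assms
        by (simp add: race_weight_def exp_add[symmetric] algebra_simps c_def)
    qed
    also have "\<dots> \<le> race_tail \<tau>" using race_integral_le[of "\<tau> + real n"] assms by (simp add: race_tail_def)
    finally show ?thesis .
  qed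
  have 2: "R0 \<le> race_tail (real n) + (1 + c * R0) * J (real n)" for n
  proof -
    \<comment> \<open>Integration by parts in monotone form: f starts at R(0) and its derivative is
      nonnegative by \<open>race_tail_le\<close>, which bounds J from below up to a vanishing
      tail.\<close>
    define f where "f s = exp (- c * s) * race_tail s + (1 + c * R0) * J s" for s
    have "f 0 \<le> f (real n)"
    proof (rule has_real_derivative_nonneg_imp_le[where f = f and f' = "\<lambda>s. c * exp (- c * s) * (R0 * race_weight s - race_tail s)"])
      fix s assume s: "s \<in> {0..real n}"
      have "(race_integral has_real_derivative race_weight s) (at s within {0..real n})"
        using race_integral_has_derivative[of s] s by (auto intro: DERIV_subset)
      then show "(f has_real_derivative c * exp (- c * s) * (R0 * race_weight s - race_tail s)) (at s within {0..real n})"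
        unfolding f_def race_tail_def
        by (auto intro!: derivative_eq_intros J[OF s] simp: algebra_simps)
      show "0 \<le> c * exp (- c * s) * (R0 * race_weight s - race_tail s)"
        using race_tail_le[of s] s c by simp
    next
      show "0 \<le> real n" by simp
    qed
    also have "f (real n) \<le> race_tail (real n) + (1 + c * R0) * J (real n)"
    proof -
      have "exp (- c * real n) \<le> 1" using c by simp
      then show ?thesis using race_tail_pos[of "real n"] by (simp add: f_def)
    qed
    finally show ?thesis by (simp add: f_def race_tail_def race_integral_def J_def)
  qed
  have 3: "R0 - race_tail (real n) \<le> (1 + c * R0) * (race_tail \<tau> / race_weight \<tau>)" for n
  proof -
    have "J (real n) \<le> race_tail \<tau> / race_weight \<tau>"
      using 1[of n] race_weight_pos[of \<tau>] by (simp add: field_simps)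
    then have "(1 + c * R0) * J (real n) \<le> (1 + c * R0) * (race_tail \<tau> / race_weight \<tau>)"
      using c race_value_pos by (intro mult_left_mono) auto
    then show ?thesis using 2[of n] by linarith
  qed
  have "(\<lambda>n. race_tail (real n)) \<longlonglongrightarrow> R0 - R0"
    unfolding race_tail_def by (intro tendsto_intros race_integral_tendsto)
  then have "(\<lambda>n. R0 - race_tail (real n)) \<longlonglongrightarrow> R0 - (R0 - R0)" by (intro tendsto_intros)
  then have "R0 - (R0 - R0) \<le> (1 + c * R0) * (race_tail \<tau> / race_weight \<tau>)"
    by (rule LIMSEQ_le_const2) (use 3 in auto)
  then show ?thesis using race_weight_pos[of \<tau>] by (simp add: c_def field_simps)
qed

lemma flow_integral_ge:
  assumes Y: "bounded_speed g {0..} Y" and t: "0 \<le> t" and f: "continuous_on {0..\<tau>} f"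
    and le: "\<And>s. s \<in> {0..\<tau>} \<Longrightarrow> f s \<le> flow k t Y (t + s)"
  shows "integral {0..\<tau>} f \<le> integral {t..t + \<tau>} (flow k t Y)"
proof -
  have c: "continuous_on {t..t + \<tau>} (flow k t Y)"
    by (rule continuous_on_subset[OF flow_continuous[OF Y t]]) auto
  have "integral {0..\<tau>} (flow k t Y \<circ> (\<lambda>x. x + t)) = integral {0 + t..\<tau> + t} (flow k t Y)"
    by (rule integral_shift) (use c in \<open>auto simp: add.commute\<close>)
  then have eq: "integral {t..t + \<tau>} (flow k t Y) = integral {0..\<tau>} (\<lambda>s. flow k t Y (t + s))"
    by (simp add: o_def add.commute)
  show ?thesis unfolding eq
  proof (intro integral_le integrable_continuous_real f le)
    show "continuous_on {0..\<tau>} (\<lambda>s. flow k t Y (t + s))"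
      by (rule continuous_on_compose2[OF c]) (auto intro!: continuous_intros)
  qed
qed

lemma capability_increment:
  assumes "bounded_speed g I Y" "s \<in> I" "s' \<in> I" "s \<le> s'"
  shows "capability i (Y s') - capability i (Y s) \<in> {0..s' - s}"
  using assms by (cases i) (auto simp: capability_proj bounded_speed_def)

lemma position_increment:
  assumes "bounded_speed g I Y" "s \<in> I" "s' \<in> I" "s \<le> s'"
  shows "snd (snd (Y s')) = snd (snd (Y s)) + g * (s' - s)"
proof -
  have "snd (snd (Y s')) - snd (snd (Y s)) = g * (s' - s)"
    using assms unfolding bounded_speed_def by blast
  then show ?thesis by simp
qed

lemma exposure_capability: "exposure p = max (capability i p) (capability (other i) p) - snd (snd p)"
  by (cases i) (auto simp: exposure_proj capability_proj max.commute)

text \<open>Exposure grows at rate at most 1 - g, so from a safe state no behaviour accumulates more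
  hazard than joint racing from the threshold.\<close>

lemma race_cum_hazard_le:
  assumes Y: "bounded_speed g {0..} Y" and t: "0 \<le> t" and s: "0 \<le> s"
    and safe: "exposure (Y t) \<le> 0"
  shows "cum_hazard lam Y t (t + s) \<le> \<Lambda> s"
proof -
  have "cum_hazard lam Y t (t + s) \<le> integral {t..t + s} (\<lambda>u. lamhat ((1 - g) * (u - t)))"
  proof (rule cum_hazard_le[OF Y t])
    fix u assume u: "u \<in> {t..t + s}"
    have "exposure (Y u) \<le> exposure (Y t) + (1 - g) * (u - t)"
      using capability_increment[OF Y, of t u Firm1] capability_increment[OF Y, of t u Firm2]
        position_increment[OF Y, of t u] u t
      by (auto simp: exposure_capability[of _ Firm1] algebra_simps)
    then have "exposure (Y u) \<le> (1 - g) * (u - t)" using safe by simp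
    then show "lam (exposure (Y u)) \<le> lamhat ((1 - g) * (u - t))"
      by (meson lam_le_lamhat lamhat_mono order_trans)
  next
    show "(\<lambda>u. lamhat ((1 - g) * (u - t))) integrable_on {t..t + s}"
      by (intro integrable_continuous_real continuous_on_compose2[OF lamhat_continuous[of UNIV]] continuous_intros) auto
  qed
  also have "integral {t..t + s} (\<lambda>u. lamhat ((1 - g) * (u - t))) = \<Lambda> s"
  proof -
    have "integral {0..s} ((\<lambda>u. lamhat ((1 - g) * (u - t))) \<circ> (\<lambda>x. x + t)) = integral {0 + t..s + t} (\<lambda>u. lamhat ((1 - g) * (u - t)))"
      by (rule integral_shift) (auto intro!: continuous_on_compose2[OF lamhat_continuous[of UNIV]] continuous_intros)
    then show ?thesis by (simp add: race_hazard_lamhat o_def add.commute)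
  qed
  finally show ?thesis .
qed

text \<open>Against a racing firm the rival does most harm by racing too, and exposure cannot exceed
  that of joint racing. A deviation is held for finite time only, so the payoff after n periods is
  dropped and n tends to infinity.\<close>

lemma race_guarantee:
  assumes \<sigma>: "spe \<alpha> \<beta> r g lam \<sigma>" and h: "feasible_history g (t, S)"
    and safe: "exposure (S t) \<le> 0"
  shows "ennreal (exp (\<alpha> * capability k (S t) - \<beta> * capability (other k) (S t)) * R0) \<le> game_value k \<sigma> (t, S)"
proof -
  have t: "t \<ge> 0" using h by (simp add: feasible_history_iff[OF g])
  define E where "E = exp (\<alpha> * capability k (S t) - \<beta> * capability (other k) (S t))"
  have "ennreal (E * race_integral (real n)) \<le> game_value k \<sigma> (t, S)" for n
  proof -
    obtain Y where Y: "bounded_speed g {0..} Y" and YS: "\<And>s. s \<in> {0..t} \<Longrightarrow> Y s = S s"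
      and cap: "\<And>s. s \<in> {t..t + real n} \<Longrightarrow> capability k (Y s) = capability k (S t) + 1 * (s - t)"
      and val: "ennreal (integral {t..t + real n} (flow k t Y)) + ennreal (exp (- r * real n - cum_hazard lam Y t (t + real n))) *
       game_value k \<sigma> (t + real n, Y) \<le> game_value k \<sigma> (t, S)"
      using spe_hold_value_step[OF \<sigma> h, of 1 "real n" k] by (smt (verit) atLeastAtMost_iff of_nat_0_le_iff zero_le_one)
    have "integral {0..real n} (\<lambda>s. E * race_weight s) \<le> integral {t..t + real n} (flow k t Y)"
    proof (rule flow_integral_ge[OF Y t])
      show "continuous_on {0..real n} (\<lambda>s. E * race_weight s)"
        by (intro continuous_intros continuous_on_subset[OF race_weight_continuous]) auto
      fix s assume s: "s \<in> {0..real n}"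
      have "cum_hazard lam Y t (t + s) \<le> \<Lambda> s"
        using s safe YS[of t] t by (intro race_cum_hazard_le[OF Y t]) auto
      moreover have "capability k (Y (t + s)) = capability k (S t) + s" using cap[of "t + s"] s by simp
      moreover have "capability (other k) (Y (t + s)) \<le> capability (other k) (S t) + s"
        using capability_increment[OF Y, of t "t + s" "other k"] YS[of t] s t by auto
      then have "\<beta> * capability (other k) (Y (t + s)) \<le> \<beta> * (capability (other k) (S t) + s)"
        using \<beta>_pos by simp
      ultimately show "E * race_weight s \<le> flow k t Y (t + s)"
        by (simp add: E_def race_weight_def flow_def exp_add[symmetric] \<rho>_def algebra_simps)
    qed
    then have "ennreal (E * race_integral (real n)) \<le> ennreal (integral {t..t + real n} (flow k t Y))"
      by (intro ennreal_leI) (simp add: race_integral_def)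
    also have "\<dots> \<le> game_value k \<sigma> (t, S)" using val by (meson add_increasing2 order_trans order_refl zero_le le_add_same_cancel1)
    finally show ?thesis .
  qed
  moreover have "(\<lambda>n. ennreal (E * race_integral (real n))) \<longlonglongrightarrow> ennreal (E * R0)"
    by (intro tendsto_ennrealI tendsto_intros race_integral_tendsto)
  ultimately have "ennreal (E * R0) \<le> game_value k \<sigma> (t, S)"
    by (intro LIMSEQ_le_const2) auto
  then show ?thesis by (simp add: E_def)
qed

end

section \<open>Lipschitz functions on compact intervals\<close>

text \<open>The constant may depend on T. The class contains the ingredients of the Lyapunov
  function, is closed under products, integrals and composition with continuously differentiable
  functions, and gives both absolute continuity and differentiability almost everywhere.\<close>

definition lipschitzian :: "real \<Rightarrow> (real \<Rightarrow> real) \<Rightarrow> bool" where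
  "lipschitzian T f \<longleftrightarrow> (\<exists>L. L-lipschitz_on {0..T} f)"

lemma lipschitzianI: "L-lipschitz_on {0..T} f \<Longrightarrow> lipschitzian T f"
  by (auto simp: lipschitzian_def)

lemma lipschitzian_continuous: "lipschitzian T f \<Longrightarrow> continuous_on {0..T} f"
  by (auto simp: lipschitzian_def intro: lipschitz_on_continuous_on)

lemma lipschitzian_bounded:
  assumes "lipschitzian T f"
  obtains B where "B > 0" "\<And>x. x \<in> {0..T} \<Longrightarrow> \<bar>f x\<bar> \<le> B"
proof -
  have "bounded (f ` {0..T})"
    using lipschitzian_continuous[OF assms] by (intro compact_imp_bounded compact_continuous_image) auto
  then show ?thesis using that unfolding bounded_pos by auto
qed

lemma lipschitzian_add: "lipschitzian T f \<Longrightarrow> lipschitzian T h \<Longrightarrow> lipschitzian T (\<lambda>x. f x + h x)"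
  unfolding lipschitzian_def by (auto intro: lipschitz_on_add)

lemma lipschitzian_mult:
  assumes "lipschitzian T f" "lipschitzian T h"
  shows "lipschitzian T (\<lambda>x. f x * h x)"
proof -
  obtain Lf Lh where L: "Lf-lipschitz_on {0..T} f" "Lh-lipschitz_on {0..T} h"
    using assms by (auto simp: lipschitzian_def)
  obtain Bf where Bf: "Bf > 0" "\<And>x. x \<in> {0..T} \<Longrightarrow> \<bar>f x\<bar> \<le> Bf" using lipschitzian_bounded[OF assms(1)] by blast
  obtain Bh where Bh: "Bh > 0" "\<And>x. x \<in> {0..T} \<Longrightarrow> \<bar>h x\<bar> \<le> Bh" using lipschitzian_bounded[OF assms(2)] by blast
  have "(Bf * Lh + Bh * Lf)-lipschitz_on {0..T} (\<lambda>x. f x * h x)"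
  proof (rule lipschitz_onI)
    fix x y assume xy: "x \<in> {0..T}" "y \<in> {0..T}"
    have "f x * h x - f y * h y = f x * (h x - h y) + h y * (f x - f y)" by (simp add: algebra_simps)
    then have "\<bar>f x * h x - f y * h y\<bar> \<le> \<bar>f x\<bar> * \<bar>h x - h y\<bar> + \<bar>h y\<bar> * \<bar>f x - f y\<bar>"
      by (metis abs_mult abs_triangle_ineq)
    also have "\<dots> \<le> Bf * (Lh * dist x y) + Bh * (Lf * dist x y)"
      using Bf Bh xy lipschitz_onD[OF L(1) xy] lipschitz_onD[OF L(2) xy]
      by (intro add_mono mult_mono) (auto simp: dist_real_def less_imp_le)
    finally show "dist (f x * h x) (f y * h y) \<le> (Bf * Lh + Bh * Lf) * dist x y"
      by (simp add: dist_real_def algebra_simps)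
  qed (use Bf Bh lipschitz_on_nonneg[OF L(1)] lipschitz_on_nonneg[OF L(2)] in auto)
  then show ?thesis by (rule lipschitzianI)
qed

text \<open>The set I admits functions that are differentiable only on a half-line. The values of u
  lie in a compact part of I, where the continuous derivative is bounded.\<close>

lemma lipschitzian_compose:
  assumes u: "lipschitzian T u" and dom: "\<And>x. x \<in> {0..T} \<Longrightarrow> u x \<in> I"
    and f: "\<And>x. x \<in> I \<Longrightarrow> (f has_real_derivative f' x) (at x within I)" and f': "continuous_on I f'"
    and I: "closed I" "convex I"
  shows "lipschitzian T (\<lambda>x. f (u x))"
proof -
  obtain B where B: "B > 0" "\<And>x. x \<in> {0..T} \<Longrightarrow> \<bar>u x\<bar> \<le> B" using lipschitzian_bounded[OF u] by blast
  obtain L where L: "L-lipschitz_on {0..T} u" using u by (auto simp: lipschitzian_def)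
  let ?J = "I \<inter> {-B..B}"
  have "compact (f' ` ?J)"
    using f' I by (intro compact_continuous_image continuous_on_subset[OF f'] closed_Int_compact) auto
  then obtain C where C: "C > 0" "\<And>x. x \<in> ?J \<Longrightarrow> \<bar>f' x\<bar> \<le> C"
    using compact_imp_bounded[of "f' ` ?J"] unfolding bounded_pos by auto
  have lip: "dist (f x) (f y) \<le> C * dist x y" if "x \<in> ?J" "y \<in> ?J" for x y
  proof -
    have "norm (f x - f y) \<le> C * norm (x - y)"
    proof (rule field_differentiable_bound[of ?J f f'])
      show "convex ?J" using I by (intro convex_Int) auto
      show "(f has_real_derivative f' z) (at z within ?J)" if "z \<in> ?J" for z
        using f[of z] that by (auto intro: DERIV_subset)
    qed (use C that in auto)
    then show ?thesis by (simp add: dist_norm)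
  qed
  have "(C * L)-lipschitz_on {0..T} (\<lambda>x. f (u x))"
  proof (rule lipschitz_onI)
    fix x y assume xy: "x \<in> {0..T}" "y \<in> {0..T}"
    then have "u x \<in> ?J" "u y \<in> ?J" using B(2) dom by (auto simp: abs_le_iff minus_le_iff)
    then have "dist (f (u x)) (f (u y)) \<le> C * dist (u x) (u y)" by (rule lip)
    also have "\<dots> \<le> C * (L * dist x y)" using lipschitz_onD[OF L xy] C by (intro mult_left_mono) auto
    finally show "dist (f (u x)) (f (u y)) \<le> C * L * dist x y" by simp
  qed (use C lipschitz_on_nonneg[OF L] in auto)
  then show ?thesis by (rule lipschitzianI)
qed

lemma lipschitzian_exp: "lipschitzian T u \<Longrightarrow> lipschitzian T (\<lambda>x. exp (u x))"
  by (rule lipschitzian_compose[of T u UNIV exp exp]) (auto intro: DERIV_subset[OF DERIV_exp] continuous_intros)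

lemma lipschitzian_const: "lipschitzian T (\<lambda>x. c)"
  by (rule lipschitzianI[OF lipschitz_on_constant])

lemma lipschitzian_cmult: "lipschitzian T f \<Longrightarrow> lipschitzian T (\<lambda>x. c * f x)"
  by (rule lipschitzian_mult[OF lipschitzian_const])

lemma lipschitzian_ident: "lipschitzian T (\<lambda>x. x)"
  by (rule lipschitzianI[OF lipschitz_on_id])

lemma lipschitzian_integral:
  assumes int: "f integrable_on {0..T}" and B: "\<And>x. x \<in> {0..T} \<Longrightarrow> \<bar>f x\<bar> \<le> B"
  shows "lipschitzian T (\<lambda>x. integral {0..x} f)"
proof -
  have le: "dist (integral {0..x} f) (integral {0..y} f) \<le> \<bar>B\<bar> * dist x y" if xy: "0 \<le> x" "x \<le> y" "y \<le> T" for x y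
  proof -
    have f: "f integrable_on {0..y}" "f integrable_on {x..y}" using int xy
      by (auto intro: integrable_on_subinterval)
    have "integral {0..x} f + integral {x..y} f = integral {0..y} f"
      using f xy by (intro Henstock_Kurzweil_Integration.integral_combine) auto
    then have "integral {0..y} f - integral {0..x} f = integral {x..y} f" by simp
    moreover have "norm (f u) \<le> \<bar>B\<bar>" if "u \<in> {x..y}" for u
      using B[of u] that xy by auto
    then have "norm (integral {x..y} f) \<le> \<bar>B\<bar> * measure lborel {x..y}"
      by (intro has_integral_bound_real[OF _ _ integrable_integral[OF f(2)], where S = "{}"]) auto
    ultimately show ?thesis using xy by (simp add: dist_real_def abs_minus_commute)
  qed
  have "\<bar>B\<bar>-lipschitz_on {0..T} (\<lambda>x. integral {0..x} f)"
  proof (rule lipschitz_onI)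
    show "dist (integral {0..x} f) (integral {0..y} f) \<le> \<bar>B\<bar> * dist x y" if "x \<in> {0..T}" "y \<in> {0..T}" for x y
      using le[of x y] le[of y x] that by (cases "x \<le> y") (auto simp: dist_commute)
  qed simp
  then show ?thesis by (rule lipschitzianI)
qed

lemma AE_lborel_witness_between:
  fixes a b :: real
  assumes "AE x in lborel. P x" "a < b"
  obtains x where "a < x" "x < b" "P x"
proof (rule ccontr)
  assume "\<not> thesis"
  then have no: "\<And>x. x \<in> {a<..<b} \<Longrightarrow> \<not> P x" using that by auto
  from assms(1) obtain N where N: "\<And>x. x \<notin> N \<Longrightarrow> P x" "N \<in> null_sets lborel"
    by (rule AE_E3) auto
  have "{a<..<b} \<subseteq> N" using no N(1) by blast
  then have "emeasure lborel {a<..<b} \<le> emeasure lborel N" using N(2) by (intro emeasure_mono) auto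
  also have "\<dots> = 0" using N(2) by auto
  finally show False using \<open>a < b\<close> by simp
qed

text \<open>The vanishing derivative at 0 removes the kink of the absolute value, so the gap term of
  the Lyapunov function is differentiable also where the lead changes.\<close>

lemma has_real_derivative_abs_argument:
  fixes f f' :: "real \<Rightarrow> real"
  assumes f: "\<And>x. (f has_real_derivative f' x) (at x)" and "f' 0 = 0"
  shows "((\<lambda>z. f \<bar>z\<bar>) has_real_derivative sgn z * f' \<bar>z\<bar>) (at z)"
proof -
  consider "z > 0" | "z < 0" | "z = 0" by linarith
  then show ?thesis
  proof cases
    case 1
    have "((\<lambda>z. f \<bar>z\<bar>) has_real_derivative f' z) (at z)"
      by (rule has_field_derivative_transform_within_open[OF f, of "{0<..}"]) (use 1 in auto)
    then show ?thesis using 1 by simp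
  next
    case 2
    have "((\<lambda>z. f (- z)) has_real_derivative f' (- z) * - 1) (at z)"
      by (rule DERIV_chain'[OF _ f]) (auto intro!: derivative_eq_intros)
    then have "((\<lambda>z. f \<bar>z\<bar>) has_real_derivative f' (- z) * - 1) (at z)"
      by (rule has_field_derivative_transform_within_open[of _ _ _ "{..<0}"]) (use 2 in auto)
    then show ?thesis using 2 by simp
  next
    case 3
    have "(*) (0 :: real) = (\<lambda>h. 0)" by auto
    then have "(f has_derivative (\<lambda>h. 0)) (at 0)"
      using f[of 0] assms(2) by (simp add: has_field_derivative_def)
    then have alt: "\<forall>e>0. \<exists>d>0. \<forall>y. norm (y - 0) < d \<longrightarrow> norm (f y - f 0 - 0) \<le> e * norm (y - 0)"
      unfolding has_derivative_at_alt by blast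
    have "((\<lambda>z. f \<bar>z\<bar>) has_derivative (\<lambda>h. 0)) (at 0)"
      unfolding has_derivative_at_alt
    proof (intro conjI allI impI)
      fix e :: real assume "e > 0"
      then obtain d where "d > 0" and d: "\<forall>y. norm (y - 0) < d \<longrightarrow> norm (f y - f 0 - 0) \<le> e * norm (y - 0)"
        using alt by blast
      have "norm (f \<bar>y\<bar> - f \<bar>0\<bar> - 0) \<le> e * norm (y - 0)" if "norm (y - 0) < d" for y
        using d[rule_format, of "\<bar>y\<bar>"] that by simp
      then show "\<exists>d>0. \<forall>y. norm (y - 0) < d \<longrightarrow> norm (f \<bar>y\<bar> - f \<bar>0\<bar> - 0) \<le> e * norm (y - 0)"
        using \<open>d > 0\<close> by blast
    qed simp
    then have "((\<lambda>z. f \<bar>z\<bar>) has_real_derivative 0) (at 0)"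
      by (simp add: has_field_derivative_def lambda_zero)
    then show ?thesis using 3 by simp
  qed
qed

context development_game
begin

section \<open>The gap function and the value of racing on\<close>

text \<open>Average of the leader's and the laggard's flow at gap z, relative to the flow of a tie
  at the leader's capability.\<close>

definition gap_average :: "real \<Rightarrow> real" where
  "gap_average z = (exp (\<beta> * z) + exp (- \<alpha> * z)) / 2"

definition gap_slack :: "real \<Rightarrow> real" where
  "gap_slack \<kappa> = 1 - (\<kappa> / (\<kappa> - \<beta>) + \<kappa> / (\<kappa> + \<alpha>)) / 2"

text \<open>The operator \<open>k - k' / \<kappa>\<close> multiplies the two exponentials of
  \<open>gap_average\<close> by \<open>1 - \<beta> / \<kappa>\<close> and
  \<open>1 + \<alpha> / \<kappa>\<close>, whose inverses are the coefficients here;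
  \<open>exp (\<kappa> * z)\<close> solves the homogeneous equation, and \<open>gap_slack\<close> is
  its coefficient fixed by the value 1 at z = 0.\<close>

definition gap_bound :: "real \<Rightarrow> real \<Rightarrow> real" where
  "gap_bound \<kappa> z = (\<kappa> / (\<kappa> - \<beta>) * exp (\<beta> * z) + \<kappa> / (\<kappa> + \<alpha>) * exp (- \<alpha> * z)) / 2 + gap_slack \<kappa> * exp (\<kappa> * z)"

definition gap_bound' :: "real \<Rightarrow> real \<Rightarrow> real" where
  "gap_bound' \<kappa> z = (\<kappa> / (\<kappa> - \<beta>) * \<beta> * exp (\<beta> * z) - \<kappa> / (\<kappa> + \<alpha>) * \<alpha> * exp (- \<alpha> * z)) / 2 + gap_slack \<kappa> * \<kappa> * exp (\<kappa> * z)"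

lemma gap_bound_has_derivative: "(gap_bound \<kappa> has_real_derivative gap_bound' \<kappa> z) (at z)"
proof -
  have "((\<lambda>z. (a * exp (\<beta> * z) + b * exp (- \<alpha> * z)) / 2 + c * exp (\<kappa> * z)) has_real_derivative
      (a * \<beta> * exp (\<beta> * z) - b * \<alpha> * exp (- \<alpha> * z)) / 2 + c * \<kappa> * exp (\<kappa> * z)) (at z)" for a b c
    by (auto intro!: derivative_eq_intros simp: field_simps)
  then show ?thesis unfolding gap_bound_def gap_bound'_def .
qed

lemma gap_bound'_continuous: "continuous_on A (gap_bound' \<kappa>)"
proof -
  have "continuous_on A (\<lambda>z. (a * \<beta> * exp (\<beta> * z) - b * \<alpha> * exp (- \<alpha> * z)) / 2 + c * \<kappa> * exp (\<kappa> * z))" for a b c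
    by (intro continuous_intros) auto
  then show ?thesis unfolding gap_bound'_def .
qed

context
  fixes \<kappa> assumes \<kappa>: "2 * \<alpha> * \<beta> < (\<alpha> - \<beta>) * \<kappa>"
begin

lemma \<kappa>_gt: "\<kappa> > \<beta>"
proof -
  have "(\<alpha> - \<beta>) * \<beta> < (\<alpha> - \<beta>) * \<kappa>"
  proof -
    have "(\<alpha> - \<beta>) * \<beta> \<le> \<alpha> * \<beta>" using \<beta>_pos by (simp add: algebra_simps)
    also have "\<dots> < 2 * \<alpha> * \<beta>" using \<beta>_pos \<alpha>_gt_\<beta> by simp
    finally show ?thesis using \<kappa> by linarith
  qed
  then show ?thesis using \<alpha>_gt_\<beta> by simp
qed

text \<open>Cleared of denominators this reads
  \<open>2 * \<alpha> * \<beta> \<le> (\<alpha> - \<beta>) * \<kappa>\<close>, which is where the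
  lower limit on \<open>\<kappa>\<close> comes from.\<close>

lemma gap_slack_nonneg: "gap_slack \<kappa> \<ge> 0"
proof -
  have p: "\<kappa> - \<beta> > 0" "\<kappa> + \<alpha> > 0" using \<kappa>_gt \<beta>_pos \<alpha>_gt_\<beta> by auto
  have "\<kappa> / (\<kappa> - \<beta>) + \<kappa> / (\<kappa> + \<alpha>) = (\<kappa> * (\<kappa> + \<alpha>) + \<kappa> * (\<kappa> - \<beta>)) / ((\<kappa> - \<beta>) * (\<kappa> + \<alpha>))"
    using p by (simp add: add_frac_eq)
  also have "\<dots> \<le> 2"
    using mult_pos_pos[OF p] \<kappa> by (subst pos_divide_le_eq) (simp_all add: algebra_simps)
  finally show ?thesis by (simp add: gap_slack_def)
qed

lemma gap_bound_identity: "gap_bound \<kappa> z - gap_bound' \<kappa> z / \<kappa> = gap_average z"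
proof -
  have p: "\<kappa> - \<beta> \<noteq> 0" "\<kappa> + \<alpha> \<noteq> 0" "\<kappa> \<noteq> 0" using \<kappa>_gt \<beta>_pos \<alpha>_gt_\<beta> by auto
  have 1: "\<kappa> / (\<kappa> - \<beta>) - \<kappa> / (\<kappa> - \<beta>) * \<beta> / \<kappa> = 1" "\<kappa> / (\<kappa> + \<alpha>) + \<kappa> / (\<kappa> + \<alpha>) * \<alpha> / \<kappa> = 1"
    using p by (simp_all add: diff_divide_distrib[symmetric] add_divide_distrib[symmetric])
  have "gap_bound \<kappa> z - gap_bound' \<kappa> z / \<kappa> = ((\<kappa> / (\<kappa> - \<beta>) - \<kappa> / (\<kappa> - \<beta>) * \<beta> / \<kappa>) * exp (\<beta> * z)
     + (\<kappa> / (\<kappa> + \<alpha>) + \<kappa> / (\<kappa> + \<alpha>) * \<alpha> / \<kappa>) * exp (- \<alpha> * z)) / 2"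
  proof -
    have "((a * x + b * y) / 2 + c * w) - ((a * \<beta> * x - b * \<alpha> * y) / 2 + c * \<kappa> * w) / \<kappa> =
        ((a - a * \<beta> / \<kappa>) * x + (b + b * \<alpha> / \<kappa>) * y) / 2" for a b c x y w
      using p(3) by (simp add: field_simps)
    then show ?thesis unfolding gap_bound_def gap_bound'_def .
  qed
  then show ?thesis unfolding 1 by (simp add: gap_average_def)
qed

lemma gap_bound_0: "gap_bound \<kappa> 0 = 1"
  by (simp add: gap_bound_def gap_slack_def)

text \<open>Read off the differential equation, since both the solution and the average equal 1 at
  0.\<close>

lemma gap_bound'_0: "gap_bound' \<kappa> 0 = 0"
proof -
  have "gap_bound' \<kappa> 0 / \<kappa> = 0"
    using gap_bound_identity[of 0] by (simp add: gap_bound_0 gap_average_def)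
  then show ?thesis using \<kappa>_gt \<beta>_pos by simp
qed

text \<open>The derivative starts at 0 and each of its three terms is nondecreasing in the gap, the
  first one strictly; the third needs the slack to be nonnegative.\<close>

lemma gap_bound'_pos:
  assumes "z > 0"
  shows "gap_bound' \<kappa> z > 0"
proof -
  have p: "\<kappa> - \<beta> > 0" "\<kappa> + \<alpha> > 0" "\<kappa> > 0" "\<alpha> > 0" using \<kappa>_gt \<beta>_pos \<alpha>_gt_\<beta> by auto
  have 1: "\<kappa> / (\<kappa> - \<beta>) * \<beta> * exp (\<beta> * z) > \<kappa> / (\<kappa> - \<beta>) * \<beta> * exp (\<beta> * 0)"
    using p assms \<beta>_pos by (intro mult_strict_left_mono) auto
  have 2: "\<kappa> / (\<kappa> + \<alpha>) * \<alpha> * exp (- \<alpha> * z) \<le> \<kappa> / (\<kappa> + \<alpha>) * \<alpha> * exp (- \<alpha> * 0)"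
    using p assms by (intro mult_left_mono) auto
  have 3: "gap_slack \<kappa> * \<kappa> * exp (\<kappa> * z) \<ge> gap_slack \<kappa> * \<kappa> * exp (\<kappa> * 0)"
    using p assms gap_slack_nonneg by (intro mult_left_mono) auto
  have "gap_bound' \<kappa> z > gap_bound' \<kappa> 0"
    unfolding gap_bound'_def using 1 2 3 by argo
  then show ?thesis using gap_bound'_0 by simp
qed

lemma gap_bound'_nonneg: "z \<ge> 0 \<Longrightarrow> gap_bound' \<kappa> z \<ge> 0"
  using gap_bound'_pos[of z] gap_bound'_0 by (cases "z = 0") auto

lemma gap_bound_pos: "z \<ge> 0 \<Longrightarrow> gap_bound \<kappa> z > 0"
proof -
  assume "z \<ge> 0"
  then have "gap_bound' \<kappa> z / \<kappa> \<ge> 0" using gap_bound'_nonneg \<kappa>_gt \<beta>_pos by simp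
  moreover have "gap_average z > 0" by (simp add: gap_average_def add_pos_pos)
  ultimately show ?thesis using gap_bound_identity[of z] by linarith
qed

end

text \<open>The value of racing on in current units, indexed by the time \<open>\<tau>\<close> that
  a race from a threshold tie takes to reach the margin \<open>(1 - g) * \<tau>\<close>.\<close>

definition race_continuation :: "real \<Rightarrow> real" where
  "race_continuation \<tau> = race_tail \<tau> / race_weight \<tau>"

lemma race_continuation_0: "race_continuation 0 = R0"
  by (simp add: race_continuation_def race_tail_def race_integral_def race_weight_def)

text \<open>The Bellman equation of joint racing: the value grows at discount plus hazard, less the
  flow 1.\<close>

lemma race_continuation_has_derivative:
  assumes "0 \<le> \<tau>"
  shows "(race_continuation has_real_derivative race_continuation \<tau> * (\<rho> + lamhat ((1 - g) * \<tau>)) - 1) (at \<tau> within {0..})"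
  unfolding race_continuation_def race_tail_def
  using race_weight_pos[of \<tau>]
  by (auto intro!: derivative_eq_intros race_weight_has_derivative[OF assms] race_integral_has_derivative[OF assms]
      simp: field_simps)

lemma race_continuation_pos: "0 \<le> \<tau> \<Longrightarrow> race_continuation \<tau> > 0"
  using race_tail_pos race_weight_pos by (simp add: race_continuation_def)

lemma race_continuation_le: "0 \<le> \<tau> \<Longrightarrow> race_continuation \<tau> \<le> R0"
  using race_tail_le[of \<tau>] race_weight_pos[of \<tau>] by (simp add: race_continuation_def field_simps)

lemma race_continuation_ge: "0 \<le> \<tau> \<Longrightarrow> 1 \<le> (1 / R0 + \<phi> ((1 - g) * \<tau>)) * race_continuation \<tau>"
  using race_tail_ge[of \<tau>] race_weight_pos[of \<tau>] race_value_pos by (simp add: race_continuation_def field_simps)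

lemma race_continuation_continuous: "continuous_on {0..} race_continuation"
  using race_continuation_has_derivative by (intro DERIV_continuous_on) auto

end

section \<open>Joint racing\<close>

lemma AE_halfline_from_intervals:
  assumes "\<And>T::nat. AE s in lborel. (0::real) < s \<and> s < real T \<longrightarrow> P s"
  shows "AE s in lborel. 0 < s \<longrightarrow> P s"
proof -
  have "AE s in lborel. \<forall>T::nat. (0::real) < s \<and> s < real T \<longrightarrow> P s"
    unfolding AE_all_countable using assms by (rule allI)
  then show ?thesis
  proof (rule eventually_mono, intro impI)
    fix s :: real assume *: "\<forall>T::nat. 0 < s \<and> s < real T \<longrightarrow> P s" and "0 < s"
    obtain T :: nat where "s < real T" using reals_Archimedean2 by blast
    then show "P s" using * \<open>0 < s\<close> by blast
  qed
qed

lemma lipschitzian_AE_differentiable: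
  assumes "\<And>T::nat. lipschitzian (real T) f"
  shows "AE s in lborel. 0 < s \<longrightarrow> (\<exists>v. (f has_real_derivative v) (at s))"
proof (rule AE_halfline_from_intervals)
  fix T :: nat
  obtain L where "L-lipschitz_on {0..real T} f" using assms[of T] by (auto simp: lipschitzian_def)
  then show "AE s in lborel. 0 < s \<and> s < real T \<longrightarrow> (\<exists>v. (f has_real_derivative v) (at s))"
    by (rule lipschitz_AE_differentiable)
qed

lemma lipschitzian_AE_deriv_nonpos_antimono:
  assumes lip: "\<And>T. lipschitzian T f" and der: "AE s in lborel. 0 < s \<longrightarrow> (\<exists>v\<le>0. (f has_real_derivative v) (at s))"
    and st: "0 \<le> s" "s \<le> t"
  shows "f t \<le> f s"
proof (rule abs_continuous_on_deriv_nonpos[OF _ st(2)])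
  obtain L where "L-lipschitz_on {0..t} f" using lip[of t] by (auto simp: lipschitzian_def)
  then have "L-lipschitz_on {s..t} f" by (rule lipschitz_on_subset) (use st in auto)
  then show "abs_continuous_on {s..t} f" by (rule lipschitz_imp_abs_continuous_on)
  show "AE u in lborel. s < u \<and> u < t \<longrightarrow> (\<exists>v\<le>0. (f has_real_derivative v) (at u))"
    using der by (rule eventually_mono) (use st in auto)
qed

context development_game
begin

text \<open>Including the threshold keeps the margin nonnegative, and equal to 0 throughout the safe
  region.\<close>

definition frontier :: "path \<Rightarrow> real \<Rightarrow> real" where
  "frontier Y s = max (max (fst (Y s)) (fst (snd (Y s)))) (snd (snd (Y s)))"

definition margin :: "path \<Rightarrow> real \<Rightarrow> real" where
  "margin Y s = frontier Y s - snd (snd (Y s))"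

definition gap :: "path \<Rightarrow> real \<Rightarrow> real" where
  "gap Y s = fst (Y s) - fst (snd (Y s))"

definition weight :: "path \<Rightarrow> real \<Rightarrow> real" where
  "weight Y s = exp (- r * s - cum_hazard lam Y 0 s + (\<alpha> - \<beta>) * frontier Y s)"

definition average_flow :: "path \<Rightarrow> real \<Rightarrow> real" where
  "average_flow Y s = weight Y s * gap_average \<bar>gap Y s\<bar>"

definition potential :: "real \<Rightarrow> path \<Rightarrow> real \<Rightarrow> real" where
  "potential \<kappa> Y s = weight Y s * race_continuation (margin Y s / (1 - g)) * gap_bound \<kappa> \<bar>gap Y s\<bar>"

definition lyapunov :: "real \<Rightarrow> path \<Rightarrow> real \<Rightarrow> real" where
  "lyapunov \<kappa> Y s = potential \<kappa> Y s + integral {0..s} (average_flow Y)"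

lemma margin_nonneg: "margin Y s \<ge> 0"
  by (simp add: margin_def frontier_def)

lemma weight_pos: "weight Y s > 0"
  by (simp add: weight_def)

lemma gap_average_pos: "gap_average z > 0"
  by (simp add: gap_average_def add_pos_pos)

lemma average_flow_pos: "average_flow Y s > 0"
  by (simp add: average_flow_def weight_pos gap_average_pos)

text \<open>The two branches are the derivative of the potential per unit of weight above and on the
  safety threshold, with \<open>a\<close> the growth rate of the frontier, \<open>h\<close> the hazard, \<open>zk\<close> the change of
  \<open>K = gap_bound\<close> along the path and \<open>k = gap_bound'\<close>; on the threshold \<open>a = g\<close>.\<close>

lemma verification_inequality:
  fixes a h V K k zk \<kappa> :: real
  assumes V: "0 < V" "V * \<kappa> < 1" and \<kappa>: "\<kappa> > 0" and K: "K > 0" and k: "0 \<le> k" "zk \<le> k" and a: "a \<le> 1"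
    and loss: "0 < (\<alpha> - \<beta>) * V + (V * (\<rho> + h) - 1) / (1 - g)"
  defines "B \<equiv> (- r - h + (\<alpha> - \<beta>) * a) * V * K + (V * (\<rho> + h) - 1) * ((a - g) / (1 - g)) * K + V * zk + (K - k / \<kappa>)"
  shows "B \<le> 0" "B = 0 \<Longrightarrow> a = 1 \<and> k = 0"
proof -
  have g0: "1 - g \<noteq> 0" using g by simp
  \<comment> \<open>Everything is measured against full speed: at a = 1 the terms with factor K
    cancel by the Bellman equation of racing, so what remains is the loss from the shortfall 1 - a
    and the gap term.\<close>
  have "(a - g) / (1 - g) = 1 - (1 - a) / (1 - g)"
    using g0 by (simp add: field_simps)
  then have "B = (- r - h + (\<alpha> - \<beta>) * a) * V * K + (V * (\<rho> + h) - 1) * (1 - (1 - a) / (1 - g)) * K + V * zk + (K - k / \<kappa>)"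
    by (simp add: B_def)
  also have "\<dots> = - (K * (1 - a) * ((\<alpha> - \<beta>) * V + (V * (\<rho> + h) - 1) / (1 - g))) + (V * zk - k / \<kappa>)"
    by (simp add: \<rho>_def divide_inverse algebra_simps)
  finally have B: "B = - (K * (1 - a) * ((\<alpha> - \<beta>) * V + (V * (\<rho> + h) - 1) / (1 - g))) + (V * zk - k / \<kappa>)" .
  have 1: "0 \<le> K * (1 - a) * ((\<alpha> - \<beta>) * V + (V * (\<rho> + h) - 1) / (1 - g))"
    using K a loss by (intro mult_nonneg_nonneg) auto
  have "V * zk - k / \<kappa> \<le> V * k - k / \<kappa>" using V k by simp
  also have "\<dots> = k * (V * \<kappa> - 1) / \<kappa>" using \<kappa> by (simp add: field_simps)
  finally have 2: "V * zk - k / \<kappa> \<le> k * (V * \<kappa> - 1) / \<kappa>" .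
  have 3: "k * (V * \<kappa> - 1) / \<kappa> \<le> 0"
    using k V \<kappa> by (simp add: divide_nonpos_pos mult_nonneg_nonpos)
  show "B \<le> 0" using B 1 2 3 by linarith
  show "a = 1 \<and> k = 0" if "B = 0"
  proof -
    have "K * (1 - a) * ((\<alpha> - \<beta>) * V + (V * (\<rho> + h) - 1) / (1 - g)) = 0" "k * (V * \<kappa> - 1) / \<kappa> = 0"
      using that B 1 2 3 by linarith+
    then show ?thesis using K loss V \<kappa> by auto
  qed
qed

text \<open>With frontier speed g the margin term is stationary, and \<open>patient\<close> alone
  makes the remaining terms negative. The strict sign excludes positive time on the threshold once
  the Lyapunov function is known to be constant.\<close>

lemma verification_inequality_threshold:
  fixes h V K k zk \<kappa> :: real
  assumes V: "0 < V" "V * \<kappa> < 1" and \<kappa>: "\<kappa> > 0" and K: "K > 0" and k: "0 \<le> k" "zk \<le> k" and h: "h \<ge> 0"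
    and patient: "1 < V * (r - g * (\<alpha> - \<beta>))"
  shows "(- r - h + (\<alpha> - \<beta>) * g) * V * K + V * zk + (K - k / \<kappa>) < 0"
proof -
  have "(- r - h + (\<alpha> - \<beta>) * g) * V * K + V * zk + (K - k / \<kappa>) =
     K * (1 - V * (r - g * (\<alpha> - \<beta>))) - h * V * K + (V * zk - k / \<kappa>)" by (simp add: algebra_simps)
  moreover have "K * (1 - V * (r - g * (\<alpha> - \<beta>))) < 0" using K patient by (simp add: mult_pos_neg)
  moreover have "h * V * K \<ge> 0" using h V K by simp
  moreover have "V * zk - k / \<kappa> \<le> 0"
  proof -
    have "V * zk - k / \<kappa> \<le> V * k - k / \<kappa>" using V k by simp
    also have "\<dots> = k * (V * \<kappa> - 1) / \<kappa>" using \<kappa> by (simp add: field_simps)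
    also have "\<dots> \<le> 0" using k V \<kappa> by (simp add: divide_nonpos_pos mult_nonneg_nonpos)
    finally show ?thesis .
  qed
  ultimately show ?thesis by linarith
qed

context
  fixes Y assumes Y: "bounded_speed g {0..} Y"
begin

lemma frontier_increment:
  assumes "0 \<le> s" "s \<le> s'"
  shows "frontier Y s' - frontier Y s \<in> {0..s' - s}"
proof -
  have "g * (s' - s) \<in> {0..s' - s}" using g assms by (auto simp: mult_left_le_one_le)
  moreover have "fst (Y s') - fst (Y s) \<in> {0..s' - s}" "fst (snd (Y s')) - fst (snd (Y s)) \<in> {0..s' - s}"
    "snd (snd (Y s')) - snd (snd (Y s)) = g * (s' - s)"
    using Y assms unfolding bounded_speed_def by auto
  ultimately show ?thesis unfolding frontier_def by auto
qed

lemma lipschitzian_components: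
  "lipschitzian T (frontier Y)" "lipschitzian T (margin Y)" "lipschitzian T (gap Y)"
proof -
  have sub: "bounded_speed g {0..T} Y" using Y by (rule bounded_speed_subset) auto
  note c = bounded_speed_component_lipschitz[OF g sub, THEN lipschitzianI]
  show f: "lipschitzian T (frontier Y)"
  proof (rule lipschitzianI[of 1], rule lipschitz_onI)
    show "dist (frontier Y s) (frontier Y s') \<le> 1 * dist s s'" if "s \<in> {0..T}" "s' \<in> {0..T}" for s s'
      using frontier_increment[of s s'] frontier_increment[of s' s] that
      by (cases "s \<le> s'") (auto simp: dist_real_def)
  qed simp
  show "lipschitzian T (margin Y)"
    using lipschitzian_add[OF f lipschitzian_cmult[OF c(3), of "-1"]] by (simp add: margin_def[abs_def])
  show "lipschitzian T (gap Y)"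
    using lipschitzian_add[OF c(1) lipschitzian_cmult[OF c(2), of "-1"]] by (simp add: gap_def[abs_def])
qed

lemma lipschitzian_cum_hazard: "lipschitzian T (cum_hazard lam Y 0)"
proof -
  obtain B where B: "\<And>s. s \<in> {0..T} \<Longrightarrow> \<bar>margin Y s\<bar> \<le> B"
    using lipschitzian_bounded[OF lipschitzian_components(2)] by blast
  have "lipschitzian T (\<lambda>s. integral {0..s} (\<lambda>u. lam (exposure (Y u))))"
  proof (rule lipschitzian_integral)
    show "(\<lambda>u. lam (exposure (Y u))) integrable_on {0..T}" by (rule hazard_integrable[OF Y]) simp
    show "\<bar>lam (exposure (Y s))\<bar> \<le> lam B" if "s \<in> {0..T}" for s
    proof -
      have "exposure (Y s) \<le> margin Y s" by (simp add: exposure_proj margin_def frontier_def)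
      also have "\<dots> \<le> B" using B[OF that] by simp
      finally show ?thesis using lam_mono lam_nonneg by simp
    qed
  qed
  then show ?thesis by (simp add: cum_hazard_def[abs_def])
qed

lemma lipschitzian_weight: "lipschitzian T (weight Y)"
proof -
  have "lipschitzian T (\<lambda>s. (- r * s + -1 * cum_hazard lam Y 0 s) + (\<alpha> - \<beta>) * frontier Y s)"
    by (intro lipschitzian_add lipschitzian_cmult lipschitzian_ident lipschitzian_cum_hazard lipschitzian_components)
  then show ?thesis unfolding weight_def[abs_def] by (intro lipschitzian_exp) simp
qed

lemma continuous_on_halfline_lipschitzian:
  assumes "\<And>T. lipschitzian T f"
  shows "continuous_on {0..} f"
  using lipschitzian_continuous[OF assms] by (rule continuous_on_halfline)

lemma average_flow_continuous: "continuous_on {0..} (average_flow Y)"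
  unfolding average_flow_def gap_average_def
  by (intro continuous_intros continuous_on_halfline_lipschitzian lipschitzian_weight lipschitzian_components) auto

lemma lipschitzian_lyapunov: "lipschitzian T (lyapunov \<kappa> Y)"
proof -
  have 1: "lipschitzian T (\<lambda>s. race_continuation (margin Y s / (1 - g)))"
  proof (rule lipschitzian_compose[where I = "{0..}" and f = race_continuation and
        f' = "\<lambda>\<tau>. race_continuation \<tau> * (\<rho> + lamhat ((1 - g) * \<tau>)) - 1"])
    show "lipschitzian T (\<lambda>s. margin Y s / (1 - g))"
      using lipschitzian_cmult[OF lipschitzian_components(2), of T "1 / (1 - g)"] by simp
    show "continuous_on {0..} (\<lambda>\<tau>. race_continuation \<tau> * (\<rho> + lamhat ((1 - g) * \<tau>)) - 1)"
      by (intro continuous_intros race_continuation_continuous continuous_on_compose2[OF lamhat_continuous[of UNIV]]) auto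
  qed (use race_continuation_has_derivative margin_nonneg g in auto)
  have abs: "lipschitzian T (\<lambda>s. \<bar>gap Y s\<bar>)"
  proof -
    obtain L where L: "L-lipschitz_on {0..T} (gap Y)" using lipschitzian_components(3) by (auto simp: lipschitzian_def)
    have "L-lipschitz_on {0..T} (\<lambda>s. \<bar>gap Y s\<bar>)"
    proof (rule lipschitz_onI)
      fix x y assume "x \<in> {0..T}" "y \<in> {0..T}"
      then have "dist (gap Y x) (gap Y y) \<le> L * dist x y" by (rule lipschitz_onD[OF L])
      then show "dist \<bar>gap Y x\<bar> \<bar>gap Y y\<bar> \<le> L * dist x y" by (simp add: dist_real_def)
    qed (rule lipschitz_on_nonneg[OF L])
    then show ?thesis by (rule lipschitzianI)
  qed
  have 2: "lipschitzian T (\<lambda>s. gap_bound \<kappa> \<bar>gap Y s\<bar>)"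
    by (rule lipschitzian_compose[OF abs, where I = UNIV and f' = "gap_bound' \<kappa>"])
      (auto intro: gap_bound_has_derivative gap_bound'_continuous)
  have 3: "lipschitzian T (\<lambda>s. integral {0..s} (average_flow Y))"
  proof -
    have c: "continuous_on {0..T} (average_flow Y)" using average_flow_continuous by (rule continuous_on_subset) auto
    then have "bounded (average_flow Y ` {0..T})" by (intro compact_imp_bounded compact_continuous_image) auto
    then obtain B where "\<forall>s\<in>{0..T}. \<bar>average_flow Y s\<bar> \<le> B" unfolding bounded_iff by auto
    then have "\<And>s. s \<in> {0..T} \<Longrightarrow> \<bar>average_flow Y s\<bar> \<le> B" by blast
    then show ?thesis using c by (intro lipschitzian_integral integrable_continuous_real)
  qed
  show ?thesis
    unfolding lyapunov_def[abs_def] potential_def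
    by (intro lipschitzian_add lipschitzian_mult lipschitzian_weight 1 2 3)
qed

text \<open>Off the threshold the hazard is continuous along the path, so its rate is identified
  there; on the threshold the sign of the rate will be enough.\<close>

lemma cum_hazard_has_derivative:
  assumes s: "0 < s" and m: "margin Y s > 0"
  shows "(cum_hazard lam Y 0 has_real_derivative lamhat (margin Y s)) (at s)"
proof -
  have me: "margin Y s = exposure (Y s)" using m by (auto simp: exposure_proj margin_def frontier_def max_def split: if_splits)
  have ce: "isCont (\<lambda>u. exposure (Y u)) s"
    using continuous_on_interior[OF exposure_continuous[OF Y], of s] s by simp
  have ev: "\<forall>\<^sub>F u in nhds s. exposure (Y u) > 0"
    using ce m unfolding me isCont_def
    by (auto simp: eventually_nhds_conv_at intro: order_tendstoD)
  have "isCont (\<lambda>u. lamhat (exposure (Y u))) s"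
    using lamhat_continuous[of UNIV] by (intro isCont_o2[OF ce]) (auto simp: continuous_on_eq_continuous_at)
  moreover have "\<forall>\<^sub>F u in nhds s. lam (exposure (Y u)) = lamhat (exposure (Y u))"
    using ev by eventually_elim (simp add: lamhat_eq)
  ultimately have c: "isCont (\<lambda>u. lam (exposure (Y u))) s"
    by (subst isCont_cong)
  have "((\<lambda>u. integral {0..u} (\<lambda>u. lam (exposure (Y u)))) has_vector_derivative lam (exposure (Y s))) (at s within ({0..s + 1} - {}))"
    using s by (intro integral_has_vector_derivative_continuous_at hazard_integrable[OF Y])
      (auto intro: continuous_at_imp_continuous_at_within c)
  moreover have "at s within ({0..s + 1} - {}) = at s"
    using s by (simp add: at_within_Icc_at)
  ultimately have "((\<lambda>u. integral {0..u} (\<lambda>u. lam (exposure (Y u)))) has_vector_derivative lam (exposure (Y s))) (at s)"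
    by simp
  then show ?thesis
    using m by (simp add: cum_hazard_def[abs_def] has_real_derivative_iff_has_vector_derivative me lamhat_eq)
qed

text \<open>The chain rule at dates where path, frontier and accumulated hazard are all
  differentiable, with the sign from the two verification inequalities. The clause on v = 0 records
  what equality forces.\<close>

lemma lyapunov_AE_derivative:
  assumes \<kappa>: "2 * \<alpha> * \<beta> < (\<alpha> - \<beta>) * \<kappa>" and small: "R0 * \<kappa> < 1" and patient: "1 < R0 * (r - g * (\<alpha> - \<beta>))"
  shows "AE s in lborel. 0 < s \<longrightarrow> (\<exists>v\<le>0. (lyapunov \<kappa> Y has_real_derivative v) (at s) \<and>
     (v = 0 \<longrightarrow> (frontier Y has_real_derivative 1) (at s) \<and> gap Y s = 0))"
proof -
  have \<kappa>0: "\<kappa> > 0" using \<kappa>_gt[OF \<kappa>] \<beta>_pos by simp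
  have "AE s in lborel. 0 < s \<longrightarrow> (\<exists>v. (frontier Y has_real_derivative v) (at s))"
    "AE s in lborel. 0 < s \<longrightarrow> (\<exists>v. (cum_hazard lam Y 0 has_real_derivative v) (at s))"
    by (intro lipschitzian_AE_differentiable lipschitzian_components lipschitzian_cum_hazard)+
  with bounded_speed_halfline_AE_derivative[OF g Y]
  show ?thesis
  proof eventually_elim
    case (elim s)
    show ?case
    proof
      assume s: "0 < s"
      obtain v1 v2 where v: "v1 \<in> {0..1}" "v2 \<in> {0..1}" "(Y has_vector_derivative (v1, v2, g)) (at s)"
        using elim s by blast
      obtain a where a: "(frontier Y has_real_derivative a) (at s)" using elim s by blast
      obtain h where h: "(cum_hazard lam Y 0 has_real_derivative h) (at s)" using elim s by blast
      have a01: "a \<in> {0..1}"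
      proof (rule has_vector_derivative_in_closed[of "frontier Y" _ s _ 1])
        show "(frontier Y (s + h) - frontier Y s) /\<^sub>R h \<in> {0..1}" if "0 < h" for h
          using frontier_increment[of s "s + h"] that s by (auto simp: field_simps)
      qed (use a in \<open>auto simp: has_real_derivative_iff_has_vector_derivative\<close>)
      have h0: "h \<in> {0..}"
      proof (rule has_vector_derivative_in_closed[of "cum_hazard lam Y 0" _ s _ 1])
        show "(cum_hazard lam Y 0 (s + h) - cum_hazard lam Y 0 s) /\<^sub>R h \<in> {0..}" if "0 < h" for h
          using cum_hazard_mono[OF Y, of 0 s "s + h"] that s by auto
      qed (use h in \<open>auto simp: has_real_derivative_iff_has_vector_derivative\<close>)
      have "((\<lambda>s. fst (Y s)) has_vector_derivative fst (v1, v2, g)) (at s)"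
        "((\<lambda>s. fst (snd (Y s))) has_vector_derivative fst (snd (v1, v2, g))) (at s)"
        "((\<lambda>s. snd (snd (Y s))) has_vector_derivative snd (snd (v1, v2, g))) (at s)"
        by (rule bounded_linear.has_vector_derivative[OF _ v(3)],
            intro bounded_linear_fst bounded_linear_fst_comp bounded_linear_snd_comp bounded_linear_snd)+
      then have comp: "((\<lambda>s. fst (Y s)) has_real_derivative v1) (at s)"
        "((\<lambda>s. fst (snd (Y s))) has_real_derivative v2) (at s)"
        "((\<lambda>s. snd (snd (Y s))) has_real_derivative g) (at s)"
        by (simp_all add: has_real_derivative_iff_has_vector_derivative)
      have m': "(margin Y has_real_derivative (a - g)) (at s)"
        unfolding margin_def[abs_def] by (intro DERIV_diff a comp)
      have gap': "(gap Y has_real_derivative (v1 - v2)) (at s)"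
        unfolding gap_def[abs_def] by (intro DERIV_diff comp)
      define W V K k zk where "W = weight Y s" and "V = race_continuation (margin Y s / (1 - g))"
        and "K = gap_bound \<kappa> \<bar>gap Y s\<bar>" and "k = gap_bound' \<kappa> \<bar>gap Y s\<bar>"
        and "zk = sgn (gap Y s) * k * (v1 - v2)"
      define V' where "V' = (V * (\<rho> + lamhat (margin Y s)) - 1) * ((a - g) / (1 - g))"
      have w': "(weight Y has_real_derivative W * (- r - h + (\<alpha> - \<beta>) * a)) (at s)"
        unfolding weight_def[abs_def] W_def
        by (auto intro!: derivative_eq_intros h a simp: algebra_simps)
      \<comment> \<open>The value of racing is differentiable only on the half-line, so the outer
        derivative is taken within the range of the scaled margin.\<close>
      have "(race_continuation \<circ> (\<lambda>s. margin Y s / (1 - g)) has_real_derivative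
          (V * (\<rho> + lamhat ((1 - g) * (margin Y s / (1 - g)))) - 1) * ((a - g) / (1 - g))) (at s)"
        unfolding V_def
      proof (rule DERIV_image_chain)
        show "((\<lambda>s. margin Y s / (1 - g)) has_real_derivative (a - g) / (1 - g)) (at s)"
          using DERIV_cdivide[OF m'] .
        show "(race_continuation has_real_derivative race_continuation (margin Y s / (1 - g)) *
           (\<rho> + lamhat ((1 - g) * (margin Y s / (1 - g)))) - 1) (at (margin Y s / (1 - g)) within range (\<lambda>s. margin Y s / (1 - g)))"
          using g margin_nonneg by (intro DERIV_subset[OF race_continuation_has_derivative]) auto
      qed
      then have v': "((\<lambda>s. race_continuation (margin Y s / (1 - g))) has_real_derivative V') (at s)"
        using g by (simp add: o_def V'_def)
      have k': "((\<lambda>s. gap_bound \<kappa> \<bar>gap Y s\<bar>) has_real_derivative zk) (at s)"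
        unfolding zk_def k_def
        by (rule DERIV_chain2[OF has_real_derivative_abs_argument[OF gap_bound_has_derivative gap_bound'_0[OF \<kappa>]] gap'])
      have i': "((\<lambda>s. integral {0..s} (average_flow Y)) has_real_derivative average_flow Y s) (at s)"
      proof -
        have "((\<lambda>s. integral {0..s} (average_flow Y)) has_real_derivative average_flow Y s) (at s within {0..s + 1})"
          by (rule integral_has_real_derivative) (use s in \<open>auto intro: continuous_on_subset[OF average_flow_continuous]\<close>)
        then show ?thesis using s by (simp add: at_within_Icc_at)
      qed
      define B where "B = (- r - h + (\<alpha> - \<beta>) * a) * V * K + V' * K + V * zk + (K - k / \<kappa>)"
      have avg: "average_flow Y s = W * (K - k / \<kappa>)"
        using gap_bound_identity[OF \<kappa>, of "\<bar>gap Y s\<bar>"] by (simp add: average_flow_def W_def K_def k_def)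
      have lyap': "(lyapunov \<kappa> Y has_real_derivative W * B) (at s)"
        unfolding lyapunov_def[abs_def] potential_def
        by (rule derivative_eq_intros w' v' k' i' refl)+
          (simp add: B_def avg W_def[symmetric] V_def[symmetric] K_def[symmetric] algebra_simps)
      have m0: "margin Y s / (1 - g) \<ge> 0" using margin_nonneg g by simp
      have V: "0 < V" "V \<le> R0" using race_continuation_pos[OF m0] race_continuation_le[OF m0] by (auto simp: V_def)
      have V\<kappa>: "V * \<kappa> < 1" using small V \<kappa>0 mult_right_mono[of V R0 \<kappa>] by linarith
      have K: "K > 0" using gap_bound_pos[OF \<kappa>] by (simp add: K_def)
      have k0: "k \<ge> 0" using gap_bound'_nonneg[OF \<kappa>] by (simp add: k_def)
      have "\<bar>zk\<bar> = \<bar>sgn (gap Y s)\<bar> * k * \<bar>v1 - v2\<bar>" using k0 by (simp add: zk_def abs_mult)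
      also have "\<dots> \<le> 1 * k * 1"
        using k0 v(1,2) by (intro mult_mono) (auto simp: sgn_if)
      finally have zk: "zk \<le> k" by simp
      have B: "B \<le> 0 \<and> (B = 0 \<longrightarrow> a = 1 \<and> k = 0)"
      proof (cases "margin Y s = 0")
        case False
        then have mp: "margin Y s > 0" using margin_nonneg[of Y s] by simp
        have hm: "h = lamhat (margin Y s)"
          using DERIV_unique[OF h cum_hazard_has_derivative[OF s mp]] .
        \<comment> \<open>The concavity bound becomes strict when \<open>1 / R0\<close> is replaced
          by the larger \<open>r - g * (\<alpha> - \<beta>)\<close>; this is the positive loss from
          slowing the frontier.\<close>
        have "1 \<le> (1 / R0 + \<phi> (margin Y s)) * V"
          using race_continuation_ge[OF m0] g by (simp add: V_def)
        also have "\<dots> < (r - g * (\<alpha> - \<beta>) + \<phi> (margin Y s)) * V"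
        proof -
          have "1 / R0 < r - g * (\<alpha> - \<beta>)" using patient race_value_pos by (simp add: field_simps)
          then show ?thesis using V by (intro mult_strict_right_mono) auto
        qed
        also have "\<dots> \<le> (r - g * (\<alpha> - \<beta>) + h) * V"
          using V lam0 mp by (intro mult_right_mono) (auto simp: hm lamhat_def)
        finally have l: "1 < (r - g * (\<alpha> - \<beta>) + h) * V" .
        have "(\<alpha> - \<beta>) * V + (V * (\<rho> + h) - 1) / (1 - g) = ((r - g * (\<alpha> - \<beta>) + h) * V - 1) / (1 - g)"
          using g by (simp add: \<rho>_def field_simps)
        then have "0 < (\<alpha> - \<beta>) * V + (V * (\<rho> + h) - 1) / (1 - g)" using l g by simp
        from verification_inequality[OF V(1) V\<kappa> \<kappa>0 K k0 zk _ this, of a] a01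
        show ?thesis by (simp add: B_def V'_def hm)
      next
        case True
        \<comment> \<open>The margin is nonnegative and vanishes here, so it has a minimum and zero
          derivative: the frontier moves with the threshold.\<close>
        have "a - g = 0"
          by (rule DERIV_local_min[OF m', of 1]) (use True margin_nonneg in auto)
        then have ag: "a = g" by simp
        have "V = R0" using True by (simp add: V_def race_continuation_0)
        then have "B < 0"
          using verification_inequality_threshold[OF V(1) V\<kappa> \<kappa>0 K k0 zk, of h] h0 patient
          by (simp add: B_def V'_def ag)
        then show ?thesis by simp
      qed
      have kg: "k = 0 \<Longrightarrow> gap Y s = 0"
        using gap_bound'_pos[OF \<kappa>, of "\<bar>gap Y s\<bar>"] by (force simp: k_def)
      have "W > 0" by (simp add: W_def weight_pos)
      then show "\<exists>v\<le>0. (lyapunov \<kappa> Y has_real_derivative v) (at s) \<and>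
         (v = 0 \<longrightarrow> (frontier Y has_real_derivative 1) (at s) \<and> gap Y s = 0)"
        using a lyap' B kg by (intro exI[of _ "W * B"]) (auto simp: mult_le_0_iff)
    qed
  qed
qed

text \<open>Factoring out the tie flow at the leader's capability leaves
  \<open>exp (\<beta> * z)\<close> for the leader and \<open>exp (- \<alpha> * z)\<close> for the
  laggard. The inequality is strict only when both firms are below the threshold, where the frontier
  exceeds their capabilities.\<close>

lemma flow_sum_le: "flow Firm1 0 Y s + flow Firm2 0 Y s \<le> 2 * average_flow Y s"
proof -
  define A1 A2 where "A1 = fst (Y s)" and "A2 = fst (snd (Y s))"
  define E where "E = exp (- r * s - cum_hazard lam Y 0 s)"
  have sum: "exp (\<alpha> * A1 - \<beta> * A2) + exp (\<alpha> * A2 - \<beta> * A1) = exp ((\<alpha> - \<beta>) * max A1 A2) * (2 * gap_average \<bar>A1 - A2\<bar>)"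
  proof (cases "A1 \<ge> A2")
    case True
    then show ?thesis by (simp add: gap_average_def distrib_left exp_add[symmetric] max_def algebra_simps)
  next
    case False
    then show ?thesis by (simp add: gap_average_def distrib_left exp_add[symmetric] max_def algebra_simps)
  qed
  have "flow Firm1 0 Y s + flow Firm2 0 Y s = E * (exp (\<alpha> * A1 - \<beta> * A2) + exp (\<alpha> * A2 - \<beta> * A1))"
    by (simp add: flow_def E_def A1_def A2_def capability_proj distrib_left)
  also have "\<dots> = E * exp ((\<alpha> - \<beta>) * max A1 A2) * (2 * gap_average \<bar>A1 - A2\<bar>)" unfolding sum by simp
  also have "\<dots> \<le> E * exp ((\<alpha> - \<beta>) * frontier Y s) * (2 * gap_average \<bar>A1 - A2\<bar>)"
    using \<alpha>_gt_\<beta> gap_average_pos[of "\<bar>A1 - A2\<bar>"]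
    by (intro mult_right_mono mult_left_mono) (auto simp: E_def frontier_def A1_def A2_def)
  also have "\<dots> = 2 * average_flow Y s"
    by (simp add: average_flow_def weight_def gap_def E_def A1_def A2_def exp_add)
  finally show ?thesis .
qed

end

text \<open>The Lyapunov function starts at the racing value and dominates the accumulated average payoff.
  If both firms obtain at least the racing value it is constant, which forces its derivative to
  vanish almost everywhere.\<close>

lemma joint_racing:
  assumes Y: "bounded_speed g {0..} Y" and Y0: "Y 0 = (x0, x0, x0)"
    and vals: "\<And>i. ennreal (exp ((\<alpha> - \<beta>) * x0) * R0) \<le> value_of i 0 Y"
    and patient: "1 < R0 * (r - g * (\<alpha> - \<beta>))" and asym: "R0 * (2 * \<alpha> * \<beta>) < \<alpha> - \<beta>"
    and t: "t \<ge> 0"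
  shows "capability i (Y t) = x0 + t"
proof -
  define E where "E = exp ((\<alpha> - \<beta>) * x0) * R0"
  have "2 * \<alpha> * \<beta> / (\<alpha> - \<beta>) < 1 / R0"
    using asym race_value_pos \<alpha>_gt_\<beta> by (simp add: field_simps)
  then obtain \<kappa> where \<kappa>1: "2 * \<alpha> * \<beta> / (\<alpha> - \<beta>) < \<kappa>" and \<kappa>2: "\<kappa> < 1 / R0" using dense by blast
  have \<kappa>: "2 * \<alpha> * \<beta> < (\<alpha> - \<beta>) * \<kappa>" using \<kappa>1 \<alpha>_gt_\<beta> by (simp add: field_simps)
  have small: "R0 * \<kappa> < 1" using \<kappa>2 race_value_pos by (simp add: field_simps)
  note der = lyapunov_AE_derivative[OF Y \<kappa> small patient]
  have anti: "lyapunov \<kappa> Y t \<le> lyapunov \<kappa> Y s" if "0 \<le> s" "s \<le> t" for s t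
    by (rule lipschitzian_AE_deriv_nonpos_antimono[OF lipschitzian_lyapunov[OF Y] _ that])
      (use der in \<open>auto elim!: eventually_mono\<close>)
  have start: "lyapunov \<kappa> Y 0 = E"
    by (simp add: lyapunov_def potential_def weight_def frontier_def margin_def gap_def Y0 race_continuation_0
        gap_bound_0[OF \<kappa>] E_def cum_hazard_def)
  have pot: "potential \<kappa> Y s > 0" for s
  proof -
    have "margin Y s / (1 - g) \<ge> 0" using margin_nonneg g by simp
    then show ?thesis unfolding potential_def
      by (intro mult_pos_pos weight_pos race_continuation_pos gap_bound_pos[OF \<kappa>]) auto
  qed
  have cont: "continuous_on {0..b} (average_flow Y)" for b
    by (rule continuous_on_subset[OF average_flow_continuous[OF Y]]) auto
  \<comment> \<open>The potential is positive and the Lyapunov function decreases, so its value at s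
    dominates the payoff accumulated up to any n; for n before s the integral is first extended to
    s.\<close>
  have lower: "integral {0..real n} (average_flow Y) \<le> lyapunov \<kappa> Y s" if "0 \<le> s" for n s
  proof -
    have "integral {0..real n} (average_flow Y) \<le> integral {0..max (real n) s} (average_flow Y)"
      by (intro integral_subset_le integrable_continuous_real cont) (auto simp: average_flow_pos less_imp_le)
    also have "\<dots> \<le> lyapunov \<kappa> Y (max (real n) s)" using pot[of "max (real n) s"] by (simp add: lyapunov_def)
    also have "\<dots> \<le> lyapunov \<kappa> Y s" using that by (intro anti) auto
    finally show ?thesis .
  qed
  have const: "lyapunov \<kappa> Y s = E" if "0 \<le> s" for s
  proof -
    have m: "(\<lambda>u. ennreal (flow i 0 Y u) * indicator {0..} u) \<in> borel_measurable borel" for i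
      by (rule continuous_on_borel_measurable_indicator[OF flow_continuous[OF Y]]) auto
    have m2: "(\<lambda>u. ennreal (2 * average_flow Y u) * indicator {0..} u) \<in> borel_measurable borel"
      by (rule continuous_on_borel_measurable_indicator) (auto intro!: continuous_intros average_flow_continuous[OF Y])
    \<comment> \<open>Each firm obtains at least E on this one path, and the sum of the flows is at
      most twice the average flow, so the Lyapunov function cannot fall below its initial value
      E.\<close>
    have "ennreal (2 * E) = ennreal E + ennreal E"
      using race_value_pos by (subst ennreal_plus[symmetric]) (auto simp: E_def)
    also have "\<dots> \<le> value_of Firm1 0 Y + value_of Firm2 0 Y"
      using vals by (intro add_mono) (auto simp: E_def)
    also have "\<dots> = (\<integral>\<^sup>+u. ennreal (flow Firm1 0 Y u) * indicator {0..} u + ennreal (flow Firm2 0 Y u) * indicator {0..} u \<partial>lborel)"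
      unfolding path_payoff_flow using m by (subst nn_integral_add) auto
    also have "\<dots> \<le> (\<integral>\<^sup>+u\<in>{0..}. ennreal (2 * average_flow Y u) * indicator {0..} u \<partial>lborel)"
    proof (rule nn_integral_mono)
      fix u
      have "ennreal (flow Firm1 0 Y u) + ennreal (flow Firm2 0 Y u) \<le> ennreal (2 * average_flow Y u)"
        using flow_sum_le[OF Y, of u] flow_pos[OF Y] by (subst ennreal_plus[symmetric]) (auto intro: less_imp_le ennreal_leI)
      then show "ennreal (flow Firm1 0 Y u) * indicator {0..} u + ennreal (flow Firm2 0 Y u) * indicator {0..} u
          \<le> ennreal (2 * average_flow Y u) * indicator {0..} u * indicator {0..} u"
        by (auto split: split_indicator)
    qed
    also have "\<dots> = (SUP n. \<integral>\<^sup>+u\<in>{0..0 + real n}. ennreal (2 * average_flow Y u) * indicator {0..} u \<partial>lborel)"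
      by (rule nn_integral_halfline_SUP[OF m2])
    also have "\<dots> \<le> ennreal (2 * lyapunov \<kappa> Y s)"
    proof (rule SUP_least)
      fix n :: nat
      have "(\<integral>\<^sup>+u\<in>{0..0 + real n}. ennreal (2 * average_flow Y u) * indicator {0..} u \<partial>lborel)
         = (\<integral>\<^sup>+u\<in>{0..real n}. ennreal (2 * average_flow Y u) \<partial>lborel)"
        by (intro nn_integral_cong) (auto split: split_indicator)
      also have "\<dots> = ennreal (integral {0..real n} (\<lambda>u. 2 * average_flow Y u))"
        by (rule nn_integral_Icc_eq_integral) (auto intro!: continuous_intros cont simp: average_flow_pos less_imp_le)
      also have "\<dots> \<le> ennreal (2 * lyapunov \<kappa> Y s)"
        using lower[OF that, of n] by (intro ennreal_leI) simp
      finally show "(\<integral>\<^sup>+u\<in>{0..0 + real n}. ennreal (2 * average_flow Y u) * indicator {0..} u \<partial>lborel) \<le> ennreal (2 * lyapunov \<kappa> Y s)" .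
    qed
    finally have "ennreal (2 * E) \<le> ennreal (2 * lyapunov \<kappa> Y s)" .
    moreover have "E > 0" using race_value_pos by (simp add: E_def)
    ultimately have "2 * E \<le> 2 * lyapunov \<kappa> Y s"
      by (smt (verit) ennreal_le_iff2)
    then show ?thesis using anti[of 0 s] that start by simp
  qed
  have ae: "AE s in lborel. 0 < s \<longrightarrow> (frontier Y has_real_derivative 1) (at s) \<and> gap Y s = 0"
    using der
  proof (rule eventually_mono, intro impI)
    fix s :: real assume "0 < s \<longrightarrow> (\<exists>v\<le>0. (lyapunov \<kappa> Y has_real_derivative v) (at s) \<and>
     (v = 0 \<longrightarrow> (frontier Y has_real_derivative 1) (at s) \<and> gap Y s = 0))" and s: "0 < s"
    then obtain v where v: "(lyapunov \<kappa> Y has_real_derivative v) (at s)"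
      "v = 0 \<longrightarrow> (frontier Y has_real_derivative 1) (at s) \<and> gap Y s = 0" by blast
    have "(lyapunov \<kappa> Y has_real_derivative 0) (at s)"
      by (rule has_field_derivative_transform_within_open[of "\<lambda>_. E" _ _ "{0<..}"]) (use s const in auto)
    then have "v = 0" using DERIV_unique[OF v(1)] by simp
    then show "(frontier Y has_real_derivative 1) (at s) \<and> gap Y s = 0" using v(2) by simp
  qed
  have front: "frontier Y t = x0 + t"
  proof -
    have "t - frontier Y t \<le> 0 - frontier Y 0"
    proof (rule lipschitzian_AE_deriv_nonpos_antimono[of "\<lambda>s. s - frontier Y s"])
      show "lipschitzian T (\<lambda>s. s - frontier Y s)" for T
        using lipschitzian_add[OF lipschitzian_ident lipschitzian_cmult[OF lipschitzian_components(1)[OF Y], of _ "-1"], of T] by simp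
      show "AE s in lborel. 0 < s \<longrightarrow> (\<exists>v\<le>0. ((\<lambda>s. s - frontier Y s) has_real_derivative v) (at s))"
        using ae
      proof (rule eventually_mono, intro impI)
        fix s :: real assume "0 < s \<longrightarrow> (frontier Y has_real_derivative 1) (at s) \<and> gap Y s = 0" "0 < s"
        then have "((\<lambda>s. s - frontier Y s) has_real_derivative 1 - 1) (at s)" by (intro DERIV_diff DERIV_ident) auto
        then show "\<exists>v\<le>0. ((\<lambda>s. s - frontier Y s) has_real_derivative v) (at s)" by (intro exI[of _ 0]) simp
      qed
    qed (use t in auto)
    moreover have "frontier Y t - frontier Y 0 \<in> {0..t - 0}" using frontier_increment[OF Y, of 0 t] t by simp
    ultimately show ?thesis by (simp add: frontier_def Y0)
  qed
  have "gap Y t = 0"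
  proof (rule ccontr)
    assume "gap Y t \<noteq> 0"
    then have pos: "\<bar>gap Y t\<bar> > 0" by simp
    \<comment> \<open>The gap vanishes at almost every date only; a witness closer to t than the
      size of the gap at t contradicts that the gap changes at rate at most 1.\<close>
    obtain u where u: "t < u" "u < t + \<bar>gap Y t\<bar>" "0 < u \<longrightarrow> (frontier Y has_real_derivative 1) (at u) \<and> gap Y u = 0"
      using AE_lborel_witness_between[OF ae, of t "t + \<bar>gap Y t\<bar>"] pos by auto
    then have "gap Y u = 0" using t by simp
    moreover have "\<bar>gap Y u - gap Y t\<bar> \<le> u - t"
      using capability_increment[OF Y, of t u Firm1] capability_increment[OF Y, of t u Firm2] u t
      by (auto simp: gap_def capability_proj)
    ultimately show False using u by simp
  qed
  then have eq: "fst (Y t) = fst (snd (Y t))" by (simp add: gap_def)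
  have "snd (snd (Y t)) = x0 + g * t" using position_increment[OF Y, of 0 t] t by (simp add: Y0)
  moreover have "g * t \<le> t" using g t by (simp add: mult_left_le_one_le)
  moreover have "fst (Y t) \<le> x0 + t" using capability_increment[OF Y, of 0 t Firm1] t by (simp add: capability_proj Y0)
  ultimately have "fst (Y t) = x0 + t"
  \<comment> \<open>After date 0 the threshold is strictly below x0 + t, so the frontier is attained
    by the firms themselves.\<close>
  proof (cases "t = 0")
    case False
    then have "g * t < t" using g t by simp
    then show ?thesis using front eq \<open>snd (snd (Y t)) = x0 + g * t\<close> by (auto simp: frontier_def max_def split: if_splits)
  qed (simp add: Y0)
  then show ?thesis using eq by (cases i) (auto simp: capability_proj)
qed

end

section \<open>The payoff guarantee\<close>

context development_game
begin

definition survival :: "path \<Rightarrow> real \<Rightarrow> real \<Rightarrow> real" where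
  "survival Y t s = exp (- cum_hazard lam Y t s)"

text \<open>Each capability rises by between 0 and s - t. The extreme cases, stopping against a
  racing rival and racing against a stopped one, have effective discount rates r + \<beta> and r -
  \<alpha>.\<close>

lemma flow_survival_bounds:
  assumes Y: "bounded_speed g {0..} Y" and t: "0 \<le> t" "t \<le> s"
  defines "E \<equiv> \<lambda>i. exp (\<alpha> * capability i (Y t) - \<beta> * capability (other i) (Y t))"
  shows "E i * (exp (- (r + \<beta>) * (s - t)) * survival Y t s) \<le> flow i t Y s"
    and "flow i t Y s \<le> E i * (exp (- (r - \<alpha>) * (s - t)) * survival Y t s)"
proof -
  have "capability i (Y s) - capability i (Y t) \<in> {0..s - t}"
    "capability (other i) (Y s) - capability (other i) (Y t) \<in> {0..s - t}"
    using capability_increment[OF Y, of t s] t by auto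
  then have "\<alpha> * capability i (Y t) \<le> \<alpha> * capability i (Y s)" "\<alpha> * capability i (Y s) \<le> \<alpha> * (capability i (Y t) + (s - t))"
    "\<beta> * capability (other i) (Y t) \<le> \<beta> * capability (other i) (Y s)"
    "\<beta> * capability (other i) (Y s) \<le> \<beta> * (capability (other i) (Y t) + (s - t))"
    using \<beta>_pos \<alpha>_gt_\<beta> by (auto intro!: mult_left_mono)
  then show "E i * (exp (- (r + \<beta>) * (s - t)) * survival Y t s) \<le> flow i t Y s"
    and "flow i t Y s \<le> E i * (exp (- (r - \<alpha>) * (s - t)) * survival Y t s)"
    by (simp_all add: E_def flow_def survival_def exp_add[symmetric] algebra_simps)
qed

lemma survival_continuous:
  assumes "bounded_speed g {0..} Y" "0 \<le> t"
  shows "continuous_on {t..} (survival Y t)"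
  unfolding survival_def by (intro continuous_intros cum_hazard_continuous assms)

lemma discounted_survival_measurable:
  assumes "bounded_speed g {0..} Y" "0 \<le> t"
  shows "(\<lambda>s. ennreal (exp (- c * (s - t)) * survival Y t s) * indicator {t..} s) \<in> borel_measurable borel"
  by (rule continuous_on_borel_measurable_indicator) (auto intro!: continuous_intros survival_continuous assms)

text \<open>Survival is decreasing, so stretching time by \<open>(r + \<beta>) / (r - \<alpha>)\<close> turns the smaller discount rate
  into the larger one at the cost of exactly that factor.\<close>

lemma discounted_survival_ratio:
  assumes Y: "bounded_speed g {0..} Y" and t: "0 \<le> t" and r: "r > \<alpha>"
  defines "N \<equiv> \<lambda>c. \<integral>\<^sup>+s\<in>{t..}. ennreal (exp (- c * (s - t)) * survival Y t s) \<partial>lborel"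
  shows "N (r - \<alpha>) \<le> ennreal ((r + \<beta>) / (r - \<alpha>)) * N (r + \<beta>)"
proof -
  define k where "k = (r + \<beta>) / (r - \<alpha>)"
  have k: "k \<ge> 1" "k > 0" using r \<beta>_pos \<alpha>_gt_\<beta> by (auto simp: k_def)
  have "N (r - \<alpha>) = ennreal \<bar>k\<bar> * (\<integral>\<^sup>+u. ennreal (exp (- (r - \<alpha>) * ((t - k * t) + k * u - t)) * survival Y t ((t - k * t) + k * u)) * indicator {t..} ((t - k * t) + k * u) \<partial>lborel)"
    unfolding N_def
    by (rule nn_integral_real_affine[where t = "t - k * t" and c = k and f = "\<lambda>s. ennreal (exp (- (r - \<alpha>) * (s - t)) * survival Y t s) * indicator {t..} s"])
      (rule discounted_survival_measurable[OF Y t], use k in simp)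
  also have "\<dots> \<le> ennreal \<bar>k\<bar> * N (r + \<beta>)"
    unfolding N_def
  proof (intro mult_left_mono nn_integral_mono)
    fix u
    have eq: "t - k * t + k * u - t = k * (u - t)" "t - k * t + k * u = t + k * (u - t)" by (simp_all add: algebra_simps)
    show "ennreal (exp (- (r - \<alpha>) * ((t - k * t) + k * u - t)) * survival Y t ((t - k * t) + k * u)) * indicator {t..} ((t - k * t) + k * u)
      \<le> ennreal (exp (- (r + \<beta>) * (u - t)) * survival Y t u) * indicator {t..} u"
    proof (cases "t \<le> u")
      case True
      have "u - t \<le> k * (u - t)" using k True by (simp add: mult_le_cancel_right1)
      then have "cum_hazard lam Y t u \<le> cum_hazard lam Y t (t + k * (u - t))"
        using True t by (intro cum_hazard_mono[OF Y]) auto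
      then have surv: "survival Y t (t + k * (u - t)) \<le> survival Y t u" by (simp add: survival_def)
      have "(r - \<alpha>) * (k * (u - t)) = (r + \<beta>) * (u - t)" using r by (simp add: k_def)
      then have e: "- (r - \<alpha>) * (k * (u - t)) = - (r + \<beta>) * (u - t)" by (simp only: mult_minus_left)
      have "exp (- (r - \<alpha>) * (k * (u - t))) * survival Y t (t + k * (u - t)) \<le> exp (- (r + \<beta>) * (u - t)) * survival Y t u"
        unfolding e using surv by (intro mult_left_mono) simp_all
      then show ?thesis unfolding eq using True by (auto intro!: ennreal_leI split: split_indicator)
    next
      case False
      then have "k * (u - t) < 0" using k by (simp add: mult_pos_neg)
      then show ?thesis unfolding eq using False by simp
    qed
  qed simp
  finally show ?thesis using k(2) unfolding k_def[symmetric] by simp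
qed

text \<open>Both firms share the survival along the path, so each payoff lies between its initial
  flow times discounted survival at rate r + \<beta> and the same at rate r - \<alpha>. The initial
  flows differ by the exponential of \<alpha> + \<beta> times the capability gap.\<close>

lemma path_payoff_ratio:
  assumes Y: "bounded_speed g {0..} Y" and t: "0 \<le> t" and r: "r > \<alpha>"
  shows "ennreal ((r - \<alpha>) / (r + \<beta>) * exp (- (\<alpha> + \<beta>) * (capability (other i) (Y t) - capability i (Y t)))) * value_of (other i) t Y \<le> value_of i t Y"
proof -
  define E where "E i = exp (\<alpha> * capability i (Y t) - \<beta> * capability (other i) (Y t))" for i
  define N where "N c = (\<integral>\<^sup>+s\<in>{t..}. ennreal (exp (- c * (s - t)) * survival Y t s) \<partial>lborel)" for c
  have p: "r - \<alpha> > 0" "r + \<beta> > 0" using r \<beta>_pos \<alpha>_gt_\<beta> by auto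
  have scale: "ennreal (E j) * N c = (\<integral>\<^sup>+s\<in>{t..}. ennreal (E j * (exp (- c * (s - t)) * survival Y t s)) \<partial>lborel)" for j c
  proof -
    have "(\<lambda>s. ennreal (exp (- c * (s - t)) * survival Y t s) * indicator {t..} s) \<in> borel_measurable lborel"
      using discounted_survival_measurable[OF Y t, of c] by simp
    from nn_integral_cmult[OF this, of "ennreal (E j)"] show ?thesis
      unfolding N_def by (simp add: E_def ennreal_mult' mult.assoc)
  qed
  have mono: "ennreal x * indicator {t..} s \<le> ennreal y * indicator {t..} s" if "t \<le> s \<Longrightarrow> x \<le> y" for x y s
    using that by (cases "t \<le> s") (simp_all add: ennreal_leI)
  have lower: "ennreal (E j) * N (r + \<beta>) \<le> value_of j t Y" for j
    unfolding scale path_payoff_flow unfolding E_def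
    by (intro nn_integral_mono mono) (rule flow_survival_bounds[OF Y t])
  have upper: "value_of j t Y \<le> ennreal (E j) * N (r - \<alpha>)" for j
    unfolding scale path_payoff_flow unfolding E_def
    by (intro nn_integral_mono mono) (rule flow_survival_bounds[OF Y t])
  have Ei: "exp (- (\<alpha> + \<beta>) * (capability (other i) (Y t) - capability i (Y t))) * E (other i) = E i"
    by (simp add: E_def exp_add[symmetric] algebra_simps)
  have "ennreal ((r - \<alpha>) / (r + \<beta>) * exp (- (\<alpha> + \<beta>) * (capability (other i) (Y t) - capability i (Y t)))) * value_of (other i) t Y
     \<le> ennreal ((r - \<alpha>) / (r + \<beta>) * exp (- (\<alpha> + \<beta>) * (capability (other i) (Y t) - capability i (Y t)))) * (ennreal (E (other i)) * N (r - \<alpha>))"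
    by (intro mult_left_mono upper) simp
  also have "\<dots> = ennreal ((r - \<alpha>) / (r + \<beta>) * E i) * N (r - \<alpha>)"
    unfolding Ei[symmetric] mult.assoc[symmetric] using p by (subst ennreal_mult[symmetric]) (auto simp: E_def mult.assoc)
  also have "\<dots> \<le> ennreal ((r - \<alpha>) / (r + \<beta>) * E i) * (ennreal ((r + \<beta>) / (r - \<alpha>)) * N (r + \<beta>))"
    by (intro mult_left_mono discounted_survival_ratio[OF Y t r, folded N_def]) simp
  also have "\<dots> = ennreal (E i) * N (r + \<beta>)"
    unfolding mult.assoc[symmetric] using p by (subst ennreal_mult[symmetric]) (auto simp: E_def)
  also have "\<dots> \<le> value_of i t Y" by (rule lower)
  finally show ?thesis .
qed

text \<open>With r > \<alpha> even racing against a stopped rival without hazard has a finite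
  discounted payoff. Finiteness later permits the passage from extended to real values.\<close>

lemma game_value_finite:
  assumes \<sigma>: "\<And>i. is_strategy g (\<sigma> i)" and h: "feasible_history g (t, S)" and r: "r > \<alpha>"
  shows "game_value i \<sigma> (t, S) < top"
proof -
  have t: "0 \<le> t" using h by (simp add: feasible_history_iff[OF g])
  define E where "E = exp (\<alpha> * capability i (S t) - \<beta> * capability (other i) (S t))"
  have hi: "((\<lambda>x. exp (- (r - \<alpha>) * x)) has_integral exp (- (r - \<alpha>) * t) / (r - \<alpha>)) {t..}"
    using r has_integral_exp_minus_to_infinity[of "r - \<alpha>" t] by simp
  have int: "((\<lambda>s. E * exp ((r - \<alpha>) * t) * exp (- (r - \<alpha>) * s)) has_integral
      E * exp ((r - \<alpha>) * t) * (exp (- (r - \<alpha>) * t) / (r - \<alpha>))) {t..}"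
    by (rule has_integral_mult_right[OF hi])
  define C where "C = E * exp ((r - \<alpha>) * t) * (exp (- (r - \<alpha>) * t) / (r - \<alpha>))"
  have "value_of i t Y \<le> ennreal C" if "Y \<in> continuations g \<sigma> (t, S)" for Y
  proof -
    have Y: "bounded_speed g {0..} Y" by (rule continuation_bounded_speed[where \<sigma> = \<sigma>, OF g \<sigma> h that])
    have YS: "Y t = S t" using that t by (auto simp: continuations_def)
    have "value_of i t Y \<le> (\<integral>\<^sup>+s\<in>{t..}. ennreal (E * exp ((r - \<alpha>) * t) * exp (- (r - \<alpha>) * s)) \<partial>lborel)"
      unfolding path_payoff_flow
    proof (intro nn_integral_mono)
      fix s
      show "ennreal (flow i t Y s) * indicator {t..} s \<le> ennreal (E * exp ((r - \<alpha>) * t) * exp (- (r - \<alpha>) * s)) * indicator {t..} s"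
      proof (cases "t \<le> s")
        case True
        have "flow i t Y s \<le> E * (exp (- (r - \<alpha>) * (s - t)) * survival Y t s)"
          using flow_survival_bounds(2)[OF Y t True, of i] by (simp add: YS E_def)
        also have "\<dots> \<le> E * (exp (- (r - \<alpha>) * (s - t)) * 1)"
          using cum_hazard_nonneg[OF Y t, of s] by (intro mult_left_mono) (auto simp: survival_def E_def)
        also have "\<dots> = E * exp ((r - \<alpha>) * t) * exp (- (r - \<alpha>) * s)"
          by (simp add: exp_add[symmetric] algebra_simps mult_exp_exp)
        finally show ?thesis using True by (simp add: ennreal_leI)
      qed simp
    qed
    also have "\<dots> = ennreal C"
      unfolding C_def by (rule nn_integral_has_integral_lebesgue'[OF _ int]) (simp add: E_def)
    finally show ?thesis .
  qed
  then have "game_value i \<sigma> (t, S) \<le> ennreal C" unfolding payoff_def by (auto intro: SUP_least)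
  then show ?thesis by (rule le_less_trans) simp
qed

text \<open>Both values are suprema over the same continuations, so the bound for a common path
  passes to them.\<close>

lemma game_value_ratio:
  assumes \<sigma>: "\<And>i. is_strategy g (\<sigma> i)" and h: "feasible_history g (t, S)" and r: "r > \<alpha>"
  shows "ennreal ((r - \<alpha>) / (r + \<beta>) * exp (- (\<alpha> + \<beta>) * (capability (other i) (S t) - capability i (S t)))) * game_value (other i) \<sigma> (t, S)
    \<le> game_value i \<sigma> (t, S)"
  unfolding payoff_def fst_conv SUP_mult_left_ennreal
proof (rule SUP_least)
  fix Z assume Z: "Z \<in> continuations g \<sigma> (t, S)"
  have t: "0 \<le> t" using h by (simp add: feasible_history_iff[OF g])
  have Zb: "bounded_speed g {0..} Z" by (rule continuation_bounded_speed[where \<sigma> = \<sigma>, OF g \<sigma> h Z])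
  have ZS: "Z t = S t" using Z t by (auto simp: continuations_def)
  show "ennreal ((r - \<alpha>) / (r + \<beta>) * exp (- (\<alpha> + \<beta>) * (capability (other i) (S t) - capability i (S t)))) * value_of (other i) t Z
    \<le> (SUP Y\<in>continuations g \<sigma> (t, S). value_of i t Y)"
    using path_payoff_ratio[OF Zb t r, of i] SUP_upper[OF Z, of "value_of i t"] by (simp add: ZS)
qed

text \<open>The one-window inequality is used twice, the second time at the history reached by the
  first window, which is a subgame of the same equilibrium.\<close>

lemma spe_two_phase_value_step:
  assumes \<sigma>: "spe \<alpha> \<beta> r g lam \<sigma>" and h: "feasible_history g (t, S)"
    and c: "c1 \<in> {0..1}" "c2 \<in> {0..1}" and \<tau>: "0 \<le> \<tau>1" "\<tau>1 \<le> \<tau>"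
  obtains Y where "bounded_speed g {0..} Y" "Y t = S t"
    "\<And>s. s \<in> {0..\<tau>1} \<Longrightarrow> capability k (Y (t + s)) = capability k (S t) + c1 * s"
    "\<And>s. s \<in> {\<tau>1..\<tau>} \<Longrightarrow> capability k (Y (t + s)) = capability k (S t) + c1 * \<tau>1 + c2 * (s - \<tau>1)"
    "ennreal (integral {t..t + \<tau>} (flow k t Y)) + ennreal (exp (- r * \<tau> - cum_hazard lam Y t (t + \<tau>))) *
       game_value k \<sigma> (t + \<tau>, Y) \<le> game_value k \<sigma> (t, S)"
proof -
  have t: "t \<ge> 0" using h by (simp add: feasible_history_iff[OF g])
  obtain Y1 where Y1: "bounded_speed g {0..} Y1" "\<And>s. s \<in> {0..t} \<Longrightarrow> Y1 s = S s"
    "\<And>s. s \<in> {t..t + \<tau>1} \<Longrightarrow> capability k (Y1 s) = capability k (S t) + c1 * (s - t)"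
    "ennreal (integral {t..t + \<tau>1} (flow k t Y1)) + ennreal (exp (- r * \<tau>1 - cum_hazard lam Y1 t (t + \<tau>1))) *
       game_value k \<sigma> (t + \<tau>1, Y1) \<le> game_value k \<sigma> (t, S)"
    by (rule spe_hold_value_step[OF \<sigma> h c(1) \<tau>(1), of k]) blast
  have h1: "feasible_history g (t + \<tau>1, Y1)"
    using Y1(1) t \<tau> by (auto simp: feasible_history_iff[OF g] intro: bounded_speed_subset)
  have \<tau>2: "\<tau> - \<tau>1 \<ge> 0" using \<tau> by simp
  obtain Y where Y: "bounded_speed g {0..} Y" "\<And>s. s \<in> {0..t + \<tau>1} \<Longrightarrow> Y s = Y1 s"
    "\<And>s. s \<in> {t + \<tau>1..t + \<tau>1 + (\<tau> - \<tau>1)} \<Longrightarrow> capability k (Y s) = capability k (Y1 (t + \<tau>1)) + c2 * (s - (t + \<tau>1))"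
    "ennreal (integral {t + \<tau>1..t + \<tau>1 + (\<tau> - \<tau>1)} (flow k (t + \<tau>1) Y)) +
       ennreal (exp (- r * (\<tau> - \<tau>1) - cum_hazard lam Y (t + \<tau>1) (t + \<tau>1 + (\<tau> - \<tau>1)))) *
       game_value k \<sigma> (t + \<tau>1 + (\<tau> - \<tau>1), Y) \<le> game_value k \<sigma> (t + \<tau>1, Y1)"
    by (rule spe_hold_value_step[OF \<sigma> h1 c(2) \<tau>2, of k]) blast
  define e1 where "e1 = exp (- r * \<tau>1 - cum_hazard lam Y t (t + \<tau>1))"
  define e2 where "e2 = exp (- r * (\<tau> - \<tau>1) - cum_hazard lam Y (t + \<tau>1) (t + \<tau>))"
  define I1 where "I1 = integral {t..t + \<tau>1} (flow k t Y)"
  define I2 where "I2 = integral {t + \<tau>1..t + \<tau>} (flow k (t + \<tau>1) Y)"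
  have eqY: "Y s = Y1 s" if "s \<in> {t..t + \<tau>1}" for s using Y(2)[of s] that t by auto
  have "I1 = integral {t..t + \<tau>1} (flow k t Y1)"
    unfolding I1_def by (intro integral_cong flow_cong) (auto intro: eqY)
  moreover have "cum_hazard lam Y1 t (t + \<tau>1) = cum_hazard lam Y t (t + \<tau>1)"
    by (rule cum_hazard_cong) (simp add: eqY)
  ultimately have 1: "ennreal I1 + ennreal e1 * game_value k \<sigma> (t + \<tau>1, Y1) \<le> game_value k \<sigma> (t, S)"
    using Y1(4) by (simp add: e1_def)
  have 2: "ennreal I2 + ennreal e2 * game_value k \<sigma> (t + \<tau>, Y) \<le> game_value k \<sigma> (t + \<tau>1, Y1)"
    using Y(4) by (simp add: I2_def e2_def)
  have c: "continuous_on {t..} (flow k t Y)" by (rule flow_continuous[OF Y(1) t])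
  have "integral {t..t + \<tau>} (flow k t Y) = I1 + integral {t + \<tau>1..t + \<tau>} (flow k t Y)"
    unfolding I1_def using \<tau>
    by (intro Henstock_Kurzweil_Integration.integral_combine[symmetric] integrable_continuous_real continuous_on_subset[OF c]) auto
  also have "integral {t + \<tau>1..t + \<tau>} (flow k t Y) = integral {t + \<tau>1..t + \<tau>} (\<lambda>s. e1 * flow k (t + \<tau>1) Y s)"
    using flow_shift[OF Y(1) t, of "t + \<tau>1" _ k] \<tau> by (intro integral_cong) (simp add: e1_def)
  also have "\<dots> = e1 * I2" by (simp add: I2_def)
  finally have I: "integral {t..t + \<tau>} (flow k t Y) = I1 + e1 * I2" .
  have nonneg: "0 \<le> integral {a..b} (flow k a Y)" if "0 \<le> a" for a b
    by (intro integral_nonneg integrable_continuous_real continuous_on_subset[OF flow_continuous[OF Y(1) that]])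
      (auto simp: flow_pos[OF Y(1)] less_imp_le)
  have I0: "I1 \<ge> 0" "I2 \<ge> 0"
    unfolding I1_def I2_def using t \<tau> by (auto intro!: nonneg)
  have e: "exp (- r * \<tau> - cum_hazard lam Y t (t + \<tau>)) = e1 * e2"
    using cum_hazard_add[OF Y(1) t, of "t + \<tau>1" "t + \<tau>"] \<tau> by (simp add: e1_def e2_def exp_add[symmetric] algebra_simps)
  show ?thesis
  proof (rule that[OF Y(1)])
    show "Y t = S t" using Y(2)[of t] Y1(2)[of t] t \<tau> by auto
    show "capability k (Y (t + s)) = capability k (S t) + c1 * s" if "s \<in> {0..\<tau>1}" for s
      using Y(2)[of "t + s"] Y1(3)[of "t + s"] that t by auto
    show "capability k (Y (t + s)) = capability k (S t) + c1 * \<tau>1 + c2 * (s - \<tau>1)" if "s \<in> {\<tau>1..\<tau>}" for s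
      using Y(3)[of "t + s"] Y1(3)[of "t + \<tau>1"] that t \<tau> by auto
    have "ennreal (I1 + e1 * I2) + ennreal (e1 * e2) * game_value k \<sigma> (t + \<tau>, Y)
      = ennreal I1 + ennreal e1 * (ennreal I2 + ennreal e2 * game_value k \<sigma> (t + \<tau>, Y))"
      using I0 by (simp add: e1_def e2_def ennreal_mult distrib_left mult.assoc add.assoc)
    also have "\<dots> \<le> ennreal I1 + ennreal e1 * game_value k \<sigma> (t + \<tau>1, Y1)"
      by (intro add_left_mono mult_left_mono 2) simp
    also note 1
    finally show "ennreal (integral {t..t + \<tau>} (flow k t Y)) + ennreal (exp (- r * \<tau> - cum_hazard lam Y t (t + \<tau>))) *
       game_value k \<sigma> (t + \<tau>, Y) \<le> game_value k \<sigma> (t, S)" unfolding I e .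
  qed
qed

text \<open>Wider than ties because a phase of following the threshold ends with the firm on it and
  the rival at most level; the induction has to restart from there, in any equilibrium and after any
  history. The unit is the flow of a tie on the threshold.\<close>

definition guaranteed :: "real \<Rightarrow> bool" where
  "guaranteed V \<longleftrightarrow> (\<forall>\<sigma> t S k. spe \<alpha> \<beta> r g lam \<sigma> \<longrightarrow> feasible_history g (t, S) \<longrightarrow>
     capability k (S t) = snd (snd (S t)) \<longrightarrow> capability (other k) (S t) \<le> snd (snd (S t)) \<longrightarrow>
     ennreal (exp ((\<alpha> - \<beta>) * snd (snd (S t))) * V) \<le> game_value k \<sigma> (t, S))"

lemma guaranteed_race_value: "guaranteed R0"
  unfolding guaranteed_def
proof (intro allI impI)
  fix \<sigma> t S k
  assume \<sigma>: "spe \<alpha> \<beta> r g lam \<sigma>" and h: "feasible_history g (t, S)"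
    and S: "capability k (S t) = snd (snd (S t))" "capability (other k) (S t) \<le> snd (snd (S t))"
  have "exposure (S t) \<le> 0" using S by (simp add: exposure_capability[of _ k])
  from race_guarantee[OF \<sigma> h this, of k]
  have "ennreal (exp (\<alpha> * capability k (S t) - \<beta> * capability (other k) (S t)) * R0) \<le> game_value k \<sigma> (t, S)" .
  moreover have "exp ((\<alpha> - \<beta>) * snd (snd (S t))) * R0 \<le> exp (\<alpha> * capability k (S t) - \<beta> * capability (other k) (S t)) * R0"
    using S(2) \<beta>_pos race_value_pos by (intro mult_right_mono) (auto simp: S(1) algebra_simps)
  ultimately show "ennreal (exp ((\<alpha> - \<beta>) * snd (snd (S t))) * R0) \<le> game_value k \<sigma> (t, S)"
    by (meson ennreal_leI order_trans)
qed


abbreviation "\<Gamma> \<equiv> pause_hazard g lam"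
abbreviation "catch \<equiv> catch_time g"
abbreviation "follow \<equiv> follow_time g"

text \<open>A rival at c needs this long to close the distance \<open>g * \<epsilon>\<close> to the
  threshold, on which it gains 1 - g per unit of time. It is the sum of the catch and follow phases
  of the benchmark.\<close>

definition tie_time :: "real \<Rightarrow> real" where
  "tie_time \<epsilon> = g * \<epsilon> / (1 - g)"

lemma catch_follow: "catch \<epsilon> + follow \<epsilon> = tie_time \<epsilon>"
proof -
  have g0: "g \<noteq> 0" "1 - g \<noteq> 0" using g by auto
  have "(1 - g) / g + (2 * g - 1) / (g * (1 - g)) = ((1 - g) * (1 - g) + (2 * g - 1)) / (g * (1 - g))"
    using g0 by (simp add: add_divide_distrib)
  also have "(1 - g) * (1 - g) + (2 * g - 1) = g * g" by (simp add: algebra_simps)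
  also have "g * g / (g * (1 - g)) = g / (1 - g)" using g0 by simp
  finally have "((1 - g) / g + (2 * g - 1) / (g * (1 - g))) * \<epsilon> = g / (1 - g) * \<epsilon>" by simp
  then show ?thesis by (simp add: catch_time_def follow_time_def tie_time_def distrib_right)
qed

lemma lamhat_integrable': "lamhat integrable_on {a..b}"
  by (intro integrable_continuous_real lamhat_continuous)

definition lamhat_integral :: "real \<Rightarrow> real" where
  "lamhat_integral x = integral {0..x} lamhat"

lemma lamhat_integral_has_derivative:
  assumes "0 \<le> x"
  shows "(lamhat_integral has_real_derivative lamhat x) (at x within {0..})"
proof -
  have "((\<lambda>u. integral {0..u} lamhat) has_real_derivative lamhat x) (at x within {0..x + 1})"
    by (rule integral_has_real_derivative) (use assms in \<open>auto intro: lamhat_continuous\<close>)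
  moreover have "at x within {0..x + 1} = at x within {0..}"
    by (rule at_within_nhd[of x "{x - 1<..<x + 1}"]) auto
  ultimately show ?thesis by (simp add: lamhat_integral_def[abs_def])
qed

lemma lamhat_integral_continuous: "continuous_on {0..} lamhat_integral"
  using lamhat_integral_has_derivative by (intro DERIV_continuous_on) auto

lemma pause_hazard_eq:
  assumes "\<epsilon> > 0" "0 \<le> s"
  shows "\<Gamma> \<epsilon> s = (lamhat_integral ((1 - g) * \<epsilon>) - lamhat_integral (max 0 ((1 - g) * \<epsilon> - g * s))) / g"
proof -
  let ?m = "(1 - g) * \<epsilon>" and ?l = "max 0 ((1 - g) * \<epsilon> - g * s)"
  have m: "0 \<le> ?l" "?l \<le> ?m" using assms g by auto
  have "integral {?l..?m} lam = integral {?l..?m} lamhat"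
    by (rule integral_spike[of "{0}"]) (use m in \<open>auto simp: lamhat_eq\<close>)
  moreover have "lamhat_integral ?l + integral {?l..?m} lamhat = lamhat_integral ?m"
    unfolding lamhat_integral_def by (intro Henstock_Kurzweil_Integration.integral_combine m lamhat_integrable')
  ultimately show ?thesis by (simp add: pause_hazard_def)
qed

lemma pause_hazard_continuous:
  assumes "\<epsilon> > 0"
  shows "continuous_on {0..} (\<Gamma> \<epsilon>)"
proof -
  have "continuous_on {0..} (\<lambda>s. (lamhat_integral ((1 - g) * \<epsilon>) - lamhat_integral (max 0 ((1 - g) * \<epsilon> - g * s))) / g)"
    by (intro continuous_intros continuous_on_compose2[OF lamhat_integral_continuous]) (use g in auto)
  then show ?thesis by (rule continuous_on_eq) (simp add: pause_hazard_eq[OF assms])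
qed

lemma pause_hazard_after_catch:
  assumes "\<epsilon> > 0" "catch \<epsilon> \<le> s"
  shows "\<Gamma> \<epsilon> s = \<Gamma> \<epsilon> (catch \<epsilon>)"
proof -
  have gc: "g * catch \<epsilon> = (1 - g) * \<epsilon>" using g by (simp add: catch_time_def)
  moreover have "g * catch \<epsilon> \<le> g * s" using assms g by (intro mult_left_mono) auto
  ultimately show ?thesis by (simp add: pause_hazard_def)
qed

text \<open>Exposure that falls at rate g turns time into exposure with the factor 1 / g, and after
  the catch date nothing accrues. The inequality comes from comparing \<open>lam\<close> pointwise
  with its continuous majorant \<open>lamhat\<close>.\<close>

lemma integral_lam_le_pause_hazard:
  assumes \<epsilon>: "\<epsilon> > 0" and s: "0 \<le> s"
  shows "integral {0..s} (\<lambda>u. lam (max 0 ((1 - g) * \<epsilon> - g * u))) \<le> \<Gamma> \<epsilon> s"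
proof -
  let ?m = "(1 - g) * \<epsilon>" and ?f = "\<lambda>u. lam (max 0 ((1 - g) * \<epsilon> - g * u))"
  have int: "?f integrable_on {a..b}" for a b :: real
    by (intro lam_compose_integrable continuous_intros)
  have gc: "g * catch \<epsilon> = (1 - g) * \<epsilon>" "0 \<le> catch \<epsilon>" using g \<epsilon> by (simp_all add: catch_time_def)
  have before: "integral {0..s} ?f \<le> \<Gamma> \<epsilon> s" if s: "0 \<le> s" "s \<le> catch \<epsilon>" for s
  proof -
    have nn: "?m - g * u \<ge> 0" if "u \<in> {0..s}" for u
    proof -
      have "g * u \<le> g * catch \<epsilon>" using that s g by (intro mult_left_mono) auto
      then show ?thesis using gc by simp
    qed
    have "((\<lambda>u. lamhat (?m - g * u)) has_integral (- lamhat_integral (?m - g * s) / g - - lamhat_integral (?m - g * 0) / g)) {0..s}"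
    proof (rule fundamental_theorem_of_calculus[OF s(1)])
      fix u assume u: "u \<in> {0..s}"
      have "(lamhat_integral \<circ> (\<lambda>u. ?m - g * u) has_real_derivative lamhat (?m - g * u) * (- g)) (at u within {0..s})"
      proof (rule DERIV_image_chain)
        show "(lamhat_integral has_real_derivative lamhat (?m - g * u)) (at (?m - g * u) within (\<lambda>u. ?m - g * u) ` {0..s})"
          using nn u by (intro DERIV_subset[OF lamhat_integral_has_derivative]) auto
      qed (auto intro!: derivative_eq_intros)
      then have "((\<lambda>u. - lamhat_integral (?m - g * u) / g) has_real_derivative - (lamhat (?m - g * u) * (- g)) / g) (at u within {0..s})"
        by (intro DERIV_cdivide DERIV_minus) (simp add: o_def)
      then show "((\<lambda>u. - lamhat_integral (?m - g * u) / g) has_vector_derivative lamhat (?m - g * u)) (at u within {0..s})"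
        using g by (simp add: has_real_derivative_iff_has_vector_derivative)
    qed
    moreover have "\<Gamma> \<epsilon> s = - lamhat_integral (?m - g * s) / g - - lamhat_integral (?m - g * 0) / g"
      using nn[of s] s by (simp add: pause_hazard_eq[OF \<epsilon>] max_def diff_divide_distrib)
    ultimately have hi: "((\<lambda>u. lamhat (?m - g * u)) has_integral \<Gamma> \<epsilon> s) {0..s}" by simp
    show ?thesis
      by (rule has_integral_le[OF integrable_integral[OF int] hi]) (use nn lam_le_lamhat in \<open>auto simp: max_def\<close>)
  qed
  show ?thesis
  proof (cases "s \<le> catch \<epsilon>")
    case False
    have "integral {catch \<epsilon>..s} ?f = integral {catch \<epsilon>..s} (\<lambda>_. 0)"
    proof (rule integral_cong)
      fix u assume "u \<in> {catch \<epsilon>..s}"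
      then have "g * catch \<epsilon> \<le> g * u" using g by (intro mult_left_mono) auto
      then show "?f u = 0" using gc lam_nonpos by simp
    qed
    then have "integral {0..s} ?f = integral {0..catch \<epsilon>} ?f"
      using Henstock_Kurzweil_Integration.integral_combine[of 0 "catch \<epsilon>" s ?f] int gc(2) False by simp
    also have "\<dots> \<le> \<Gamma> \<epsilon> (catch \<epsilon>)" using before[of "catch \<epsilon>"] gc by simp
    finally show ?thesis using pause_hazard_after_catch[OF \<epsilon>, of s] False by simp
  qed (use before s in auto)
qed

text \<open>Flow of a firm that starts at c + \<epsilon>, waits for the threshold and then follows
  it, against a rival racing from c, divided by the flow of a tie at c.\<close>

definition leader_flow :: "real \<Rightarrow> real \<Rightarrow> real" where
  "leader_flow \<epsilon> s = exp (\<alpha> * max \<epsilon> (g * \<epsilon> + g * s) - (r + \<beta>) * s - \<Gamma> \<epsilon> s)"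

definition leader_value :: "real \<Rightarrow> real \<Rightarrow> real" where
  "leader_value \<epsilon> V = integral {0..tie_time \<epsilon>} (leader_flow \<epsilon>) + exp (- \<Gamma> \<epsilon> (catch \<epsilon>) - \<rho> * tie_time \<epsilon>) * V"

lemma leader_flow_continuous: "\<epsilon> > 0 \<Longrightarrow> continuous_on {0..} (leader_flow \<epsilon>)"
  unfolding leader_flow_def by (intro continuous_intros pause_hazard_continuous)

lemma leader_value_nonneg:
  assumes "\<epsilon> > 0" "V \<ge> 0"
  shows "leader_value \<epsilon> V \<ge> 0"
proof -
  have "integral {0..tie_time \<epsilon>} (leader_flow \<epsilon>) \<ge> 0"
    by (intro integral_nonneg integrable_continuous_real continuous_on_subset[OF leader_flow_continuous[OF assms(1)]])
      (auto simp: leader_flow_def)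
  then show ?thesis using assms(2) by (simp add: leader_value_def)
qed

text \<open>The two branches of the maximum cross at the catch date, after which no hazard accrues;
  g > 1/2 puts that date before the tie.\<close>

lemma leader_value_eq_L2:
  assumes \<epsilon>: "\<epsilon> > 0" and half: "g > 1 / 2"
  shows "leader_value \<epsilon> V = L2 \<alpha> \<beta> r g lam \<epsilon> + exp (- \<Gamma> \<epsilon> (catch \<epsilon>) - (r - \<alpha> + \<beta>) * (catch \<epsilon> + follow \<epsilon>)) * (V - R0)"
proof -
  let ?T = "catch \<epsilon>" and ?E = "catch \<epsilon> + follow \<epsilon>"
  have T: "0 \<le> ?T" "?T \<le> ?E" using \<epsilon> half g by (auto simp: catch_time_def follow_time_def)
  have gT: "g * ?T = (1 - g) * \<epsilon>" using g by (simp add: catch_time_def)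
  have c: "continuous_on {0..?E} (leader_flow \<epsilon>)" by (rule continuous_on_subset[OF leader_flow_continuous[OF \<epsilon>]]) auto
  have "integral {0..?E} (leader_flow \<epsilon>) = integral {0..?T} (leader_flow \<epsilon>) + integral {?T..?E} (leader_flow \<epsilon>)"
    using T by (intro Henstock_Kurzweil_Integration.integral_combine[symmetric] integrable_continuous_real c)
  also have "integral {0..?T} (leader_flow \<epsilon>) = integral {0..?T} (\<lambda>s. exp (\<alpha> * \<epsilon>) * exp (- (r + \<beta>) * s - \<Gamma> \<epsilon> s))"
  proof (rule integral_cong)
    fix s assume "s \<in> {0..?T}"
    then have "g * s \<le> g * ?T" using g by (intro mult_left_mono) auto
    then have "max \<epsilon> (g * \<epsilon> + g * s) = \<epsilon>" using gT by (simp add: algebra_simps)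
    then show "leader_flow \<epsilon> s = exp (\<alpha> * \<epsilon>) * exp (- (r + \<beta>) * s - \<Gamma> \<epsilon> s)"
      by (simp add: leader_flow_def exp_add[symmetric] algebra_simps)
  qed
  also have "integral {?T..?E} (leader_flow \<epsilon>) = integral {?T..?E} (\<lambda>s. exp (\<alpha> * g * \<epsilon> - \<Gamma> \<epsilon> ?T) * exp (- (r + \<beta> - \<alpha> * g) * s))"
  proof (rule integral_cong)
    fix s assume s: "s \<in> {?T..?E}"
    then have "g * ?T \<le> g * s" using g by (intro mult_left_mono) auto
    then have "max \<epsilon> (g * \<epsilon> + g * s) = g * \<epsilon> + g * s" using gT by (simp add: algebra_simps)
    then show "leader_flow \<epsilon> s = exp (\<alpha> * g * \<epsilon> - \<Gamma> \<epsilon> ?T) * exp (- (r + \<beta> - \<alpha> * g) * s)"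
      using pause_hazard_after_catch[OF \<epsilon>, of s] s by (simp add: leader_flow_def exp_add[symmetric] algebra_simps)
  qed
  finally show ?thesis
    by (simp add: leader_value_def L2_def Let_def catch_follow[symmetric] \<rho>_def algebra_simps)
qed

text \<open>A firm that is ahead by at most \<open>\<epsilon>\<close> first moves onto the safety threshold (waiting or racing) and
  then follows it; the rival cannot reach the threshold before \<open>tie_time\<close>.\<close>

lemma leader_guarantee:
  assumes V: "guaranteed V" "V \<ge> 0" and half: "g > 1 / 2" and \<epsilon>: "\<epsilon> > 0"
    and \<sigma>: "spe \<alpha> \<beta> r g lam \<sigma>" and h: "feasible_history g (t, S)"
    and X: "snd (snd (S t)) = c + g * \<epsilon>" and k: "capability k (S t) \<in> {c..c + \<epsilon>}"
    and l: "capability (other k) (S t) \<le> c"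
  shows "ennreal (exp (\<alpha> * (capability k (S t) - \<epsilon>) - \<beta> * c) * leader_value \<epsilon> V) \<le> game_value k \<sigma> (t, S)"
proof -
  have t: "t \<ge> 0" using h by (simp add: feasible_history_iff[OF g])
  define A where "A = capability k (S t)"
  define \<tau> where "\<tau> = tie_time \<epsilon>"
  \<comment> \<open>A firm past the threshold waits for it and a firm short of it races to it;
    \<open>\<tau>1\<close> is the time until they meet.\<close>
  define pace where "pace = (if A \<ge> c + g * \<epsilon> then 0 else 1 :: real)"
  define \<tau>1 where "\<tau>1 = (if A \<ge> c + g * \<epsilon> then (A - (c + g * \<epsilon>)) / g else (c + g * \<epsilon> - A) / (1 - g))"
  have A: "c \<le> A" "A \<le> c + \<epsilon>" using k by (auto simp: A_def)
  have g\<tau>: "(1 - g) * \<tau> = g * \<epsilon>" using g by (simp add: \<tau>_def tie_time_def)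
  have \<tau>0: "\<tau> \<ge> 0" using g \<epsilon> by (simp add: \<tau>_def tie_time_def)
  have p01: "pace \<in> {0..1}" by (simp add: pace_def)
  have catch_le: "catch \<epsilon> \<le> \<tau>"
  proof -
    have "follow \<epsilon> \<ge> 0"
      unfolding follow_time_def using \<epsilon> half g by (intro mult_nonneg_nonneg divide_nonneg_nonneg) auto
    then show ?thesis using catch_follow[of \<epsilon>] by (simp add: \<tau>_def)
  qed
  have \<tau>1: "0 \<le> \<tau>1" "\<tau>1 \<le> \<tau>" "pace * \<tau>1 + A - g * \<tau>1 = c + g * \<epsilon>"
    and wait: "A \<ge> c + g * \<epsilon> \<Longrightarrow> g * \<tau>1 = A - (c + g * \<epsilon>)" and race: "A < c + g * \<epsilon> \<Longrightarrow> (1 - g) * \<tau>1 = c + g * \<epsilon> - A"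
  proof -
    show wait: "A \<ge> c + g * \<epsilon> \<Longrightarrow> g * \<tau>1 = A - (c + g * \<epsilon>)" and race: "A < c + g * \<epsilon> \<Longrightarrow> (1 - g) * \<tau>1 = c + g * \<epsilon> - A"
      using g by (simp_all add: \<tau>1_def)
    show "0 \<le> \<tau>1" using g by (simp add: \<tau>1_def)
    show "\<tau>1 \<le> \<tau>"
    proof (cases "A \<ge> c + g * \<epsilon>")
      case True
      then have "\<tau>1 \<le> ((1 - g) * \<epsilon>) / g" using A g unfolding \<tau>1_def by (auto intro!: divide_right_mono simp: algebra_simps)
      also have "\<dots> = catch \<epsilon>" by (simp add: catch_time_def)
      finally show ?thesis using catch_le by simp
    next
      case False
      then have "\<tau>1 \<le> (g * \<epsilon>) / (1 - g)" using A g unfolding \<tau>1_def by (auto intro!: divide_right_mono)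
      then show ?thesis by (simp add: \<tau>_def tie_time_def)
    qed
    show "pace * \<tau>1 + A - g * \<tau>1 = c + g * \<epsilon>"
      using wait race by (cases "A \<ge> c + g * \<epsilon>") (auto simp: pace_def algebra_simps)
  qed
  obtain Y where Y: "bounded_speed g {0..} Y" and Yt: "Y t = S t"
    and cap1: "\<And>s. s \<in> {0..\<tau>1} \<Longrightarrow> capability k (Y (t + s)) = capability k (S t) + pace * s"
    and cap2: "\<And>s. s \<in> {\<tau>1..\<tau>} \<Longrightarrow> capability k (Y (t + s)) = capability k (S t) + pace * \<tau>1 + g * (s - \<tau>1)"
    and val: "ennreal (integral {t..t + \<tau>} (flow k t Y)) + ennreal (exp (- r * \<tau> - cum_hazard lam Y t (t + \<tau>))) *
       game_value k \<sigma> (t + \<tau>, Y) \<le> game_value k \<sigma> (t, S)"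
  proof (rule spe_two_phase_value_step[OF \<sigma> h p01 _ \<tau>1(1,2), of g k])
    show "g \<in> {0..1}" using g by simp
  qed blast
  have pos: "snd (snd (Y (t + s))) = c + g * \<epsilon> + g * s" if "0 \<le> s" for s
    using position_increment[OF Y, of t "t + s"] that t X by (simp add: Yt)
  have rival: "capability (other k) (Y (t + s)) \<le> c + s" if "0 \<le> s" for s
    using capability_increment[OF Y, of t "t + s" "other k"] that t l by (simp add: Yt)
  have after: "capability k (Y (t + s)) = c + g * \<epsilon> + g * s" if "s \<in> {\<tau>1..\<tau>}" for s
    using cap2[OF that] \<tau>1(3) by (simp add: A_def algebra_simps)
  \<comment> \<open>Both bounds are attained for the extreme start A = c + \<epsilon>. For smaller A
    the capability bound is shifted down by c + \<epsilon> - A, while the exposure bound is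
    kept.\<close>
  have lead: "A - \<epsilon> + max \<epsilon> (g * \<epsilon> + g * s) \<le> capability k (Y (t + s))"
    and safe: "capability k (Y (t + s)) - snd (snd (Y (t + s))) \<le> max 0 ((1 - g) * \<epsilon> - g * s)"
    if s: "s \<in> {0..\<tau>}" for s
  proof -
    have "A - \<epsilon> + max \<epsilon> (g * \<epsilon> + g * s) \<le> capability k (Y (t + s)) \<and>
      capability k (Y (t + s)) - snd (snd (Y (t + s))) \<le> max 0 ((1 - g) * \<epsilon> - g * s)"
    proof (cases "s \<le> \<tau>1")
      case True
      then have cs: "capability k (Y (t + s)) = A + pace * s" using cap1[of s] s by (simp add: A_def)
      show ?thesis
      proof (cases "A \<ge> c + g * \<epsilon>")
        case w: True
        have "g * s \<le> g * \<tau>1" using True g by (intro mult_left_mono) auto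
        then have "g * s \<le> A - (c + g * \<epsilon>)" using wait[OF w] by simp
        then show ?thesis using A cs w pos[of s] s by (auto simp: pace_def algebra_simps)
      next
        case w: False
        have "(1 - g) * s \<le> (1 - g) * \<tau>1" using True g by (intro mult_left_mono) auto
        then have "(1 - g) * s \<le> c + g * \<epsilon> - A" using race w by simp
        moreover have "0 \<le> (1 - g) * s" "0 \<le> (1 - g) * \<epsilon>" using g s \<epsilon> by auto
        ultimately show ?thesis using cs w pos[of s] s by (auto simp: pace_def algebra_simps)
      qed
    next
      case False
      then have cs: "capability k (Y (t + s)) = c + g * \<epsilon> + g * s" using after[of s] s by auto
      moreover have "A \<le> c + g * \<epsilon> + g * s"
      proof (cases "A \<ge> c + g * \<epsilon>")
        case w: True
        have "g * \<tau>1 \<le> g * s" using False g by (intro mult_left_mono) auto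
        then show ?thesis using wait[OF w] by simp
      next
        case w: False
        have "0 \<le> g * s" using g s by auto
        then show ?thesis using w by simp
      qed
      ultimately show ?thesis using A pos[of s] s by auto
    qed
    then show "A - \<epsilon> + max \<epsilon> (g * \<epsilon> + g * s) \<le> capability k (Y (t + s))"
      "capability k (Y (t + s)) - snd (snd (Y (t + s))) \<le> max 0 ((1 - g) * \<epsilon> - g * s)" by auto
  qed
  have hazard: "cum_hazard lam Y t (t + s) \<le> \<Gamma> \<epsilon> s" if s: "s \<in> {0..\<tau>}" for s
  proof -
    have "cum_hazard lam Y t (t + s) \<le> integral {t..t + s} (\<lambda>v. lam (max 0 ((1 - g) * \<epsilon> - g * (v - t))))"
    proof (rule cum_hazard_le[OF Y t])
      show "(\<lambda>v. lam (max 0 ((1 - g) * \<epsilon> - g * (v - t)))) integrable_on {t..t + s}"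
        by (intro lam_compose_integrable continuous_intros)
    next
      fix v assume v: "v \<in> {t..t + s}"
      define u where "u = v - t"
      have u: "v = t + u" "u \<in> {0..\<tau>}" using v s by (auto simp: u_def)
      \<comment> \<open>Up to the tie date the rival is not above the threshold, so exposure is
        controlled by the firm alone.\<close>
      have "(1 - g) * u \<le> (1 - g) * \<tau>" using u g by (intro mult_left_mono) auto
      then have "capability (other k) (Y v) - snd (snd (Y v)) \<le> 0"
        using rival[of u] pos[of u] u g\<tau> by (auto simp: algebra_simps)
      then have "exposure (Y v) \<le> max 0 ((1 - g) * \<epsilon> - g * u)"
        using safe[OF u(2)] u(1) by (auto simp: exposure_capability[of _ k])
      then show "lam (exposure (Y v)) \<le> lam (max 0 ((1 - g) * \<epsilon> - g * (v - t)))"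
        by (intro lam_mono) (simp add: u_def)
    qed
    also have "\<dots> = integral {0..s} (\<lambda>u. lam (max 0 ((1 - g) * \<epsilon> - g * u)))"
      using integral_shift_real_ivl[of t t "t + s" "\<lambda>v. lam (max 0 ((1 - g) * \<epsilon> - g * (v - t)))"] by simp
    also have "\<dots> \<le> \<Gamma> \<epsilon> s" using s by (intro integral_lam_le_pause_hazard \<epsilon>) auto
    finally show ?thesis .
  qed
  define E where "E = exp (\<alpha> * (A - \<epsilon>) - \<beta> * c)"
  have "integral {0..\<tau>} (\<lambda>s. E * leader_flow \<epsilon> s) \<le> integral {t..t + \<tau>} (flow k t Y)"
  proof (rule flow_integral_ge[OF Y t])
    show "continuous_on {0..\<tau>} (\<lambda>s. E * leader_flow \<epsilon> s)"
      by (intro continuous_intros continuous_on_subset[OF leader_flow_continuous[OF \<epsilon>]]) auto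
    fix s assume s: "s \<in> {0..\<tau>}"
    have "\<alpha> * (A - \<epsilon> + max \<epsilon> (g * \<epsilon> + g * s)) \<le> \<alpha> * capability k (Y (t + s))"
      using lead[OF s] \<alpha>_gt_\<beta> \<beta>_pos by (intro mult_left_mono) auto
    moreover have "\<beta> * capability (other k) (Y (t + s)) \<le> \<beta> * (c + s)"
      using rival[of s] s \<beta>_pos by (intro mult_left_mono) auto
    ultimately show "E * leader_flow \<epsilon> s \<le> flow k t Y (t + s)"
      using hazard[OF s] by (simp add: E_def leader_flow_def flow_def exp_add[symmetric] algebra_simps)
  qed
  then have I: "E * integral {0..\<tau>} (leader_flow \<epsilon>) \<le> integral {t..t + \<tau>} (flow k t Y)" by simp
  have h': "feasible_history g (t + \<tau>, Y)"
    using Y t \<tau>0 by (auto simp: feasible_history_iff[OF g] intro: bounded_speed_subset)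
  have end_pos: "snd (snd (Y (t + \<tau>))) = c + \<tau>" using pos[OF \<tau>0] g\<tau> by (simp add: algebra_simps)
  have "capability k (Y (t + \<tau>)) = c + \<tau>" using after[of \<tau>] \<tau>1 g\<tau> by (simp add: algebra_simps)
  \<comment> \<open>At the tie date the firm is on the threshold c + \<tau> with the rival at most
    level, so the guarantee V applies to the history reached.\<close>
  then have tail: "ennreal (exp ((\<alpha> - \<beta>) * (c + \<tau>)) * V) \<le> game_value k \<sigma> (t + \<tau>, Y)"
    using V(1) \<sigma> h' rival[OF \<tau>0] end_pos unfolding guaranteed_def by metis
  have "cum_hazard lam Y t (t + \<tau>) \<le> \<Gamma> \<epsilon> (catch \<epsilon>)"
    using hazard[of \<tau>] \<tau>0 pause_hazard_after_catch[OF \<epsilon> catch_le] by simp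
  \<comment> \<open>The final position is the same for every A; bounding A - \<epsilon> by c brings
    the tail under the common factor E.\<close>
  moreover have "\<alpha> * (A - \<epsilon>) \<le> \<alpha> * c" using A \<alpha>_gt_\<beta> \<beta>_pos by (intro mult_left_mono) auto
  ultimately have "E * exp (- \<Gamma> \<epsilon> (catch \<epsilon>) - \<rho> * \<tau>) \<le> exp (- r * \<tau> - cum_hazard lam Y t (t + \<tau>)) * exp ((\<alpha> - \<beta>) * (c + \<tau>))"
    by (simp add: E_def exp_add[symmetric] \<rho>_def algebra_simps)
  then have T: "E * exp (- \<Gamma> \<epsilon> (catch \<epsilon>) - \<rho> * \<tau>) * V \<le> exp (- r * \<tau> - cum_hazard lam Y t (t + \<tau>)) * (exp ((\<alpha> - \<beta>) * (c + \<tau>)) * V)"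
    unfolding mult.assoc[symmetric] by (rule mult_right_mono[OF _ V(2)])
  have nn: "0 \<le> E * integral {0..\<tau>} (leader_flow \<epsilon>)"
    unfolding E_def
    by (intro mult_nonneg_nonneg integral_nonneg integrable_continuous_real continuous_on_subset[OF leader_flow_continuous[OF \<epsilon>]])
      (auto simp: leader_flow_def)
  have "ennreal (E * leader_value \<epsilon> V) = ennreal (E * integral {0..\<tau>} (leader_flow \<epsilon>) + E * exp (- \<Gamma> \<epsilon> (catch \<epsilon>) - \<rho> * \<tau>) * V)"
    by (simp add: leader_value_def \<tau>_def distrib_left mult.assoc)
  also have "\<dots> \<le> ennreal (integral {t..t + \<tau>} (flow k t Y) + exp (- r * \<tau> - cum_hazard lam Y t (t + \<tau>)) * (exp ((\<alpha> - \<beta>) * (c + \<tau>)) * V))"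
    using I T by (intro ennreal_leI) simp
  also have "\<dots> = ennreal (integral {t..t + \<tau>} (flow k t Y)) + ennreal (exp (- r * \<tau> - cum_hazard lam Y t (t + \<tau>))) * ennreal (exp ((\<alpha> - \<beta>) * (c + \<tau>)) * V)"
    using I nn V(2) by (subst ennreal_plus) (auto simp: ennreal_mult)
  also have "\<dots> \<le> ennreal (integral {t..t + \<tau>} (flow k t Y)) + ennreal (exp (- r * \<tau> - cum_hazard lam Y t (t + \<tau>))) * game_value k \<sigma> (t + \<tau>, Y)"
    by (intro add_left_mono mult_left_mono tail) simp
  also note val
  finally show ?thesis by (simp add: E_def A_def)
qed

text \<open>The firm pauses for \<open>\<epsilon>\<close>. If the rival has overtaken it, the rival's leader guarantee carries over
  through the payoff ratio along a common path; otherwise the firm is itself the leader.\<close>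

lemma guaranteed_step:
  assumes V: "guaranteed V" "V \<ge> 0" and half: "g > 1 / 2" and r: "r > \<alpha>" and \<epsilon>: "\<epsilon> > 0"
  shows "guaranteed (L1 \<alpha> \<beta> r g lam \<epsilon> + q \<alpha> \<beta> r g lam \<epsilon> * (V - R0))"
  unfolding guaranteed_def
proof (intro allI impI)
  fix \<sigma> t S k
  assume \<sigma>: "spe \<alpha> \<beta> r g lam \<sigma>" and h: "feasible_history g (t, S)"
    and S: "capability k (S t) = snd (snd (S t))" "capability (other k) (S t) \<le> snd (snd (S t))"
  have st: "is_strategy g (\<sigma> i)" for i using \<sigma> by (simp add: spe_def)
  define x where "x = snd (snd (S t))"
  define p where "p = (r - \<alpha>) / (r + \<beta>)"
  define Lv where "Lv = leader_value \<epsilon> V"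
  have p: "0 \<le> p" "p \<le> 1" using r \<alpha>_gt_\<beta> \<beta>_pos by (auto simp: p_def)
  have Lv: "Lv \<ge> 0" unfolding Lv_def by (rule leader_value_nonneg[OF \<epsilon> V(2)])
  have t: "t \<ge> 0" using h by (simp add: feasible_history_iff[OF g])
  obtain Y where Y: "bounded_speed g {0..} Y" and YS: "\<And>s. s \<in> {0..t} \<Longrightarrow> Y s = S s"
    and cap: "\<And>s. s \<in> {t..t + \<epsilon>} \<Longrightarrow> capability k (Y s) = capability k (S t) + 0 * (s - t)"
    and val: "ennreal (integral {t..t + \<epsilon>} (flow k t Y)) + ennreal (exp (- r * \<epsilon> - cum_hazard lam Y t (t + \<epsilon>))) *
       game_value k \<sigma> (t + \<epsilon>, Y) \<le> game_value k \<sigma> (t, S)"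
  proof (rule spe_hold_value_step[OF \<sigma> h, of 0 \<epsilon> k])
    show "0 \<in> {0..1::real}" "0 \<le> \<epsilon>" using \<epsilon> by auto
  qed blast
  have Yt: "Y t = S t" using YS t by simp
  have h': "feasible_history g (t + \<epsilon>, Y)"
    using Y t \<epsilon> by (auto simp: feasible_history_iff[OF g] intro: bounded_speed_subset)
  have safe: "exposure (Y t) \<le> 0" using S by (simp add: Yt exposure_capability[of _ k])
  have hazard: "cum_hazard lam Y t (t + s) \<le> \<Lambda> s" if "0 \<le> s" for s
    by (rule race_cum_hazard_le[OF Y t that safe])
  have rival: "capability (other k) (Y (t + s)) \<le> x + s" if "0 \<le> s" for s
    using capability_increment[OF Y, of t "t + s" "other k"] that t S by (simp add: Yt x_def)
  have ck: "capability k (Y (t + \<epsilon>)) = x" using cap[of "t + \<epsilon>"] \<epsilon> S by (simp add: x_def)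
  have X: "snd (snd (Y (t + \<epsilon>))) = x + g * \<epsilon>"
    using position_increment[OF Y, of t "t + \<epsilon>"] t \<epsilon> by (simp add: Yt x_def)
  define E where "E = exp ((\<alpha> - \<beta>) * x)"
  define J where "J = integral {0..\<epsilon>} (\<lambda>s. exp (- (r + \<beta>) * s - \<Lambda> s))"
  have cJ: "continuous_on {0..\<epsilon>} (\<lambda>s. exp (- (r + \<beta>) * s - \<Lambda> s))"
    by (intro continuous_intros continuous_on_subset[OF race_hazard_continuous]) auto
  have "integral {0..\<epsilon>} (\<lambda>s. E * exp (- (r + \<beta>) * s - \<Lambda> s)) \<le> integral {t..t + \<epsilon>} (flow k t Y)"
  proof (rule flow_integral_ge[OF Y t])
    show "continuous_on {0..\<epsilon>} (\<lambda>s. E * exp (- (r + \<beta>) * s - \<Lambda> s))" by (intro continuous_on_mult_left cJ)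
    fix s assume s: "s \<in> {0..\<epsilon>}"
    have "\<beta> * capability (other k) (Y (t + s)) \<le> \<beta> * (x + s)"
      using rival[of s] s \<beta>_pos by (intro mult_left_mono) auto
    moreover have "capability k (Y (t + s)) = x" using cap[of "t + s"] s S by (simp add: x_def)
    ultimately show "E * exp (- (r + \<beta>) * s - \<Lambda> s) \<le> flow k t Y (t + s)"
      using hazard[of s] s by (simp add: E_def flow_def exp_add[symmetric] algebra_simps)
  qed
  then have I: "E * J \<le> integral {t..t + \<epsilon>} (flow k t Y)" by (simp add: J_def)
  have J0: "J \<ge> 0" unfolding J_def by (intro integral_nonneg integrable_continuous_real cJ) auto
  \<comment> \<open>One bound serves both cases; the binding one is a rival that raced throughout
    and is ahead by the full \<epsilon>.\<close>
  have cont: "ennreal (E * (p * exp (- (\<alpha> + \<beta>) * \<epsilon>) * Lv)) \<le> game_value k \<sigma> (t + \<epsilon>, Y)"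
  proof (cases "capability (other k) (Y (t + \<epsilon>)) \<ge> x")
    case True
    define y where "y = capability (other k) (Y (t + \<epsilon>))"
    have y: "x \<le> y" "y \<le> x + \<epsilon>" using True rival[of \<epsilon>] \<epsilon> by (auto simp: y_def)
    have lead: "ennreal (exp (\<alpha> * (y - \<epsilon>) - \<beta> * x) * Lv) \<le> game_value (other k) \<sigma> (t + \<epsilon>, Y)"
      using leader_guarantee[OF V half \<epsilon> \<sigma> h', of x "other k"] X y ck by (simp add: y_def Lv_def)
    have "E * (p * exp (- (\<alpha> + \<beta>) * \<epsilon>) * Lv) \<le> (p * exp (- (\<alpha> + \<beta>) * (y - x))) * (exp (\<alpha> * (y - \<epsilon>) - \<beta> * x) * Lv)"
    proof -
      \<comment> \<open>The exponents combine to
        \<open>\<alpha> * x - \<beta> * y - \<alpha> * \<epsilon>\<close>, which is smallest at y =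
        x + \<epsilon>.\<close>
      have "\<beta> * y \<le> \<beta> * (x + \<epsilon>)" using y \<beta>_pos by (intro mult_left_mono) auto
      then have "E * exp (- (\<alpha> + \<beta>) * \<epsilon>) \<le> exp (- (\<alpha> + \<beta>) * (y - x)) * exp (\<alpha> * (y - \<epsilon>) - \<beta> * x)"
        by (simp add: E_def exp_add[symmetric] algebra_simps)
      then have "(p * Lv) * (E * exp (- (\<alpha> + \<beta>) * \<epsilon>)) \<le> (p * Lv) * (exp (- (\<alpha> + \<beta>) * (y - x)) * exp (\<alpha> * (y - \<epsilon>) - \<beta> * x))"
        using p Lv by (intro mult_left_mono) auto
      then show ?thesis by (simp only: mult_ac)
    qed
    then have "ennreal (E * (p * exp (- (\<alpha> + \<beta>) * \<epsilon>) * Lv)) \<le> ennreal ((p * exp (- (\<alpha> + \<beta>) * (y - x))) * (exp (\<alpha> * (y - \<epsilon>) - \<beta> * x) * Lv))"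
      by (rule ennreal_leI)
    also have "\<dots> = ennreal (p * exp (- (\<alpha> + \<beta>) * (y - x))) * ennreal (exp (\<alpha> * (y - \<epsilon>) - \<beta> * x) * Lv)"
      using p Lv by (intro ennreal_mult) auto
    also have "\<dots> \<le> ennreal (p * exp (- (\<alpha> + \<beta>) * (y - x))) * game_value (other k) \<sigma> (t + \<epsilon>, Y)"
      by (intro mult_left_mono lead) simp
    also have "\<dots> \<le> game_value k \<sigma> (t + \<epsilon>, Y)"
      using game_value_ratio[of \<sigma>, OF st h' r, of k] ck by (simp add: y_def p_def)
    finally show ?thesis .
  next
    case False
    have lead: "ennreal (exp (\<alpha> * (x - \<epsilon>) - \<beta> * x) * Lv) \<le> game_value k \<sigma> (t + \<epsilon>, Y)"
      using leader_guarantee[OF V half \<epsilon> \<sigma> h', of x k] X False ck \<epsilon> by (simp add: Lv_def)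
    have "E * (p * exp (- (\<alpha> + \<beta>) * \<epsilon>) * Lv) \<le> exp (\<alpha> * (x - \<epsilon>) - \<beta> * x) * Lv"
    proof -
      have "exp (- (\<alpha> + \<beta>) * \<epsilon>) \<le> exp (- \<alpha> * \<epsilon>)"
        using \<epsilon> \<beta>_pos by (simp add: algebra_simps)
      then have "E * (p * exp (- (\<alpha> + \<beta>) * \<epsilon>)) \<le> E * (1 * exp (- \<alpha> * \<epsilon>))"
        using p by (intro mult_left_mono mult_mono) (auto simp: E_def)
      also have "\<dots> = exp (\<alpha> * (x - \<epsilon>) - \<beta> * x)" by (simp add: E_def exp_add[symmetric] algebra_simps)
      finally have "E * (p * exp (- (\<alpha> + \<beta>) * \<epsilon>)) * Lv \<le> exp (\<alpha> * (x - \<epsilon>) - \<beta> * x) * Lv" by (rule mult_right_mono[OF _ Lv])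
      then show ?thesis by (simp only: mult_ac)
    qed
    then show ?thesis using lead by (meson ennreal_leI order_trans)
  qed
  define D where "D = exp (- r * \<epsilon> - cum_hazard lam Y t (t + \<epsilon>))"
  define N where "N = p * exp (- (\<alpha> + \<beta>) * \<epsilon>) * Lv"
  have N0: "N \<ge> 0" using p Lv by (simp add: N_def)
  have D: "exp (- r * \<epsilon> - \<Lambda> \<epsilon>) \<le> D" using hazard[of \<epsilon>] \<epsilon> by (simp add: D_def)
  have eq: "L1 \<alpha> \<beta> r g lam \<epsilon> + q \<alpha> \<beta> r g lam \<epsilon> * (V - R0) = J + exp (- r * \<epsilon> - \<Lambda> \<epsilon>) * N"
  proof -
    have "exp (- (r + \<alpha> + \<beta>) * \<epsilon> - \<Lambda> \<epsilon>) = exp (- r * \<epsilon> - \<Lambda> \<epsilon>) * exp (- (\<alpha> + \<beta>) * \<epsilon>)"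
      by (simp add: exp_add[symmetric] algebra_simps)
    moreover have "q \<alpha> \<beta> r g lam \<epsilon> = p * exp (- (r + \<alpha> + \<beta>) * \<epsilon> - \<Lambda> \<epsilon>) * exp (- \<Gamma> \<epsilon> (catch \<epsilon>) - (r - \<alpha> + \<beta>) * (catch \<epsilon> + follow \<epsilon>))"
      by (simp add: q_def Let_def p_def mult.assoc mult_exp_exp algebra_simps)
    ultimately show ?thesis
      unfolding L1_def J_def N_def Lv_def leader_value_eq_L2[OF \<epsilon> half] p_def[symmetric] by (simp add: algebra_simps)
  qed
  have "E * (L1 \<alpha> \<beta> r g lam \<epsilon> + q \<alpha> \<beta> r g lam \<epsilon> * (V - R0)) = E * J + exp (- r * \<epsilon> - \<Lambda> \<epsilon>) * (E * N)"
    unfolding eq by (simp add: algebra_simps)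
  also have "\<dots> \<le> integral {t..t + \<epsilon>} (flow k t Y) + D * (E * N)"
    using I D N0 by (intro add_mono mult_right_mono) (auto simp: E_def)
  finally have "ennreal (E * (L1 \<alpha> \<beta> r g lam \<epsilon> + q \<alpha> \<beta> r g lam \<epsilon> * (V - R0)))
     \<le> ennreal (integral {t..t + \<epsilon>} (flow k t Y) + D * (E * N))" by (rule ennreal_leI)
  also have "\<dots> = ennreal (integral {t..t + \<epsilon>} (flow k t Y)) + ennreal D * ennreal (E * N)"
  proof -
    have "0 \<le> E * J" using J0 by (simp add: E_def)
    then have "0 \<le> integral {t..t + \<epsilon>} (flow k t Y)" using I by linarith
    moreover have "0 \<le> E * N" "0 \<le> D" using N0 by (simp_all add: E_def D_def)
    ultimately show ?thesis by (simp add: ennreal_mult)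
  qed
  also have "\<dots> \<le> ennreal (integral {t..t + \<epsilon>} (flow k t Y)) + ennreal D * game_value k \<sigma> (t + \<epsilon>, Y)"
    using cont by (intro add_left_mono mult_left_mono) (simp_all add: N_def)
  also have "\<dots> \<le> game_value k \<sigma> (t, S)" using val by (simp add: D_def)
  finally show "ennreal (exp ((\<alpha> - \<beta>) * snd (snd (S t))) * (L1 \<alpha> \<beta> r g lam \<epsilon> + q \<alpha> \<beta> r g lam \<epsilon> * (V - R0))) \<le> game_value k \<sigma> (t, S)"
    by (simp add: E_def x_def)
qed

end

section \<open>Limit of the guarantee and the exposure ceiling\<close>

lemma exp_chord_le:
  fixes l x :: real
  assumes "0 \<le> l" "l \<le> 1"
  shows "exp (l * x) \<le> (1 - l) + l * exp x"
  using convex_onD[OF exp_convex, of l 0 x] assms by simp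

context development_game
begin

lemma exp_pair_mono:
  assumes "0 \<le> x" "x \<le> y"
  shows "exp (\<alpha> * x) + exp (- \<beta> * x) \<le> exp (\<alpha> * y) + exp (- \<beta> * y)"
proof (rule DERIV_nonneg_imp_nondecreasing[OF assms(2)])
  fix z assume z: "x \<le> z" "z \<le> y"
  have "((\<lambda>z. exp (\<alpha> * z) + exp (- \<beta> * z)) has_real_derivative \<alpha> * exp (\<alpha> * z) - \<beta> * exp (- \<beta> * z)) (at z)"
    by (auto intro!: derivative_eq_intros simp: algebra_simps)
  moreover have "\<beta> * exp (- \<beta> * z) \<le> \<alpha> * exp (\<alpha> * z)"
    using assms z \<alpha>_gt_\<beta> \<beta>_pos by (intro mult_mono) (auto intro: order_trans[of _ 0])
  ultimately show "\<exists>d. ((\<lambda>z. exp (\<alpha> * z) + exp (- \<beta> * z)) has_real_derivative d) (at z) \<and> 0 \<le> d" by force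
qed

lemma average_bound_mono: "0 \<le> x \<Longrightarrow> x \<le> y \<Longrightarrow> average_bound \<alpha> \<beta> x \<le> average_bound \<alpha> \<beta> y"
  unfolding average_bound_def using exp_pair_mono[of x y] \<alpha>_gt_\<beta>
  by (intro max.mono divide_right_mono) (auto intro!: mult_left_mono)

text \<open>For a fixed larger capability M the sum is convex in the smaller one m, so it lies below
  the chord between m = 0 and m = M; these ends give the two branches of
  \<open>average_bound\<close>. Monotonicity then replaces M by s.\<close>

lemma exp_gap_le_average_bound:
  assumes a: "a \<in> {0..s}" and b: "b \<in> {0..s}"
  shows "exp (\<alpha> * a - \<beta> * b) + exp (\<alpha> * b - \<beta> * a) \<le> 2 * average_bound \<alpha> \<beta> s"
proof -
  have *: "exp (\<alpha> * M - \<beta> * m) + exp (\<alpha> * m - \<beta> * M) \<le> 2 * average_bound \<alpha> \<beta> M" if m: "0 \<le> m" "m \<le> M" for m M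
  proof (cases "M = 0")
    case True
    then show ?thesis using m by (simp add: average_bound_def)
  next
    case False
    have "(exp (\<alpha> * M) + exp (- \<beta> * M)) / 2 \<le> average_bound \<alpha> \<beta> M"
      unfolding average_bound_def by (rule max.cobounded2)
    moreover have "exp ((\<alpha> - \<beta>) * M) \<le> average_bound \<alpha> \<beta> M"
      unfolding average_bound_def by (rule max.cobounded1)
    ultimately have ends: "exp (\<alpha> * M) + exp (- \<beta> * M) \<le> 2 * average_bound \<alpha> \<beta> M"
        "2 * exp ((\<alpha> - \<beta>) * M) \<le> 2 * average_bound \<alpha> \<beta> M" by simp_all
    define l where "l = m / M"
    have l: "0 \<le> l" "l \<le> 1" "l * M = m" using m False by (auto simp: l_def)
    have 1: "exp (- \<beta> * m) \<le> (1 - l) + l * exp (- \<beta> * M)"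
      using exp_chord_le[OF l(1,2), of "- \<beta> * M"] l(3) by (simp add: mult.left_commute)
    have 2: "exp (\<alpha> * m) \<le> (1 - l) + l * exp (\<alpha> * M)"
      using exp_chord_le[OF l(1,2), of "\<alpha> * M"] l(3) by (simp add: mult.left_commute)
    have "exp (\<alpha> * M - \<beta> * m) + exp (\<alpha> * m - \<beta> * M) = exp (\<alpha> * M) * exp (- \<beta> * m) + exp (- \<beta> * M) * exp (\<alpha> * m)"
      by (simp add: exp_add[symmetric])
    also have "\<dots> \<le> exp (\<alpha> * M) * ((1 - l) + l * exp (- \<beta> * M)) + exp (- \<beta> * M) * ((1 - l) + l * exp (\<alpha> * M))"
      using 1 2 by (intro add_mono mult_left_mono) auto
    also have "\<dots> = (1 - l) * (exp (\<alpha> * M) + exp (- \<beta> * M)) + l * (2 * (exp (\<alpha> * M) * exp (- \<beta> * M)))"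
      by (simp add: algebra_simps)
    also have "exp (\<alpha> * M) * exp (- \<beta> * M) = exp ((\<alpha> - \<beta>) * M)" by (simp add: exp_add[symmetric] algebra_simps)
    also have "(1 - l) * (exp (\<alpha> * M) + exp (- \<beta> * M)) + l * (2 * exp ((\<alpha> - \<beta>) * M))
       \<le> (1 - l) * (2 * average_bound \<alpha> \<beta> M) + l * (2 * average_bound \<alpha> \<beta> M)"
      using l ends by (intro add_mono mult_left_mono) auto
    also have "\<dots> = 2 * average_bound \<alpha> \<beta> M" by (simp add: algebra_simps)
    finally show ?thesis .
  qed
  have "exp (\<alpha> * a - \<beta> * b) + exp (\<alpha> * b - \<beta> * a) \<le> 2 * average_bound \<alpha> \<beta> (max a b)"
    using *[of "min a b" "max a b"] a b by (cases "a \<le> b") (auto simp: min_def max_def)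
  also have "\<dots> \<le> 2 * average_bound \<alpha> \<beta> s" using average_bound_mono[of "max a b" s] a b by auto
  finally show ?thesis .
qed

lemma average_bound_pos: "average_bound \<alpha> \<beta> s > 0"
  by (simp add: average_bound_def less_max_iff_disj)

lemma average_bound_continuous: "continuous_on A (average_bound \<alpha> \<beta>)"
  unfolding average_bound_def by (auto intro!: continuous_intros)

lemma average_bound_le_exp:
  assumes "0 \<le> s"
  shows "average_bound \<alpha> \<beta> s \<le> exp (\<alpha> * s)"
proof -
  have "exp (- \<beta> * s) \<le> exp (\<alpha> * s)" "exp ((\<alpha> - \<beta>) * s) \<le> exp (\<alpha> * s)"
    using assms \<alpha>_gt_\<beta> \<beta>_pos by (auto intro: order_trans[of _ 0] mult_right_mono)
  then show ?thesis by (simp add: average_bound_def)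
qed

context
  assumes r: "r > \<alpha>" and half: "g > 1 / 2"
begin

lemma q_nonneg: "q \<alpha> \<beta> r g lam \<epsilon> \<ge> 0"
  using r \<alpha>_gt_\<beta> \<beta>_pos by (simp add: q_def Let_def)

definition guarantee_term :: "real \<Rightarrow> real \<Rightarrow> real" where
  "guarantee_term V \<epsilon> = L1 \<alpha> \<beta> r g lam \<epsilon> + q \<alpha> \<beta> r g lam \<epsilon> * (V - R0)"

abbreviation "Vn \<equiv> guarantee_seq \<alpha> \<beta> r g lam"

lemma guarantee_seq_Suc: "Vn (Suc n) = max R0 (SUP \<epsilon>\<in>{0<..}. guarantee_term (Vn n) \<epsilon>)"
  by (simp add: guarantee_term_def)

declare guarantee_seq.simps(2) [simp del]

lemma guarantee_seq_ge: "Vn n \<ge> R0"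
  by (cases n) (simp_all add: guarantee_seq_Suc)

lemma guaranteed_max:
  assumes "guaranteed V" "guaranteed W"
  shows "guaranteed (max V W)"
  using assms by (simp add: max_def)

text \<open>Since values are finite, a guarantee is an upper bound on V by one real number per
  equilibrium, firm and history. In this form, with its converse below, it is stable under suprema
  and limits.\<close>

lemma guaranteedD_real:
  assumes V: "guaranteed V" and \<sigma>: "spe \<alpha> \<beta> r g lam \<sigma>" and h: "feasible_history g (t, S)"
    and S: "capability k (S t) = snd (snd (S t))" "capability (other k) (S t) \<le> snd (snd (S t))"
  shows "V \<le> enn2real (game_value k \<sigma> (t, S)) / exp ((\<alpha> - \<beta>) * snd (snd (S t)))"
proof -
  have fin: "game_value k \<sigma> (t, S) < top"
    using \<sigma> by (intro game_value_finite h r) (simp add: spe_def)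
  have "ennreal (exp ((\<alpha> - \<beta>) * snd (snd (S t))) * V) \<le> game_value k \<sigma> (t, S)"
    using V \<sigma> h S unfolding guaranteed_def by blast
  moreover obtain v where "game_value k \<sigma> (t, S) = ennreal v" "v \<ge> 0"
    using fin by (cases "game_value k \<sigma> (t, S)" rule: ennreal_cases) auto
  ultimately have "exp ((\<alpha> - \<beta>) * snd (snd (S t))) * V \<le> enn2real (game_value k \<sigma> (t, S))"
    by simp
  then show ?thesis by (simp add: pos_le_divide_eq mult.commute)
qed

lemma guaranteed_of_real_bound:
  assumes "\<And>\<sigma> t S k. spe \<alpha> \<beta> r g lam \<sigma> \<Longrightarrow> feasible_history g (t, S) \<Longrightarrow>
     capability k (S t) = snd (snd (S t)) \<Longrightarrow> capability (other k) (S t) \<le> snd (snd (S t)) \<Longrightarrow>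
     V \<le> enn2real (game_value k \<sigma> (t, S)) / exp ((\<alpha> - \<beta>) * snd (snd (S t)))"
  shows "guaranteed V"
  unfolding guaranteed_def
proof (intro allI impI)
  fix \<sigma> t S k
  assume \<sigma>: "spe \<alpha> \<beta> r g lam \<sigma>" and h: "feasible_history g (t, S)"
    and S: "capability k (S t) = snd (snd (S t))" "capability (other k) (S t) \<le> snd (snd (S t))"
  have fin: "game_value k \<sigma> (t, S) < top"
    using \<sigma> by (intro game_value_finite h r) (simp add: spe_def)
  have "exp ((\<alpha> - \<beta>) * snd (snd (S t))) * V \<le> enn2real (game_value k \<sigma> (t, S))"
    using assms[OF \<sigma> h S] by (simp add: pos_le_divide_eq mult.commute)
  then show "ennreal (exp ((\<alpha> - \<beta>) * snd (snd (S t))) * V) \<le> game_value k \<sigma> (t, S)"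
    using fin by (metis ennreal_enn2real ennreal_leI)
qed

lemma guaranteed_seq: "guaranteed (Vn n)"
proof (induction n)
  case 0
  show ?case using guaranteed_race_value by simp
next
  case (Suc n)
  have nonneg: "Vn n \<ge> 0" using guarantee_seq_ge[of n] race_value_pos by linarith
  have "guaranteed (SUP \<epsilon>\<in>{0<..}. guarantee_term (Vn n) \<epsilon>)"
  proof (rule guaranteed_of_real_bound, rule cSUP_least)
    fix \<sigma> t S k \<epsilon>
    assume *: "spe \<alpha> \<beta> r g lam \<sigma>" "feasible_history g (t, S)"
      "capability k (S t) = snd (snd (S t))" "capability (other k) (S t) \<le> snd (snd (S t))" and "\<epsilon> \<in> {0 :: real<..}"
    have "guaranteed (guarantee_term (Vn n) \<epsilon>)"
      unfolding guarantee_term_def using \<open>\<epsilon> \<in> _\<close> by (intro guaranteed_step Suc nonneg half r) auto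
    then show "guarantee_term (Vn n) \<epsilon> \<le> enn2real (game_value k \<sigma> (t, S)) / exp ((\<alpha> - \<beta>) * snd (snd (S t)))"
      using * by (rule guaranteedD_real)
  qed auto
  then show ?case unfolding guarantee_seq_Suc by (intro guaranteed_max guaranteed_race_value)
qed

lemma feasible_tie_history: "feasible_history g (0, \<lambda>_. p)"
  by (auto simp: feasible_history_iff[OF g] bounded_speed_def)

text \<open>Any equilibrium bounds every guaranteed number by its finite value at a tie, so the
  suprema are genuine, the sequence is bounded and \<open>lim\<close> is a true limit. Monotonicity
  is by induction, since \<open>q\<close> is nonnegative.\<close>

lemma guarantee_seq_convergent:
  assumes \<sigma>: "spe \<alpha> \<beta> r g lam \<sigma>"
  shows "Vn \<longlonglongrightarrow> guarantee \<alpha> \<beta> r g lam"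
proof -
  \<comment> \<open>At the tie at 0 the normalizing factor is 1.\<close>
  define B where "B = enn2real (game_value Firm1 \<sigma> (0, \<lambda>_. (0, 0, 0)))"
  have bound: "V \<le> B" if "guaranteed V" for V
    using guaranteedD_real[OF that \<sigma> feasible_tie_history, of Firm1 "(0, 0, 0)"] by (simp add: B_def)
  have term_bound: "guarantee_term (Vn n) \<epsilon> \<le> B" if "\<epsilon> \<in> {0<..}" for n \<epsilon>
  proof (rule bound)
    have "Vn n \<ge> 0" using guarantee_seq_ge[of n] race_value_pos by linarith
    then show "guaranteed (guarantee_term (Vn n) \<epsilon>)"
      unfolding guarantee_term_def using that by (intro guaranteed_step guaranteed_seq half r) auto
  qed
  have mono: "Vn n \<le> Vn (Suc n)" for n
  proof (induction n)
    case 0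
    show ?case by (simp add: guarantee_seq_Suc)
  next
    case (Suc n)
    have "(SUP \<epsilon>\<in>{0<..}. guarantee_term (Vn n) \<epsilon>) \<le> (SUP \<epsilon>\<in>{0<..}. guarantee_term (Vn (Suc n)) \<epsilon>)"
    proof (rule cSUP_mono)
      show "bdd_above (guarantee_term (Vn (Suc n)) ` {0<..})"
        by (rule bdd_aboveI2[of _ _ B]) (rule term_bound)
      show "\<exists>m\<in>{0<..}. guarantee_term (Vn n) \<epsilon> \<le> guarantee_term (Vn (Suc n)) m" if "\<epsilon> \<in> {0<..}" for \<epsilon>
        using that Suc q_nonneg by (intro bexI[of _ \<epsilon>]) (auto simp: guarantee_term_def intro!: mult_left_mono)
    qed simp
    then show ?case unfolding guarantee_seq_Suc by (rule max.mono[OF order_refl])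
  qed
  have "convergent Vn"
  proof (rule Bseq_mono_convergent)
    show "Bseq Vn"
    proof (rule BseqI')
      show "norm (Vn n) \<le> B" for n
        using bound[OF guaranteed_seq, of n] guarantee_seq_ge[of n] race_value_pos by simp
    qed
    show "\<forall>m n. m \<le> n \<longrightarrow> Vn m \<le> Vn n" using lift_Suc_mono_le[of Vn] mono by blast
  qed
  then show ?thesis by (simp add: guarantee_def convergent_LIMSEQ_iff)
qed

lemma guaranteed_guarantee: "guaranteed (guarantee \<alpha> \<beta> r g lam)"
proof (rule guaranteed_of_real_bound)
  fix \<sigma> t S k
  assume \<sigma>: "spe \<alpha> \<beta> r g lam \<sigma>" and *: "feasible_history g (t, S)"
      "capability k (S t) = snd (snd (S t))" "capability (other k) (S t) \<le> snd (snd (S t))"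
  show "guarantee \<alpha> \<beta> r g lam \<le> enn2real (game_value k \<sigma> (t, S)) / exp ((\<alpha> - \<beta>) * snd (snd (S t)))"
    by (rule LIMSEQ_le_const2[OF guarantee_seq_convergent[OF \<sigma>]])
      (use guaranteedD_real[OF guaranteed_seq \<sigma> *] in auto)
qed

lemma spe_tie_guarantee:
  assumes "spe \<alpha> \<beta> r g lam \<sigma>"
  shows "ennreal (exp ((\<alpha> - \<beta>) * x0) * guarantee \<alpha> \<beta> r g lam) \<le> game_value i \<sigma> (tie_history x0)"
proof -
  have "capability i (x0, x0, x0) = x0" "capability (other i) (x0, x0, x0) = x0" by (cases i; simp)+
  then show ?thesis
    using guaranteed_guarantee assms feasible_tie_history[of "(x0, x0, x0)"]
    unfolding guaranteed_def tie_history_def by fastforce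
qed

lemma guarantee_nonneg:
  assumes "spe \<alpha> \<beta> r g lam \<sigma>"
  shows "guarantee \<alpha> \<beta> r g lam \<ge> 0"
proof (rule LIMSEQ_le_const[OF guarantee_seq_convergent[OF assms]])
  show "\<exists>N. \<forall>n\<ge>N. 0 \<le> Vn n" using guarantee_seq_ge race_value_pos by (meson less_imp_le order_trans)
qed

definition benchmark_flow :: "real \<Rightarrow> real" where
  "benchmark_flow s = exp (- r * s) * average_bound \<alpha> \<beta> s"

lemma benchmark_flow_pos: "benchmark_flow s > 0"
  by (simp add: benchmark_flow_def average_bound_pos)

lemma benchmark_flow_continuous: "continuous_on A benchmark_flow"
  unfolding benchmark_flow_def by (intro continuous_intros average_bound_continuous)

lemma benchmark_flow_integrable:
  assumes "0 \<le> t"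
  shows "benchmark_flow integrable_on {t..}"
proof (rule continuous_bounded_integrable_halfline[OF benchmark_flow_continuous])
  show "(\<lambda>s. exp (- (r - \<alpha>) * s)) integrable_on {t..}"
    using integrable_on_exp_minus_to_infinity[of "r - \<alpha>"] r by simp
  show "\<bar>benchmark_flow s\<bar> \<le> exp (- (r - \<alpha>) * s)" if "t \<le> s" for s
  proof -
    have "benchmark_flow s \<le> exp (- r * s) * exp (\<alpha> * s)"
      unfolding benchmark_flow_def using that assms by (intro mult_left_mono average_bound_le_exp) auto
    also have "\<dots> = exp (- (r - \<alpha>) * s)" by (simp add: exp_add[symmetric] algebra_simps)
    finally show ?thesis using benchmark_flow_pos[of s] by simp
  qed
qed

lemma value_ceiling_eq: "value_ceiling \<alpha> \<beta> r g lam t z =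
  integral {0..t} (\<lambda>s. benchmark_flow s * exp (- max 0 (z - \<Lambda> t + \<Lambda> s))) + exp (- z) * integral {t..} benchmark_flow"
  by (simp add: value_ceiling_def benchmark_flow_def[abs_def])

lemma value_ceiling_continuous: "continuous_on A (value_ceiling \<alpha> \<beta> r g lam t)"
proof -
  have "continuous_on UNIV (\<lambda>z. integral (cbox 0 t) (\<lambda>s. benchmark_flow s * exp (- max 0 (z - \<Lambda> t + \<Lambda> s))))"
  proof (rule integral_continuous_on_param)
    have "continuous_on (UNIV \<times> cbox 0 t) (\<lambda>p. benchmark_flow (snd p) * exp (- max 0 (fst p - \<Lambda> t + \<Lambda> (snd p))))"
      by (intro continuous_intros continuous_on_compose2[OF race_hazard_continuous] continuous_on_compose2[OF benchmark_flow_continuous[of UNIV]])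
        auto
    then show "continuous_on (UNIV \<times> cbox 0 t) (\<lambda>(z, s). benchmark_flow s * exp (- max 0 (z - \<Lambda> t + \<Lambda> s)))"
      by (simp add: case_prod_unfold)
  qed
  then have "continuous_on A (\<lambda>z. integral {0..t} (\<lambda>s. benchmark_flow s * exp (- max 0 (z - \<Lambda> t + \<Lambda> s))))"
    by (auto intro: continuous_on_subset)
  then show ?thesis
    unfolding value_ceiling_eq[abs_def] by (intro continuous_intros)
qed

text \<open>\<open>GREATEST\<close> denotes a maximum only if one exists: continuity in z makes the
  set of candidates compact, and the given z shows it nonempty.\<close>

lemma exposure_ceiling_ge:
  assumes "z \<in> {0..\<Lambda> t}" "value_ceiling \<alpha> \<beta> r g lam t z \<ge> guarantee \<alpha> \<beta> r g lam"
  shows "z \<le> exposure_ceiling \<alpha> \<beta> r g lam t"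
proof -
  define P where "P z \<longleftrightarrow> z \<in> {0..\<Lambda> t} \<and> value_ceiling \<alpha> \<beta> r g lam t z \<ge> guarantee \<alpha> \<beta> r g lam" for z
  have "{z. P z} = {0..\<Lambda> t} \<inter> {z. guarantee \<alpha> \<beta> r g lam \<le> value_ceiling \<alpha> \<beta> r g lam t z}"
    by (auto simp: P_def)
  moreover have "closed {z. guarantee \<alpha> \<beta> r g lam \<le> value_ceiling \<alpha> \<beta> r g lam t z}"
    by (intro closed_Collect_le continuous_intros value_ceiling_continuous)
  ultimately have "compact {z. P z}" by (simp add: compact_Int_closed)
  moreover have "{z. P z} \<noteq> {}" using assms by (auto simp: P_def)
  ultimately obtain m where m: "P m" "\<And>y. P y \<Longrightarrow> y \<le> m"
    using compact_attains_sup[of "{z. P z}"] by auto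
  then have "exposure_ceiling \<alpha> \<beta> r g lam t = m"
    unfolding exposure_ceiling_def P_def[symmetric] by (rule Greatest_equality)
  then show ?thesis using m(2) assms by (simp add: P_def)
qed

text \<open>Both firms obtain the guarantee on this path, so their average payoff does too, whereas
  a path with accumulated hazard z at t averages at most \<open>value_ceiling\<close> at z. So z
  meets the defining condition of the ceiling.\<close>

lemma cum_hazard_le_exposure_ceiling:
  assumes Y: "bounded_speed g {0..} Y" and Y0: "Y 0 = (x0, x0, x0)" and t: "t \<ge> 0"
    and vals: "\<And>i. ennreal (exp ((\<alpha> - \<beta>) * x0) * guarantee \<alpha> \<beta> r g lam) \<le> value_of i 0 Y"
    and nonneg: "guarantee \<alpha> \<beta> r g lam \<ge> 0"
  shows "cum_hazard lam Y 0 t \<le> exposure_ceiling \<alpha> \<beta> r g lam t"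
proof (rule exposure_ceiling_ge)
  define z where "z = cum_hazard lam Y 0 t"
  define E where "E = exp ((\<alpha> - \<beta>) * x0)"
  have safe: "exposure (Y 0) \<le> 0" by (simp add: Y0)
  have haz: "cum_hazard lam Y 0 s \<le> \<Lambda> s" if "0 \<le> s" for s
    using race_cum_hazard_le[OF Y order_refl that safe] by simp
  show z: "cum_hazard lam Y 0 t \<in> {0..\<Lambda> t}"
    using haz[OF t] cum_hazard_nonneg[OF Y order_refl] by auto
  \<comment> \<open>Between s and t at most \<Lambda> t - \<Lambda> s can accrue, so a total of z at
    t forces the rest to be present already at s.\<close>
  have early: "max 0 (z - \<Lambda> t + \<Lambda> s) \<le> cum_hazard lam Y 0 s" if s: "0 \<le> s" "s \<le> t" for s
  proof -
    have "cum_hazard lam Y s t \<le> integral {s..t} (\<lambda>u. lamhat ((1 - g) * u))"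
    proof (rule cum_hazard_le[OF Y s(1) _ lamhat_integrable])
      fix u assume u: "u \<in> {s..t}"
      have "exposure (Y u) \<le> (1 - g) * u"
        using capability_increment[OF Y, of 0 u Firm1] capability_increment[OF Y, of 0 u Firm2]
          position_increment[OF Y, of 0 u] u s
        by (auto simp: exposure_capability[of _ Firm1] Y0 algebra_simps)
      then show "lam (exposure (Y u)) \<le> lamhat ((1 - g) * u)"
        by (meson lam_le_lamhat lamhat_mono order_trans)
    qed
    also have "\<dots> = \<Lambda> t - \<Lambda> s"
    proof -
      have "\<Lambda> s + integral {s..t} (\<lambda>u. lamhat ((1 - g) * u)) = \<Lambda> t"
        unfolding race_hazard_lamhat using s lamhat_integrable by (intro Henstock_Kurzweil_Integration.integral_combine) auto
      then show ?thesis by simp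
    qed
    finally show ?thesis
      using cum_hazard_add[OF Y order_refl s] cum_hazard_nonneg[OF Y order_refl, of s] by (simp add: z_def)
  qed
  have late: "z \<le> cum_hazard lam Y 0 s" if "t \<le> s" for s
    unfolding z_def by (rule cum_hazard_mono[OF Y order_refl t that])
  have sum: "flow Firm1 0 Y s + flow Firm2 0 Y s \<le> 2 * E * (benchmark_flow s * exp (- cum_hazard lam Y 0 s))" if s: "0 \<le> s" for s
  proof -
    define a b where "a = capability Firm1 (Y s) - x0" and "b = capability Firm2 (Y s) - x0"
    have ab: "a \<in> {0..s}" "b \<in> {0..s}"
      using capability_increment[OF Y, of 0 s Firm1] capability_increment[OF Y, of 0 s Firm2] s
      by (auto simp: a_def b_def Y0)
    have "flow Firm1 0 Y s + flow Firm2 0 Y s =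
        E * (exp (- r * s) * exp (- cum_hazard lam Y 0 s)) * (exp (\<alpha> * a - \<beta> * b) + exp (\<alpha> * b - \<beta> * a))"
      by (simp add: flow_def E_def a_def b_def distrib_left exp_add[symmetric] algebra_simps)
    also have "\<dots> \<le> E * (exp (- r * s) * exp (- cum_hazard lam Y 0 s)) * (2 * average_bound \<alpha> \<beta> s)"
      by (intro mult_left_mono exp_gap_le_average_bound ab) (simp add: E_def)
    finally show ?thesis by (simp add: benchmark_flow_def mult_ac)
  qed
  define I1 where "I1 = integral {0..t} (\<lambda>s. benchmark_flow s * exp (- max 0 (z - \<Lambda> t + \<Lambda> s)))"
  define I2 where "I2 = integral {t..} benchmark_flow"
  have c1: "continuous_on {0..t} (\<lambda>s. 2 * E * (benchmark_flow s * exp (- max 0 (z - \<Lambda> t + \<Lambda> s))))"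
    by (intro continuous_intros benchmark_flow_continuous continuous_on_subset[OF race_hazard_continuous]) auto
  have c2: "continuous_on {t..} (\<lambda>s. 2 * E * exp (- z) * benchmark_flow s)"
    by (intro continuous_intros benchmark_flow_continuous)
  have I1: "(\<integral>\<^sup>+s\<in>{0..t}. ennreal (2 * E * (benchmark_flow s * exp (- max 0 (z - \<Lambda> t + \<Lambda> s)))) \<partial>lborel) = ennreal (2 * E * I1)"
    using nn_integral_Icc_eq_integral[OF c1] benchmark_flow_pos by (simp add: E_def I1_def less_imp_le)
  have "((\<lambda>s. 2 * E * exp (- z) * benchmark_flow s) has_integral 2 * E * exp (- z) * I2) {t..}"
    unfolding I2_def by (intro has_integral_mult_right integrable_integral benchmark_flow_integrable t)
  then have I2: "(\<integral>\<^sup>+s\<in>{t..}. ennreal (2 * E * exp (- z) * benchmark_flow s) \<partial>lborel) = ennreal (2 * E * exp (- z) * I2)"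
    by (intro nn_integral_has_integral_lebesgue') (simp add: E_def benchmark_flow_pos less_imp_le)
  have m: "(\<lambda>u. ennreal (flow i 0 Y u) * indicator {0..} u) \<in> borel_measurable borel" for i
    by (rule continuous_on_borel_measurable_indicator[OF flow_continuous[OF Y]]) auto
  have m1: "(\<lambda>s. ennreal (2 * E * (benchmark_flow s * exp (- max 0 (z - \<Lambda> t + \<Lambda> s)))) * indicator {0..t} s) \<in> borel_measurable borel"
    by (rule continuous_on_borel_measurable_indicator[OF c1]) auto
  have m2: "(\<lambda>s. ennreal (2 * E * exp (- z) * benchmark_flow s) * indicator {t..} s) \<in> borel_measurable borel"
    by (rule continuous_on_borel_measurable_indicator[OF c2]) auto
  have nn: "I1 \<ge> 0" "I2 \<ge> 0"
    unfolding I1_def I2_def using benchmark_flow_pos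
    by (auto intro!: integral_nonneg benchmark_flow_integrable t integrable_continuous_real continuous_intros
        benchmark_flow_continuous continuous_on_subset[OF race_hazard_continuous] simp: less_imp_le)
  have "ennreal (2 * (E * guarantee \<alpha> \<beta> r g lam)) = ennreal (E * guarantee \<alpha> \<beta> r g lam) + ennreal (E * guarantee \<alpha> \<beta> r g lam)"
    using nonneg by (subst ennreal_plus[symmetric]) (auto simp: E_def)
  also have "\<dots> \<le> value_of Firm1 0 Y + value_of Firm2 0 Y"
    unfolding E_def by (intro add_mono vals)
  also have "\<dots> = (\<integral>\<^sup>+u. ennreal (flow Firm1 0 Y u) * indicator {0..} u + ennreal (flow Firm2 0 Y u) * indicator {0..} u \<partial>lborel)"
    unfolding path_payoff_flow using m by (subst nn_integral_add) auto
  also have "\<dots> \<le> (\<integral>\<^sup>+s. ennreal (2 * E * (benchmark_flow s * exp (- max 0 (z - \<Lambda> t + \<Lambda> s)))) * indicator {0..t} s +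
      ennreal (2 * E * exp (- z) * benchmark_flow s) * indicator {t..} s \<partial>lborel)"
  proof (rule nn_integral_mono)
    fix s
    have le: "ennreal (flow Firm1 0 Y s) + ennreal (flow Firm2 0 Y s) \<le> ennreal (2 * E * (benchmark_flow s * exp (- c)))"
      if "0 \<le> s" "c \<le> cum_hazard lam Y 0 s" for c
    proof -
      have "flow Firm1 0 Y s + flow Firm2 0 Y s \<le> 2 * E * (benchmark_flow s * exp (- cum_hazard lam Y 0 s))" by (rule sum[OF that(1)])
      also have "\<dots> \<le> 2 * E * (benchmark_flow s * exp (- c))"
        using that(2) benchmark_flow_pos[of s] by (intro mult_left_mono) (auto simp: E_def)
      finally show ?thesis
        using flow_pos[OF Y] by (subst ennreal_plus[symmetric]) (auto intro: less_imp_le ennreal_leI)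
    qed
    \<comment> \<open>The date t belongs to both intervals; there the second summand only enlarges
      the bound.\<close>
    consider "s < 0" | "0 \<le> s" "s \<le> t" | "t < s" "0 \<le> s" using t by linarith
    then show "ennreal (flow Firm1 0 Y s) * indicator {0..} s + ennreal (flow Firm2 0 Y s) * indicator {0..} s
      \<le> ennreal (2 * E * (benchmark_flow s * exp (- max 0 (z - \<Lambda> t + \<Lambda> s)))) * indicator {0..t} s +
      ennreal (2 * E * exp (- z) * benchmark_flow s) * indicator {t..} s"
    proof cases
      case 2
      have "ennreal (flow Firm1 0 Y s) + ennreal (flow Firm2 0 Y s)
        \<le> ennreal (2 * E * (benchmark_flow s * exp (- max 0 (z - \<Lambda> t + \<Lambda> s))))"
        by (rule le[OF 2(1) early[OF 2]])
      then show ?thesis using 2 by (simp add: add_increasing2)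
    next
      case 3
      have "ennreal (flow Firm1 0 Y s) + ennreal (flow Firm2 0 Y s) \<le> ennreal (2 * E * (benchmark_flow s * exp (- z)))"
        using 3 by (intro le late) auto
      then show ?thesis using 3 by (simp add: mult_ac)
    qed simp
  qed
  also have "\<dots> = ennreal (2 * E * I1) + ennreal (2 * E * exp (- z) * I2)"
    using m1 m2 by (subst nn_integral_add) (auto simp: I1 I2)
  also have "\<dots> = ennreal (2 * (E * (I1 + exp (- z) * I2)))"
    using nn by (subst ennreal_plus[symmetric]) (auto simp: E_def algebra_simps)
  finally have "2 * (E * guarantee \<alpha> \<beta> r g lam) \<le> 2 * (E * (I1 + exp (- z) * I2))"
    using nn by (subst (asm) ennreal_le_iff) (auto simp: E_def)
  then show "guarantee \<alpha> \<beta> r g lam \<le> value_ceiling \<alpha> \<beta> r g lam t (cum_hazard lam Y 0 t)"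
    by (simp add: value_ceiling_eq z_def[symmetric] I1_def[symmetric] I2_def[symmetric] E_def)
qed

end

section \<open>Equilibrium outcomes from a tie\<close>

lemma spe_outcome_joint_racing:
  assumes cond1: "effective_hazard \<alpha> \<beta> r g lam < (1 - g) * (\<alpha> - \<beta>)"
    and cond2: "r + effective_hazard \<alpha> \<beta> r g lam > (\<alpha>\<^sup>2 + \<beta>\<^sup>2) / (\<alpha> - \<beta>)"
    and Y: "spe_outcome \<alpha> \<beta> r g lam (tie_history x0) Y" and t: "t \<ge> 0"
  shows "capability i (Y t) = capability i (Y 0) + t"
proof -
  obtain \<sigma> where \<sigma>: "spe \<alpha> \<beta> r g lam \<sigma>" and cont: "Y \<in> continuations g \<sigma> (0, \<lambda>_. (x0, x0, x0))"
    and val: "\<And>i. value_of i 0 Y = game_value i \<sigma> (0, \<lambda>_. (x0, x0, x0))"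
    using Y by (auto simp: spe_outcome_def tie_history_def)
  have st: "is_strategy g (\<sigma> i)" for i using \<sigma> by (simp add: spe_def)
  have h: "feasible_history g (0, \<lambda>_. (x0, x0, x0))"
    by (auto simp: feasible_history_iff[OF g] bounded_speed_def)
  have Yb: "bounded_speed g {0..} Y"
    by (rule continuation_bounded_speed[where \<sigma> = \<sigma>, OF g st h cont])
  have Y0: "Y 0 = (x0, x0, x0)" using cont by (auto simp: continuations_def)
  have vals: "ennreal (exp ((\<alpha> - \<beta>) * x0) * R0) \<le> value_of i 0 Y" for i
    using race_guarantee[OF \<sigma> h, of i] unfolding val by (cases i) (simp_all add: algebra_simps)
  have R: "R0 > 0" by (rule race_value_pos)
  \<comment> \<open>\<open>1 / R0\<close> is \<open>\<rho>\<close> plus the effective hazard, so the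
    first hypothesis bounds it by \<open>r - g * (\<alpha> - \<beta>)\<close>.\<close>
  have patient: "1 < R0 * (r - g * (\<alpha> - \<beta>))"
  proof -
    have "1 / R0 < r - g * (\<alpha> - \<beta>)" using cond1 by (simp add: effective_hazard_def algebra_simps)
    then show ?thesis using R by (simp add: field_simps)
  qed
  \<comment> \<open>After multiplication by \<alpha> - \<beta> the second hypothesis compares
    \<open>\<alpha>\<^sup>2 + \<beta>\<^sup>2\<close> with
    \<open>(\<alpha> - \<beta>)\<^sup>2\<close> plus \<open>(\<alpha> - \<beta>) / R0\<close>; the
    difference of the squares is \<open>2 * \<alpha> * \<beta>\<close>.\<close>
  have asym: "R0 * (2 * \<alpha> * \<beta>) < \<alpha> - \<beta>"
  proof -
    have "(\<alpha>\<^sup>2 + \<beta>\<^sup>2) / (\<alpha> - \<beta>) < 1 / R0 + (\<alpha> - \<beta>)" using cond2 by (simp add: effective_hazard_def algebra_simps)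
    then have "\<alpha>\<^sup>2 + \<beta>\<^sup>2 < (1 / R0 + (\<alpha> - \<beta>)) * (\<alpha> - \<beta>)" using \<alpha>_gt_\<beta> by (simp add: pos_divide_less_eq)
    then have "2 * \<alpha> * \<beta> < (\<alpha> - \<beta>) / R0" by (simp add: power2_eq_square algebra_simps)
    then show ?thesis using R by (simp add: pos_less_divide_eq mult.commute)
  qed
  have "capability i (Y t) = x0 + t" "capability i (Y 0) = x0"
    using joint_racing[OF Yb Y0 vals patient asym] t by (auto simp: Y0) (cases i; simp)
  then show ?thesis by simp
qed

lemma spe_outcome_disaster_prob:
  assumes r: "r > \<alpha>" and half: "g > 1 / 2"
    and Y: "spe_outcome \<alpha> \<beta> r g lam (tie_history x0) Y" and t: "t \<ge> 0"
  shows "disaster_prob lam Y t \<le> 1 - exp (- exposure_ceiling \<alpha> \<beta> r g lam t)"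
proof -
  obtain \<sigma> where \<sigma>: "spe \<alpha> \<beta> r g lam \<sigma>" and cont: "Y \<in> continuations g \<sigma> (0, \<lambda>_. (x0, x0, x0))"
    and val: "\<And>i. value_of i 0 Y = game_value i \<sigma> (tie_history x0)"
    using Y by (auto simp: spe_outcome_def tie_history_def)
  have st: "is_strategy g (\<sigma> i)" for i using \<sigma> by (simp add: spe_def)
  have h: "feasible_history g (0, \<lambda>_. (x0, x0, x0))"
    by (auto simp: feasible_history_iff[OF g] bounded_speed_def)
  have Yb: "bounded_speed g {0..} Y"
    by (rule continuation_bounded_speed[where \<sigma> = \<sigma>, OF g st h cont])
  have Y0: "Y 0 = (x0, x0, x0)" using cont by (auto simp: continuations_def)
  have "cum_hazard lam Y 0 t \<le> exposure_ceiling \<alpha> \<beta> r g lam t"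
    by (rule cum_hazard_le_exposure_ceiling[OF r half Yb Y0 t _ guarantee_nonneg[OF r half \<sigma>]])
      (simp add: val spe_tie_guarantee[OF r half \<sigma>])
  then show ?thesis by (simp add: disaster_prob_def)
qed

end

theorem theorem2:
  fixes \<alpha> \<beta> r g lam0 x0 :: real and \<phi> lam :: "real \<Rightarrow> real"
  assumes "\<alpha> > \<beta>" and "\<beta> > 0" and "r > \<alpha> - \<beta>" and "0 < g" and "g < 1"
    and "lam0 \<ge> 0"
    and "continuous_on {0..} \<phi>" and "mono_on {0..} \<phi>" and "concave_on {0..} \<phi>"
    and "\<exists>\<phi>' \<phi>''. (\<forall>D>0. (\<phi> has_real_derivative \<phi>' D) (at D) \<and>
                          (\<phi>' has_real_derivative \<phi>'' D) (at D)) \<and>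
                  continuous_on {0<..} \<phi>''"
    and "\<phi> 0 = 0"
    and "\<And>D. D \<le> 0 \<Longrightarrow> lam D = 0"
    and "\<And>D. D > 0 \<Longrightarrow> lam D = lam0 + \<phi> D"
  shows
    "(effective_hazard \<alpha> \<beta> r g lam < (1 - g) * (\<alpha> - \<beta>) \<longrightarrow>
      r + effective_hazard \<alpha> \<beta> r g lam > (\<alpha>\<^sup>2 + \<beta>\<^sup>2) / (\<alpha> - \<beta>) \<longrightarrow>
      (\<forall>Y. spe_outcome \<alpha> \<beta> r g lam (tie_history x0) Y \<longrightarrow>
        (\<forall>i. \<forall>t\<ge>0. capability i (Y t) = capability i (Y 0) + t))) \<and>
     (r > \<alpha> \<longrightarrow> g > 1 / 2 \<longrightarrow>
      (\<forall>Y. spe_outcome \<alpha> \<beta> r g lam (tie_history x0) Y \<longrightarrow>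
        (\<forall>t\<ge>0. disaster_prob lam Y t \<le> 1 - exp (- exposure_ceiling \<alpha> \<beta> r g lam t))) \<and>
      (\<forall>\<sigma> i. spe \<alpha> \<beta> r g lam \<sigma> \<longrightarrow>
        payoff \<alpha> \<beta> r g lam i \<sigma> (tie_history x0) \<ge>
          ennreal (exp ((\<alpha> - \<beta>) * x0) * guarantee \<alpha> \<beta> r g lam)))"
proof -
  interpret development_game \<alpha> \<beta> r g lam0 \<phi> lam
    by unfold_locales (use assms in auto)
  show ?thesis
    using spe_outcome_joint_racing spe_outcome_disaster_prob spe_tie_guarantee by blast
qed

end
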